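(* Let $\varphi(x,y)$ be an $I$-stable $L$-formula, let $\mathfrak{p}(x)$ be an $I_x$-wide global $\varphi$-type, and let $M$ be a model. Then there exists an $L(M)$-formula $\psi(y)$ such that for every tuple $b$ that is $I_y$-wide over $M$, $\varphi(x,b)\in\mathfrak{p}$ if and only if $\psi(b)$ holds.
   Context: Fix a complete first-order theory $T$ in a language $L$ with infinite models and work in a monster model $\mathbb{M}$; $x,y$ are finite tuples of variables. An ideal $I_x$ of $L_x(\mathbb{M})$-formulas is a family of formulas in $x$ with parameters closed under implication and finite disjunctions and containing the empty formula. A partial type is $I_x$-wide if it implies no formula in $I_x$; $a$ is $I_x$-wide over $A$ if $\mathrm{tp}(a/A)$ is. $I_x$ is $A$-invariant if $\psi(x,a)\in I_x$, $a\equiv_A a'$ imply $\psi(x,a')\in I_x$; an $A$-invariant ideal is $S_1$ if for every $L$-formula $\psi(x,z)$ and $A$-indiscernible $(a_i)_{i\in\mathbb{N}}$ with $\psi(x,a_0)\wedge\psi(x,a_1)\in I_x$ we get $\psi(x,a_0)\in I_x$. Fix $\emptyset$-invariant $S_1$-ideals $I_x$, $I_y$ and $I=(I_x,I_y)$. A finite sequence of tuples (each in the sort of $x$ or $y$) is $M$-independent if the type of each entry over $M$ and the preceding entries is wide for the corresponding ideal ($I_x$ or $I_y$). $\varphi(x,y)$ is $I$-stable of ladder $k$ if there are no model $M$ and tuple $(a_1,b_1,\ldots,a_k,b_k)$ with $(a_1,b_1,\ldots,a_k,b_k)$ or $(b_k,a_k,\ldots,b_1,a_1)$ $M$-independent and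 $\varphi(a_i,b_j)$ iff $i\le j$; $I$-stable means for some $k$. A global $\varphi$-type is a maximal consistent set of Boolean combinations of formulas $\varphi(x,b)$ with $b\in\mathbb{M}$; it is $I_x$-wide if it implies no formula of $I_x$. *)

theory Defs
  imports Main
begin

unbundle cardinal_syntax

section \<open>First-order syntax\<close>

text \<open>
  Formulas may contain names \<open>Par m\<close> of elements of a structure, so that an \<open>L(A)\<close>-formula is a
  formula all of whose parameters lie in \<open>A\<close>, and an \<open>L\<close>-formula is one without parameters.
  Function and relation symbols are restricted to sets, so that a language may lack either kind.
\<close>

record ('f, 'r) language =
  funs :: "'f set"
  rels :: "'r set"
  farity :: "'f \<Rightarrow> nat"
  rarity :: "'r \<Rightarrow> nat"

datatype ('f, 'm) trm = Var nat | Par 'm | Fn 'f "('f, 'm) trm list"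

datatype ('f, 'r, 'm) fm =
    Bot
  | Eq "('f, 'm) trm" "('f, 'm) trm"
  | Rel 'r "('f, 'm) trm list"
  | Neg "('f, 'r, 'm) fm"
  | Conj "('f, 'r, 'm) fm" "('f, 'r, 'm) fm"
  | Exi nat "('f, 'r, 'm) fm"

definition Disj :: "('f, 'r, 'm) fm \<Rightarrow> ('f, 'r, 'm) fm \<Rightarrow> ('f, 'r, 'm) fm" where
  "Disj \<phi> \<psi> = Neg (Conj (Neg \<phi>) (Neg \<psi>))"

fun wf_trm :: "('f, 'r) language \<Rightarrow> ('f, 'm) trm \<Rightarrow> bool" where
  "wf_trm L (Var v) \<longleftrightarrow> True"
| "wf_trm L (Par m) \<longleftrightarrow> True"
| "wf_trm L (Fn f ts) \<longleftrightarrow> f \<in> funs L \<and> length ts = farity L f \<and> (\<forall>t\<in>set ts. wf_trm L t)"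

primrec wf_fm :: "('f, 'r) language \<Rightarrow> ('f, 'r, 'm) fm \<Rightarrow> bool" where
  "wf_fm L Bot \<longleftrightarrow> True"
| "wf_fm L (Eq t u) \<longleftrightarrow> wf_trm L t \<and> wf_trm L u"
| "wf_fm L (Rel r ts) \<longleftrightarrow> r \<in> rels L \<and> length ts = rarity L r \<and> (\<forall>t\<in>set ts. wf_trm L t)"
| "wf_fm L (Neg \<phi>) \<longleftrightarrow> wf_fm L \<phi>"
| "wf_fm L (Conj \<phi> \<psi>) \<longleftrightarrow> wf_fm L \<phi> \<and> wf_fm L \<psi>"
| "wf_fm L (Exi v \<phi>) \<longleftrightarrow> wf_fm L \<phi>"

fun fv_trm :: "('f, 'm) trm \<Rightarrow> nat set" where
  "fv_trm (Var v) = {v}"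
| "fv_trm (Par m) = {}"
| "fv_trm (Fn f ts) = (\<Union>t\<in>set ts. fv_trm t)"

primrec fv :: "('f, 'r, 'm) fm \<Rightarrow> nat set" where
  "fv Bot = {}"
| "fv (Eq t u) = fv_trm t \<union> fv_trm u"
| "fv (Rel r ts) = (\<Union>t\<in>set ts. fv_trm t)"
| "fv (Neg \<phi>) = fv \<phi>"
| "fv (Conj \<phi> \<psi>) = fv \<phi> \<union> fv \<psi>"
| "fv (Exi v \<phi>) = fv \<phi> - {v}"

fun params_trm :: "('f, 'm) trm \<Rightarrow> 'm set" where
  "params_trm (Var v) = {}"
| "params_trm (Par m) = {m}"
| "params_trm (Fn f ts) = (\<Union>t\<in>set ts. params_trm t)"

primrec params :: "('f, 'r, 'm) fm \<Rightarrow> 'm set" where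
  "params Bot = {}"
| "params (Eq t u) = params_trm t \<union> params_trm u"
| "params (Rel r ts) = (\<Union>t\<in>set ts. params_trm t)"
| "params (Neg \<phi>) = params \<phi>"
| "params (Conj \<phi> \<psi>) = params \<phi> \<union> params \<psi>"
| "params (Exi v \<phi>) = params \<phi>"

text \<open>\<open>fmla L A X\<close> is the set of \<open>L(A)\<close>-formulas with free variables among \<open>X\<close>.\<close>

definition fmla :: "('f, 'r) language \<Rightarrow> 'm set \<Rightarrow> nat set \<Rightarrow> ('f, 'r, 'm) fm set" where
  "fmla L A X = {\<phi>. wf_fm L \<phi> \<and> params \<phi> \<subseteq> A \<and> fv \<phi> \<subseteq> X}"

primrec inst_trm :: "(nat \<Rightarrow> 'm option) \<Rightarrow> ('f, 'm) trm \<Rightarrow> ('f, 'm) trm" where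
  "inst_trm \<rho> (Var v) = (case \<rho> v of None \<Rightarrow> Var v | Some m \<Rightarrow> Par m)"
| "inst_trm \<rho> (Par m) = Par m"
| "inst_trm \<rho> (Fn f ts) = Fn f (map (inst_trm \<rho>) ts)"

primrec inst :: "(nat \<Rightarrow> 'm option) \<Rightarrow> ('f, 'r, 'm) fm \<Rightarrow> ('f, 'r, 'm) fm" where
  "inst \<rho> Bot = Bot"
| "inst \<rho> (Eq t u) = Eq (inst_trm \<rho> t) (inst_trm \<rho> u)"
| "inst \<rho> (Rel r ts) = Rel r (map (inst_trm \<rho>) ts)"
| "inst \<rho> (Neg \<phi>) = Neg (inst \<rho> \<phi>)"
| "inst \<rho> (Conj \<phi> \<psi>) = Conj (inst \<rho> \<phi>) (inst \<rho> \<psi>)"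
| "inst \<rho> (Exi v \<phi>) = Exi v (inst (\<rho>(v := None)) \<phi>)"

text \<open>
  Tuples of variables and of elements are lists. For \<open>\<psi>(x,z)\<close>, \<open>plug z a \<psi>\<close> is the formula
  \<open>\<psi>(x,a)\<close>.
\<close>

definition plug :: "nat list \<Rightarrow> 'm list \<Rightarrow> ('f, 'r, 'm) fm \<Rightarrow> ('f, 'r, 'm) fm" where
  "plug z a \<psi> = inst (map_of (zip z a)) \<psi>"


section \<open>Structures\<close>

text \<open>
  The ambient structure has the whole type \<open>'m\<close> as its universe. The argument \<open>D\<close> of \<open>sat\<close> is the
  range of the quantifiers: it is \<open>UNIV\<close> for the ambient structure and \<open>M\<close> for a substructure \<open>M\<close>.
\<close>

record ('f, 'r, 'm) fo_struct =
  fint :: "'f \<Rightarrow> 'm list \<Rightarrow> 'm"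
  rint :: "'r \<Rightarrow> 'm list \<Rightarrow> bool"

primrec val :: "('f, 'r, 'm) fo_struct \<Rightarrow> (nat \<Rightarrow> 'm) \<Rightarrow> ('f, 'm) trm \<Rightarrow> 'm" where
  "val S s (Var v) = s v"
| "val S s (Par m) = m"
| "val S s (Fn f ts) = fint S f (map (val S s) ts)"

primrec sat :: "('f, 'r, 'm) fo_struct \<Rightarrow> 'm set \<Rightarrow> (nat \<Rightarrow> 'm) \<Rightarrow> ('f, 'r, 'm) fm \<Rightarrow> bool" where
  "sat S D s Bot \<longleftrightarrow> False"
| "sat S D s (Eq t u) \<longleftrightarrow> val S s t = val S s u"
| "sat S D s (Rel r ts) \<longleftrightarrow> rint S r (map (val S s) ts)"
| "sat S D s (Neg \<phi>) \<longleftrightarrow> \<not> sat S D s \<phi>"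
| "sat S D s (Conj \<phi> \<psi>) \<longleftrightarrow> sat S D s \<phi> \<and> sat S D s \<psi>"
| "sat S D s (Exi v \<phi>) \<longleftrightarrow> (\<exists>m\<in>D. sat S D (s(v := m)) \<phi>)"

abbreviation holds :: "('f, 'r, 'm) fo_struct \<Rightarrow> (nat \<Rightarrow> 'm) \<Rightarrow> ('f, 'r, 'm) fm \<Rightarrow> bool" where
  "holds S s \<phi> \<equiv> sat S UNIV s \<phi>"

text \<open>\<open>asg x a\<close> sends the variables \<open>x\<close> to \<open>a\<close>; its value elsewhere is irrelevant.\<close>

definition asg :: "nat list \<Rightarrow> 'm list \<Rightarrow> nat \<Rightarrow> 'm" where
  "asg x a v = the (map_of (zip x a) v)"

definition elementary_submodel :: "('f, 'r) language \<Rightarrow> ('f, 'r, 'm) fo_struct \<Rightarrow> 'm set \<Rightarrow> bool" where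
  "elementary_submodel L S M \<longleftrightarrow>
     M \<noteq> {} \<and>
     (\<forall>f\<in>funs L. \<forall>as. length as = farity L f \<and> set as \<subseteq> M \<longrightarrow> fint S f as \<in> M) \<and>
     (\<forall>\<phi>\<in>fmla L {} UNIV. \<forall>s. range s \<subseteq> M \<longrightarrow> (sat S M s \<phi> \<longleftrightarrow> holds S s \<phi>))"

definition saturated :: "('f, 'r) language \<Rightarrow> 'k rel \<Rightarrow> ('f, 'r, 'm) fo_struct \<Rightarrow> bool" where
  "saturated L \<kappa> S \<longleftrightarrow>
     (\<forall>A \<Sigma>. |A| <o \<kappa> \<and> \<Sigma> \<subseteq> fmla L A {0} \<and>
        (\<forall>\<Sigma>0\<subseteq>\<Sigma>. finite \<Sigma>0 \<longrightarrow> (\<exists>m. \<forall>\<phi>\<in>\<Sigma>0. holds S (\<lambda>_. m) \<phi>))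
      \<longrightarrow> (\<exists>m. \<forall>\<phi>\<in>\<Sigma>. holds S (\<lambda>_. m) \<phi>))"

definition automorphism :: "('f, 'r) language \<Rightarrow> ('f, 'r, 'm) fo_struct \<Rightarrow> ('m \<Rightarrow> 'm) \<Rightarrow> bool" where
  "automorphism L S h \<longleftrightarrow> bij h \<and>
     (\<forall>f\<in>funs L. \<forall>as. length as = farity L f \<longrightarrow> h (fint S f as) = fint S f (map h as)) \<and>
     (\<forall>r\<in>rels L. \<forall>as. length as = rarity L r \<longrightarrow> (rint S r as \<longleftrightarrow> rint S r (map h as)))"

definition partial_elementary ::
    "('f, 'r) language \<Rightarrow> ('f, 'r, 'm) fo_struct \<Rightarrow> 'm set \<Rightarrow> ('m \<Rightarrow> 'm) \<Rightarrow> bool" where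
  "partial_elementary L S A g \<longleftrightarrow>
     (\<forall>\<phi>\<in>fmla L {} UNIV. \<forall>s. s ` fv \<phi> \<subseteq> A \<longrightarrow> (holds S s \<phi> \<longleftrightarrow> holds S (g \<circ> s) \<phi>))"

definition strongly_homogeneous :: "('f, 'r) language \<Rightarrow> 'k rel \<Rightarrow> ('f, 'r, 'm) fo_struct \<Rightarrow> bool" where
  "strongly_homogeneous L \<kappa> S \<longleftrightarrow>
     (\<forall>A g. |A| <o \<kappa> \<and> partial_elementary L S A g
        \<longrightarrow> (\<exists>h. automorphism L S h \<and> (\<forall>a\<in>A. h a = g a)))"

definition complete_theory :: "('f, 'r) language \<Rightarrow> ('f, 'r, 'm) fm set \<Rightarrow> bool" where
  "complete_theory L T \<longleftrightarrow>
     T \<subseteq> fmla L {} {} \<and> (\<forall>\<sigma>\<in>fmla L {} {}. \<sigma> \<in> T \<longleftrightarrow> Neg \<sigma> \<notin> T)"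

definition model_of :: "('f, 'r, 'm) fo_struct \<Rightarrow> ('f, 'r, 'm) fm set \<Rightarrow> bool" where
  "model_of S T \<longleftrightarrow> (\<forall>\<sigma>\<in>T. \<forall>s. holds S s \<sigma>)"

text \<open>
  \<open>\<kappa>\<close> is the cardinal measuring smallness. The set of \<open>L\<close>-formulas has cardinality \<open>|L| + \<aleph>\<^sub>0\<close>.
\<close>

definition monster_model ::
    "('f, 'r) language \<Rightarrow> ('f, 'r, 'm) fm set \<Rightarrow> 'k rel \<Rightarrow> ('f, 'r, 'm) fo_struct \<Rightarrow> bool" where
  "monster_model L T \<kappa> S \<longleftrightarrow>
     infinite (UNIV :: 'm set) \<and> model_of S T \<and>
     Card_order \<kappa> \<and> |fmla L {} UNIV :: ('f, 'r, 'm) fm set| <o \<kappa> \<and>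
     saturated L \<kappa> S \<and> strongly_homogeneous L \<kappa> S"

text \<open>As usual, models are small elementary substructures of the monster model.\<close>

definition small_model :: "('f, 'r) language \<Rightarrow> 'k rel \<Rightarrow> ('f, 'r, 'm) fo_struct \<Rightarrow> 'm set \<Rightarrow> bool" where
  "small_model L \<kappa> S M \<longleftrightarrow> elementary_submodel L S M \<and> |M| <o \<kappa>"


section \<open>Types, ideals and wideness\<close>

definition tp :: "('f, 'r) language \<Rightarrow> ('f, 'r, 'm) fo_struct \<Rightarrow> nat list \<Rightarrow> 'm list \<Rightarrow> 'm set
    \<Rightarrow> ('f, 'r, 'm) fm set" where
  "tp L S x a A = {\<phi> \<in> fmla L A (set x). holds S (asg x a) \<phi>}"

definition equiv_over ::
    "('f, 'r) language \<Rightarrow> ('f, 'r, 'm) fo_struct \<Rightarrow> 'm set \<Rightarrow> 'm list \<Rightarrow> 'm list \<Rightarrow> bool" where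
  "equiv_over L S A a a' \<longleftrightarrow>
     length a = length a' \<and> tp L S [0..<length a] a A = tp L S [0..<length a'] a' A"

text \<open>
  The finite subset is essential: a global type need not be realized in the monster model, so
  implication means consequence in elementary extensions, which is finitary by compactness.
\<close>

definition entails ::
    "('f, 'r, 'm) fo_struct \<Rightarrow> ('f, 'r, 'm) fm set \<Rightarrow> ('f, 'r, 'm) fm \<Rightarrow> bool" where
  "entails S \<Sigma> \<theta> \<longleftrightarrow>
     (\<exists>\<Sigma>0\<subseteq>\<Sigma>. finite \<Sigma>0 \<and> (\<forall>s. (\<forall>\<sigma>\<in>\<Sigma>0. holds S s \<sigma>) \<longrightarrow> holds S s \<theta>))"

definition is_ideal ::
    "('f, 'r) language \<Rightarrow> ('f, 'r, 'm) fo_struct \<Rightarrow> nat list \<Rightarrow> ('f, 'r, 'm) fm set \<Rightarrow> bool" where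
  "is_ideal L S x I \<longleftrightarrow>
     I \<subseteq> fmla L UNIV (set x) \<and>
     Bot \<in> I \<and>
     (\<forall>\<phi>\<in>I. \<forall>\<psi>\<in>fmla L UNIV (set x). entails S {\<psi>} \<phi> \<longrightarrow> \<psi> \<in> I) \<and>
     (\<forall>\<phi>\<in>I. \<forall>\<psi>\<in>I. Disj \<phi> \<psi> \<in> I)"

definition wide :: "('f, 'r, 'm) fo_struct \<Rightarrow> ('f, 'r, 'm) fm set \<Rightarrow> ('f, 'r, 'm) fm set \<Rightarrow> bool" where
  "wide S I \<Sigma> \<longleftrightarrow> \<not> (\<exists>\<theta>\<in>I. entails S \<Sigma> \<theta>)"

definition wide_over :: "('f, 'r) language \<Rightarrow> ('f, 'r, 'm) fo_struct \<Rightarrow> nat list \<Rightarrow> ('f, 'r, 'm) fm set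
    \<Rightarrow> 'm set \<Rightarrow> 'm list \<Rightarrow> bool" where
  "wide_over L S x I A a \<longleftrightarrow> length a = length x \<and> wide S I (tp L S x a A)"

definition invariant_ideal ::
    "('f, 'r) language \<Rightarrow> ('f, 'r, 'm) fo_struct \<Rightarrow> 'm set \<Rightarrow> nat list \<Rightarrow> ('f, 'r, 'm) fm set \<Rightarrow> bool" where
  "invariant_ideal L S A x I \<longleftrightarrow>
     (\<forall>z \<psi> a a'. distinct (x @ z) \<and> \<psi> \<in> fmla L {} (set (x @ z)) \<and>
        length a = length z \<and> equiv_over L S A a a' \<and> plug z a \<psi> \<in> I
      \<longrightarrow> plug z a' \<psi> \<in> I)"

definition indiscernible ::
    "('f, 'r) language \<Rightarrow> ('f, 'r, 'm) fo_struct \<Rightarrow> 'm set \<Rightarrow> (nat \<Rightarrow> 'm list) \<Rightarrow> bool" where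
  "indiscernible L S A a \<longleftrightarrow>
     (\<forall>is js. sorted_wrt (<) is \<and> sorted_wrt (<) js \<and> length is = length js
        \<longrightarrow> equiv_over L S A (concat (map a is)) (concat (map a js)))"

definition S1_ideal ::
    "('f, 'r) language \<Rightarrow> ('f, 'r, 'm) fo_struct \<Rightarrow> 'm set \<Rightarrow> nat list \<Rightarrow> ('f, 'r, 'm) fm set \<Rightarrow> bool" where
  "S1_ideal L S A x I \<longleftrightarrow>
     is_ideal L S x I \<and> invariant_ideal L S A x I \<and>
     (\<forall>z \<psi> a. distinct (x @ z) \<and> \<psi> \<in> fmla L {} (set (x @ z)) \<and>
        (\<forall>i. length (a i) = length z) \<and> indiscernible L S A a \<and>
        Conj (plug z (a 0) \<psi>) (plug z (a 1) \<psi>) \<in> I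
      \<longrightarrow> plug z (a 0) \<psi> \<in> I)"


section \<open>Independent sequences and stability\<close>

text \<open>
  In a sequence of tuples, \<open>Inl a\<close> marks a tuple in the sort of \<open>x\<close> and \<open>Inr b\<close> a tuple in the sort
  of \<open>y\<close> (the two may have the same length).
\<close>

definition entry_elems :: "'m list + 'm list \<Rightarrow> 'm set" where
  "entry_elems c = (case c of Inl a \<Rightarrow> set a | Inr b \<Rightarrow> set b)"

definition independent ::
    "('f, 'r) language \<Rightarrow> ('f, 'r, 'm) fo_struct \<Rightarrow> nat list \<Rightarrow> ('f, 'r, 'm) fm set \<Rightarrow> nat list
     \<Rightarrow> ('f, 'r, 'm) fm set \<Rightarrow> 'm set \<Rightarrow> ('m list + 'm list) list \<Rightarrow> bool" where
  "independent L S x Ix y Iy M cs \<longleftrightarrow>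
     (\<forall>i<length cs.
        let A = M \<union> (\<Union>c\<in>set (take i cs). entry_elems c)
        in case cs ! i of
             Inl a \<Rightarrow> wide_over L S x Ix A a
           | Inr b \<Rightarrow> wide_over L S y Iy A b)"

definition ladder_seq ::
    "nat \<Rightarrow> (nat \<Rightarrow> 'm list) \<Rightarrow> (nat \<Rightarrow> 'm list) \<Rightarrow> ('m list + 'm list) list" where
  "ladder_seq k a b = concat (map (\<lambda>i. [Inl (a i), Inr (b i)]) [1..<k + 1])"

definition I_stable_of_ladder ::
    "('f, 'r) language \<Rightarrow> 'k rel \<Rightarrow> ('f, 'r, 'm) fo_struct \<Rightarrow> nat list \<Rightarrow> ('f, 'r, 'm) fm set \<Rightarrow> nat list
     \<Rightarrow> ('f, 'r, 'm) fm set \<Rightarrow> ('f, 'r, 'm) fm \<Rightarrow> nat \<Rightarrow> bool" where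
  "I_stable_of_ladder L \<kappa> S x Ix y Iy \<phi> k \<longleftrightarrow>
     \<not> (\<exists>M a b. small_model L \<kappa> S M \<and>
          (\<forall>i\<in>{1..k}. length (a i) = length x \<and> length (b i) = length y) \<and>
          (independent L S x Ix y Iy M (ladder_seq k a b) \<or>
           independent L S x Ix y Iy M (rev (ladder_seq k a b))) \<and>
          (\<forall>i\<in>{1..k}. \<forall>j\<in>{1..k}. holds S (asg (x @ y) (a i @ b j)) \<phi> \<longleftrightarrow> i \<le> j))"

definition I_stable ::
    "('f, 'r) language \<Rightarrow> 'k rel \<Rightarrow> ('f, 'r, 'm) fo_struct \<Rightarrow> nat list \<Rightarrow> ('f, 'r, 'm) fm set \<Rightarrow> nat list
     \<Rightarrow> ('f, 'r, 'm) fm set \<Rightarrow> ('f, 'r, 'm) fm \<Rightarrow> bool" where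
  "I_stable L \<kappa> S x Ix y Iy \<phi> \<longleftrightarrow> (\<exists>k. I_stable_of_ladder L \<kappa> S x Ix y Iy \<phi> k)"


section \<open>Global \<open>\<phi>\<close>-types\<close>

inductive_set bool_comb :: "nat list \<Rightarrow> ('f, 'r, 'm) fm \<Rightarrow> ('f, 'r, 'm) fm set"
  for y :: "nat list" and \<phi> :: "('f, 'r, 'm) fm" where
  "length b = length y \<Longrightarrow> plug y b \<phi> \<in> bool_comb y \<phi>"
| "Bot \<in> bool_comb y \<phi>"
| "\<theta> \<in> bool_comb y \<phi> \<Longrightarrow> Neg \<theta> \<in> bool_comb y \<phi>"
| "\<theta> \<in> bool_comb y \<phi> \<Longrightarrow> \<theta>' \<in> bool_comb y \<phi> \<Longrightarrow> Conj \<theta> \<theta>' \<in> bool_comb y \<phi>"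

definition consistent :: "('f, 'r, 'm) fo_struct \<Rightarrow> ('f, 'r, 'm) fm set \<Rightarrow> bool" where
  "consistent S \<Sigma> \<longleftrightarrow> (\<forall>\<Sigma>0\<subseteq>\<Sigma>. finite \<Sigma>0 \<longrightarrow> (\<exists>s. \<forall>\<sigma>\<in>\<Sigma>0. holds S s \<sigma>))"

definition global_phi_type ::
    "('f, 'r, 'm) fo_struct \<Rightarrow> nat list \<Rightarrow> ('f, 'r, 'm) fm \<Rightarrow> ('f, 'r, 'm) fm set \<Rightarrow> bool" where
  "global_phi_type S y \<phi> p \<longleftrightarrow>
     p \<subseteq> bool_comb y \<phi> \<and> consistent S p \<and>
     (\<forall>q. p \<subseteq> q \<and> q \<subseteq> bool_comb y \<phi> \<and> consistent S q \<longrightarrow> q = p)"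

end

theory Submission
  imports Defs "HOL-Library.Ramsey"
begin

text \<open>
  Extend \<open>\<pp>\<close> to a complete wide global type \<open>U\<close>. Stability gives a finite sequence \<open>a\<^sub>0, \<dots>, a\<^sub>2\<^sub>k\<close> of
  realizations of \<open>U\<close> such that, for \<open>b\<close> wide over enough parameters, \<open>\<phi>(x, b) \<in> U\<close> iff the majority of the
  \<open>\<phi>(a\<^sub>i, b)\<close> hold. The point is to remove the parameters: it suffices that membership of \<open>\<phi>(x, b)\<close> in \<open>U\<close>
  depends only on the type of \<open>b\<close> over \<open>M\<close>, for then the majority formula makes it locally constant on the closed
  space of wide types over \<open>M\<close>, and compactness produces an \<open>L(M)\<close>-formula.

  Given a wide global type \<open>W\<close> extending the type of \<open>b\<close> over \<open>M\<close>, let \<open>\<Xi>(x)\<close> be its majority formula. It turns out that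
  \<open>\<phi>(x, b) \<in> U\<close> iff \<open>\<Xi> \<in> U\<close>. Two consequences of the S1 property enter. First, conjugates of \<open>\<Xi>\<close> over \<open>M\<close>
  agree with \<open>\<Xi>\<close> up to the ideal: otherwise a Morley sequence of a coheir would give types alternating on wide
  tuples, hence a ladder. Second, if \<open>c\<close> and \<open>c'\<close> have the same type over a model \<open>N\<close>, \<open>c'\<close> is wide over \<open>N c\<close>, and an
  \<open>L(N)\<close>-formula \<open>\<theta>(x, c)\<close> is wide, then so is \<open>\<theta>(x, c) \<and> \<theta>(x, c')\<close>. Iterating the second fact along a chain of models
  builds a ladder if \<open>\<phi>(x, b) \<in> U\<close> and \<open>\<Xi> \<in> U\<close> disagree. Morley sequences of coheirs need not be wide
  themselves; they only serve as parameters, so that no Erdos-Rado argument is required.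
\<close>

section \<open>Definable sets\<close>

text \<open>The obstacle lies in the base set. The majority formula uses parameters from some
  \<open>A\<close> larger than \<open>M\<close> and is reliable only on tuples wide over
  \<open>A\<close>. A tuple wide over \<open>M\<close> has a conjugate over \<open>M\<close> that is
  wide over \<open>A\<close>, but nothing makes \<open>U\<close> invariant under automorphisms
  fixing \<open>M\<close>, so \<open>U\<close> might treat the two tuples differently. The way out
  is to let the sorts of \<open>x\<close> and \<open>y\<close> exchange roles: the majority set of
  \<open>W\<close> consists of tuples in the sort of \<open>x\<close>, so it can be compared with
  \<open>U\<close>, and it is chosen from \<open>W\<close> alone, not from the realization
  \<open>b\<close>. The exchange is possible because ladders are excluded in both orders of
  independence. The constant \<open>2 * k + 1\<close> is a pigeonhole: \<open>k + 1\<close> entries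
  misclassifying a wide tuple already give a ladder of length \<open>k\<close>, and if at most
  \<open>k\<close> are wrong then the remaining \<open>k + 1\<close> form a correct majority. One
  index is lost because, for one of the two kinds of error, the ladder starts with a tuple in the
  sort of \<open>y\<close>.\<close>

definition ev :: "(nat \<Rightarrow> 'm) \<Rightarrow> nat + 'm \<Rightarrow> 'm" where
  "ev s = case_sum s (\<lambda>m. m)"

lemma ev_simps [simp]: "ev s (Inl v) = s v" "ev s (Inr m) = m"
  by (simp_all add: ev_def)

text \<open>A target \<open>Inl v\<close> is a variable and \<open>Inr m\<close> a named element.
  One operation thus covers renaming variables, plugging in elements, and turning parameters back
  into variables.\<close>

primrec tsub :: "(nat \<Rightarrow> nat + 'm) \<Rightarrow> ('m \<Rightarrow> nat + 'm) \<Rightarrow> ('f, 'm) trm \<Rightarrow> ('f, 'm) trm" where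
  "tsub \<sigma> \<pi> (Var v) = case_sum Var Par (\<sigma> v)"
| "tsub \<sigma> \<pi> (Par m) = case_sum Var Par (\<pi> m)"
| "tsub \<sigma> \<pi> (Fn f ts) = Fn f (map (tsub \<sigma> \<pi>) ts)"

lemma wf_tsub: "wf_trm L t \<Longrightarrow> wf_trm L (tsub \<sigma> \<pi> t)"
  by (induction t) (auto split: sum.splits)

lemma fv_tsub: "v \<in> fv_trm (tsub \<sigma> \<pi> t) \<Longrightarrow> Inl v \<in> \<sigma> ` fv_trm t \<union> \<pi> ` params_trm t"
proof (induction t)
  case (Fn f ts)
  then obtain t where t: "t \<in> set ts" "v \<in> fv_trm (tsub \<sigma> \<pi> t)" by auto
  show ?case using Fn.IH[OF t] t(1) by auto
qed (auto split: sum.splits)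

lemma params_tsub: "m \<in> params_trm (tsub \<sigma> \<pi> t) \<Longrightarrow> Inr m \<in> \<sigma> ` fv_trm t \<union> \<pi> ` params_trm t"
proof (induction t)
  case (Fn f ts)
  then obtain t where t: "t \<in> set ts" "m \<in> params_trm (tsub \<sigma> \<pi> t)" by auto
  show ?case using Fn.IH[OF t] t(1) by auto
qed (auto split: sum.splits)

lemma val_tsub:
  "\<forall>m\<in>params_trm t. ev s (\<pi> m) = m \<Longrightarrow> val S s (tsub \<sigma> \<pi> t) = val S (\<lambda>v. ev s (\<sigma> v)) t"
proof (induction t)
  case (Fn f ts)
  have "map (val S s \<circ> tsub \<sigma> \<pi>) ts = map (val S (\<lambda>v. ev s (\<sigma> v))) ts"
    using Fn by auto
  then show ?case by (simp only: tsub.simps val.simps map_map)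
qed (auto split: sum.splits)

lemma finite_fv_trm: "finite (fv_trm t)"
  by (induction t) auto

lemma finite_params_trm: "finite (params_trm t)"
  by (induction t) auto

lemma finite_fv: "finite (fv \<phi>)"
  by (induction \<phi>) (auto simp: finite_fv_trm)

lemma finite_params: "finite (params \<phi>)"
  by (induction \<phi>) (auto simp: finite_params_trm)

lemma val_cong: "(\<And>v. v \<in> fv_trm t \<Longrightarrow> s v = s' v) \<Longrightarrow> val S s t = val S s' t"
proof (induction t)
  case (Fn f ts)
  then have "map (val S s) ts = map (val S s') ts" by auto
  then show ?case by (simp only: val.simps)
qed auto

lemma sat_cong: "(\<And>v. v \<in> fv \<phi> \<Longrightarrow> s v = s' v) \<Longrightarrow> sat S D s \<phi> = sat S D s' \<phi>"
proof (induction \<phi> arbitrary: s s')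
  case (Eq t u)
  then show ?case using val_cong[of t s s' S] val_cong[of u s s' S] by auto
next
  case (Rel r ts)
  then have "map (val S s) ts = map (val S s') ts" by (auto intro!: val_cong)
  then show ?case by (simp only: sat.simps)
next
  case (Conj \<phi>1 \<phi>2)
  have "sat S D s \<phi>1 = sat S D s' \<phi>1" "sat S D s \<phi>2 = sat S D s' \<phi>2"
    by (rule Conj.IH; use Conj.prems in simp)+
  then show ?case by simp
next
  case (Exi v \<phi>)
  have "sat S D (s(v := m)) \<phi> = sat S D (s'(v := m)) \<phi>" for m
    by (rule Exi.IH) (use Exi.prems in simp)
  then show ?case by simp
next
  case (Neg \<phi>)
  have "sat S D s \<phi> = sat S D s' \<phi>" by (rule Neg.IH) (use Neg.prems in simp)
  then show ?case by simp
qed auto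

text \<open>
  Simultaneous replacement of free variables by \<open>\<sigma>\<close> and of parameters by \<open>\<pi>\<close>. Bound variables are
  renamed on the way, so the result is only asserted to exist.
\<close>

definition is_subst :: "('f, 'r) language \<Rightarrow> ('f, 'r, 'm) fo_struct \<Rightarrow> (nat \<Rightarrow> nat + 'm) \<Rightarrow> ('m \<Rightarrow> nat + 'm)
    \<Rightarrow> ('f, 'r, 'm) fm \<Rightarrow> ('f, 'r, 'm) fm \<Rightarrow> bool" where
  "is_subst L S \<sigma> \<pi> \<phi> \<phi>' \<longleftrightarrow> wf_fm L \<phi>' \<and>
     (\<forall>m\<in>params \<phi>'. Inr m \<in> \<sigma> ` fv \<phi> \<union> \<pi> ` params \<phi>) \<and>
     (\<forall>v\<in>fv \<phi>'. Inl v \<in> \<sigma> ` fv \<phi> \<union> \<pi> ` params \<phi>) \<and>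
     (\<forall>s. (\<forall>m\<in>params \<phi>. ev s (\<pi> m) = m) \<longrightarrow> holds S s \<phi>' = holds S (\<lambda>v. ev s (\<sigma> v)) \<phi>)"

lemma is_substI:
  assumes "wf_fm L \<phi>'"
    and "\<And>m. m \<in> params \<phi>' \<Longrightarrow> Inr m \<in> \<sigma> ` fv \<phi> \<union> \<pi> ` params \<phi>"
    and "\<And>v. v \<in> fv \<phi>' \<Longrightarrow> Inl v \<in> \<sigma> ` fv \<phi> \<union> \<pi> ` params \<phi>"
    and "\<And>s. (\<And>m. m \<in> params \<phi> \<Longrightarrow> ev s (\<pi> m) = m) \<Longrightarrow> holds S s \<phi>' = holds S (\<lambda>v. ev s (\<sigma> v)) \<phi>"
  shows "is_subst L S \<sigma> \<pi> \<phi> \<phi>'"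
  unfolding is_subst_def using assms by (intro conjI ballI allI impI) simp_all

lemma is_substD:
  assumes "is_subst L S \<sigma> \<pi> \<phi> \<phi>'"
  shows "wf_fm L \<phi>'"
    and "m \<in> params \<phi>' \<Longrightarrow> Inr m \<in> \<sigma> ` fv \<phi> \<union> \<pi> ` params \<phi>"
    and "v \<in> fv \<phi>' \<Longrightarrow> Inl v \<in> \<sigma> ` fv \<phi> \<union> \<pi> ` params \<phi>"
    and "(\<And>m. m \<in> params \<phi> \<Longrightarrow> ev s (\<pi> m) = m) \<Longrightarrow> holds S s \<phi>' = holds S (\<lambda>v. ev s (\<sigma> v)) \<phi>"
  using assms by (simp_all add: is_subst_def)

lemma subst_exists: "wf_fm L \<phi> \<Longrightarrow> \<exists>\<phi>'. is_subst L S \<sigma> \<pi> \<phi> \<phi>'"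
proof (induction \<phi> arbitrary: \<sigma>)
  case Bot
  show ?case by (intro exI[of _ Bot] is_substI) simp_all
next
  case (Eq t u)
  show ?case
  proof (intro exI[of _ "Eq (tsub \<sigma> \<pi> t) (tsub \<sigma> \<pi> u)"] is_substI)
    fix s assume "\<And>m. m \<in> params (Eq t u) \<Longrightarrow> ev s (\<pi> m) = m"
    then show "holds S s (Eq (tsub \<sigma> \<pi> t) (tsub \<sigma> \<pi> u)) = holds S (\<lambda>v. ev s (\<sigma> v)) (Eq t u)"
      by (simp add: val_tsub)
  next
    fix v assume "v \<in> fv (Eq (tsub \<sigma> \<pi> t) (tsub \<sigma> \<pi> u))"
    then show "Inl v \<in> \<sigma> ` fv (Eq t u) \<union> \<pi> ` params (Eq t u)"
      using fv_tsub[of v \<sigma> \<pi> t] fv_tsub[of v \<sigma> \<pi> u] by auto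
  next
    fix m assume "m \<in> params (Eq (tsub \<sigma> \<pi> t) (tsub \<sigma> \<pi> u))"
    then show "Inr m \<in> \<sigma> ` fv (Eq t u) \<union> \<pi> ` params (Eq t u)"
      using params_tsub[of m \<sigma> \<pi> t] params_tsub[of m \<sigma> \<pi> u] by auto
  qed (use Eq in \<open>simp add: wf_tsub\<close>)
next
  case (Rel r ts)
  show ?case
  proof (intro exI[of _ "Rel r (map (tsub \<sigma> \<pi>) ts)"] is_substI)
    fix s assume "\<And>m. m \<in> params (Rel r ts) \<Longrightarrow> ev s (\<pi> m) = m"
    then have "map (val S s \<circ> tsub \<sigma> \<pi>) ts = map (val S (\<lambda>v. ev s (\<sigma> v))) ts"
      by (auto intro!: val_tsub)
    then show "holds S s (Rel r (map (tsub \<sigma> \<pi>) ts)) = holds S (\<lambda>v. ev s (\<sigma> v)) (Rel r ts)"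
      by (simp only: sat.simps map_map)
  next
    fix v assume "v \<in> fv (Rel r (map (tsub \<sigma> \<pi>) ts))"
    then obtain t where "t \<in> set ts" "v \<in> fv_trm (tsub \<sigma> \<pi> t)" by auto
    then show "Inl v \<in> \<sigma> ` fv (Rel r ts) \<union> \<pi> ` params (Rel r ts)"
      using fv_tsub[of v \<sigma> \<pi> t] by auto
  next
    fix m assume "m \<in> params (Rel r (map (tsub \<sigma> \<pi>) ts))"
    then obtain t where "t \<in> set ts" "m \<in> params_trm (tsub \<sigma> \<pi> t)" by auto
    then show "Inr m \<in> \<sigma> ` fv (Rel r ts) \<union> \<pi> ` params (Rel r ts)"
      using params_tsub[of m \<sigma> \<pi> t] by auto
  qed (use Rel in \<open>simp add: wf_tsub\<close>)
next
  case (Neg \<phi>)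
  then obtain \<phi>' where \<phi>': "is_subst L S \<sigma> \<pi> \<phi> \<phi>'" by fastforce
  show ?case
    by (intro exI[of _ "Neg \<phi>'"] is_substI) (use is_substD[OF \<phi>'] in simp_all)
next
  case (Conj \<phi> \<psi>)
  then obtain \<phi>' \<psi>' where *: "is_subst L S \<sigma> \<pi> \<phi> \<phi>'" "is_subst L S \<sigma> \<pi> \<psi> \<psi>'" by fastforce
  show ?case
  proof (intro exI[of _ "Conj \<phi>' \<psi>'"] is_substI)
    fix v assume "v \<in> fv (Conj \<phi>' \<psi>')"
    then show "Inl v \<in> \<sigma> ` fv (Conj \<phi> \<psi>) \<union> \<pi> ` params (Conj \<phi> \<psi>)"
      using is_substD(3)[OF *(1), of v] is_substD(3)[OF *(2), of v] by auto
  next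
    fix m assume "m \<in> params (Conj \<phi>' \<psi>')"
    then show "Inr m \<in> \<sigma> ` fv (Conj \<phi> \<psi>) \<union> \<pi> ` params (Conj \<phi> \<psi>)"
      using is_substD(2)[OF *(1), of m] is_substD(2)[OF *(2), of m] by auto
  qed (use is_substD(1,4)[OF *(1)] is_substD(1,4)[OF *(2)] in simp_all)
next
  case (Exi v \<phi>)
  \<comment> \<open>\<open>N\<close> collects every variable that the replacement can introduce; a
    bound variable outside \<open>N\<close> captures none of them.\<close>
  define N where "N = {w. Inl w \<in> \<sigma> ` fv \<phi> \<union> \<pi> ` params \<phi>}"
  have "finite (Inl -` (\<sigma> ` fv \<phi> \<union> \<pi> ` params \<phi>) :: nat set)"
    by (intro finite_vimageI) (simp_all add: finite_fv finite_params)
  then have "finite N" by (simp add: N_def vimage_def)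
  then obtain w where w: "w \<notin> N" using ex_new_if_finite[OF infinite_UNIV_nat] by blast
  have N: "u \<noteq> w" if "Inl u \<in> \<sigma> ` fv \<phi> \<union> \<pi> ` params \<phi>" for u
    using that w unfolding N_def by blast
  have "wf_fm L \<phi>" using Exi.prems by simp
  from Exi.IH[OF this] obtain \<phi>' where \<phi>': "is_subst L S (\<sigma>(v := Inl w)) \<pi> \<phi> \<phi>'" by blast
  show ?case
  proof (intro exI[of _ "Exi w \<phi>'"] is_substI)
    show "wf_fm L (Exi w \<phi>')" using is_substD(1)[OF \<phi>'] by simp
  next
    fix m assume "m \<in> params (Exi w \<phi>')"
    then show "Inr m \<in> \<sigma> ` fv (Exi v \<phi>) \<union> \<pi> ` params (Exi v \<phi>)"
      using is_substD(2)[OF \<phi>', of m] by (auto split: if_splits)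
  next
    fix u assume "u \<in> fv (Exi w \<phi>')"
    then show "Inl u \<in> \<sigma> ` fv (Exi v \<phi>) \<union> \<pi> ` params (Exi v \<phi>)"
      using is_substD(3)[OF \<phi>', of u] by (auto split: if_splits)
  next
    fix s assume s: "\<And>m. m \<in> params (Exi v \<phi>) \<Longrightarrow> ev s (\<pi> m) = m"
    have "holds S (s(w := m)) \<phi>' = holds S ((\<lambda>u. ev s (\<sigma> u))(v := m)) \<phi>" for m
    proof -
      have "holds S (s(w := m)) \<phi>' = holds S (\<lambda>u. ev (s(w := m)) ((\<sigma>(v := Inl w)) u)) \<phi>"
      proof (rule is_substD(4)[OF \<phi>'])
        fix m' assume m': "m' \<in> params \<phi>"
        show "ev (s(w := m)) (\<pi> m') = m'"
        proof (cases "\<pi> m'")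
          case (Inl u)
          then have "u \<noteq> w" using N[of u] m' by (metis UnI2 imageI)
          then show ?thesis using Inl s[of m'] m' by simp
        next
          case (Inr u)
          then show ?thesis using s[of m'] m' by simp
        qed
      qed
      also have "\<dots> = holds S ((\<lambda>u. ev s (\<sigma> u))(v := m)) \<phi>"
      proof (rule sat_cong)
        fix u assume u: "u \<in> fv \<phi>"
        show "ev (s(w := m)) ((\<sigma>(v := Inl w)) u) = ((\<lambda>u. ev s (\<sigma> u))(v := m)) u"
        proof (cases "u = v")
          case False
          show ?thesis
          proof (cases "\<sigma> u")
            case (Inl u')
            then have "u' \<noteq> w" using N[of u'] u by (metis UnI1 imageI)
            then show ?thesis using Inl False by simp
          qed (use False in simp)
        qed simp
      qed
      finally show ?thesis .
    qed
    then show "holds S s (Exi w \<phi>') = holds S (\<lambda>v. ev s (\<sigma> v)) (Exi v \<phi>)" by simp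
  qed
qed

lemma index_function:
  obtains idx where "\<And>v. v \<in> set x \<Longrightarrow> idx v < length x \<and> x ! idx v = v"
proof -
  have "\<forall>v. \<exists>i. v \<in> set x \<longrightarrow> i < length x \<and> x ! i = v" by (metis in_set_conv_nth)
  from choice[OF this] obtain idx where "\<forall>v. v \<in> set x \<longrightarrow> idx v < length x \<and> x ! idx v = v" ..
  then show ?thesis by (intro that) blast
qed

definition tup :: "nat \<Rightarrow> 'm list set" where
  "tup n = {a. length a = n}"

lemma tup_iff [simp]: "a \<in> tup n \<longleftrightarrow> length a = n"
  by (simp add: tup_def)

locale fo_structure =
  fixes L :: "('f, 'r) language" and S :: "('f, 'r, 'm) fo_struct"
begin

text \<open>Passing from formulas to their solution sets turns equivalence into equality and removes
  the names of the variables. Ideals of formulas become ideals of a Boolean algebra of sets.\<close>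

definition DS :: "'m set \<Rightarrow> nat \<Rightarrow> 'm list set set" where
  "DS A n = {X. \<exists>\<phi>\<in>fmla L A {..<n}. X = {a \<in> tup n. holds S ((!) a) \<phi>}}"

lemma DS_tup: "X \<in> DS A n \<Longrightarrow> X \<subseteq> tup n"
  by (auto simp: DS_def)

lemma DS_mono: "X \<in> DS A n \<Longrightarrow> A \<subseteq> B \<Longrightarrow> X \<in> DS B n"
  by (auto simp: DS_def fmla_def)

lemma DS_UNIV: "X \<in> DS A n \<Longrightarrow> X \<in> DS UNIV n"
  by (rule DS_mono) auto

lemma DS_empty [simp]: "{} \<in> DS A n"
  unfolding DS_def by (rule CollectI, rule bexI[of _ Bot]) (auto simp: fmla_def)

lemma DS_compl [intro]: "X \<in> DS A n \<Longrightarrow> tup n - X \<in> DS A n"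
  unfolding DS_def
proof safe
  fix \<phi> assume "\<phi> \<in> fmla L A {..<n}"
  then show "\<exists>\<psi>\<in>fmla L A {..<n}.
     tup n - {a \<in> tup n. holds S ((!) a) \<phi>} = {a \<in> tup n. holds S ((!) a) \<psi>}"
    by (intro bexI[of _ "Neg \<phi>"]) (auto simp: fmla_def)
qed

lemma DS_Int [intro]: "X \<in> DS A n \<Longrightarrow> Y \<in> DS A n \<Longrightarrow> X \<inter> Y \<in> DS A n"
  unfolding DS_def
proof safe
  fix \<phi> \<psi> assume "\<phi> \<in> fmla L A {..<n}" "\<psi> \<in> fmla L A {..<n}"
  then show "\<exists>\<chi>\<in>fmla L A {..<n}.
     {a \<in> tup n. holds S ((!) a) \<phi>} \<inter> {a \<in> tup n. holds S ((!) a) \<psi>} = {a \<in> tup n. holds S ((!) a) \<chi>}"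
    by (intro bexI[of _ "Conj \<phi> \<psi>"]) (auto simp: fmla_def)
qed

lemma DS_full [simp]: "tup n \<in> DS A n"
  using DS_compl[OF DS_empty] by simp

lemma DS_Diff [intro]: "X \<in> DS A n \<Longrightarrow> Y \<in> DS A n \<Longrightarrow> X - Y \<in> DS A n"
proof -
  assume "X \<in> DS A n" "Y \<in> DS A n"
  moreover have "X - Y = X \<inter> (tup n - Y)" using DS_tup[OF \<open>X \<in> DS A n\<close>] by auto
  ultimately show ?thesis by auto
qed

lemma DS_Un [intro]: "X \<in> DS A n \<Longrightarrow> Y \<in> DS A n \<Longrightarrow> X \<union> Y \<in> DS A n"
proof -
  assume "X \<in> DS A n" "Y \<in> DS A n"
  moreover have "X \<union> Y = tup n - ((tup n - X) \<inter> (tup n - Y))"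
    using DS_tup[OF \<open>X \<in> DS A n\<close>] DS_tup[OF \<open>Y \<in> DS A n\<close>] by auto
  ultimately show ?thesis by (metis DS_Int DS_compl)
qed

text \<open>The factor \<open>tup n\<close> gives the empty family its correct value, since
  \<open>\<Inter>{}\<close> is the whole type.\<close>

lemma DS_INT: "finite G \<Longrightarrow> G \<subseteq> DS A n \<Longrightarrow> tup n \<inter> \<Inter>G \<in> DS A n"
proof (induction G rule: finite_induct)
  case (insert X G)
  have "tup n \<inter> \<Inter>(insert X G) = X \<inter> (tup n \<inter> \<Inter>G)" using insert.prems by auto
  then show ?case using insert by auto
qed simp

lemma DS_UN: "finite G \<Longrightarrow> G \<subseteq> DS A n \<Longrightarrow> \<Union>G \<in> DS A n"
  by (induction G rule: finite_induct) auto

lemma subst_fmla: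
  assumes \<phi>: "\<phi> \<in> fmla L A V" and \<sigma>: "\<And>v. v \<in> V \<Longrightarrow> \<sigma> v \<in> Inl ` V' \<union> Inr ` B" and AB: "A \<subseteq> B"
  obtains \<phi>' where "\<phi>' \<in> fmla L B V'" "\<And>s. holds S s \<phi>' = holds S (\<lambda>v. ev s (\<sigma> v)) \<phi>"
proof -
  have wf: "wf_fm L \<phi>" and par: "params \<phi> \<subseteq> A" and fvs: "fv \<phi> \<subseteq> V" using \<phi> by (simp_all add: fmla_def)
  obtain \<phi>' where \<phi>': "is_subst L S \<sigma> Inr \<phi> \<phi>'" using subst_exists[OF wf] by blast
  show ?thesis
  proof (rule that)
    show "\<phi>' \<in> fmla L B V'"
      unfolding fmla_def
    proof (intro CollectI conjI subsetI)
      fix m assume "m \<in> params \<phi>'"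
      with is_substD(2)[OF \<phi>', of m] show "m \<in> B" using par fvs \<sigma> AB by fastforce
    next
      fix v assume "v \<in> fv \<phi>'"
      with is_substD(3)[OF \<phi>', of v] show "v \<in> V'" using fvs \<sigma> by fastforce
    qed (rule is_substD(1)[OF \<phi>'])
    show "holds S s \<phi>' = holds S (\<lambda>v. ev s (\<sigma> v)) \<phi>" for s by (rule is_substD(4)[OF \<phi>']) simp
  qed
qed

text \<open>Each coordinate of \<open>f\<close> is a variable or a constant. Fibers, permutations of
  coordinates and dummy variables are all preimages under such maps.\<close>

lemma DS_preimage:
  assumes X: "X \<in> DS A (length f)" and f: "set f \<subseteq> Inl ` {..<n} \<union> Inr ` A"
  shows "{a \<in> tup n. map (ev ((!) a)) f \<in> X} \<in> DS A n"
proof -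
  obtain \<phi> where \<phi>: "\<phi> \<in> fmla L A {..<length f}" "X = {a \<in> tup (length f). holds S ((!) a) \<phi>}"
    using X by (auto simp: DS_def)
  then have fvs: "fv \<phi> \<subseteq> {..<length f}" by (simp add: fmla_def)
  obtain \<phi>' where "\<phi>' \<in> fmla L A {..<n}" and \<phi>': "\<And>s. holds S s \<phi>' = holds S (\<lambda>v. ev s (f ! v)) \<phi>"
    by (rule subst_fmla[OF \<phi>(1), of "(!) f" "{..<n}" A]) (use f nth_mem in blast)+
  moreover have "holds S ((!) a) \<phi>' = holds S ((!) (map (ev ((!) a)) f)) \<phi>" for a :: "'m list"
    unfolding \<phi>' by (rule sat_cong) (use fvs in auto)
  ultimately show ?thesis unfolding DS_def using \<phi>(2) by auto
qed

lemma DS_proj: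
  assumes "X \<in> DS A (Suc n)"
  shows "{a \<in> tup n. \<exists>m. a @ [m] \<in> X} \<in> DS A n"
proof -
  obtain \<phi> where \<phi>: "\<phi> \<in> fmla L A {..<Suc n}" "X = {a \<in> tup (Suc n). holds S ((!) a) \<phi>}"
    using assms by (auto simp: DS_def)
  have "Exi n \<phi> \<in> fmla L A {..<n}" using \<phi>(1) by (auto simp: fmla_def less_Suc_eq)
  moreover have "holds S ((!) (a @ [m])) \<phi> = holds S (((!) a)(n := m)) \<phi>" if "length a = n" for a m
    by (rule sat_cong) (use \<phi>(1) that in \<open>auto simp: fmla_def nth_append less_Suc_eq\<close>)
  ultimately show ?thesis unfolding DS_def using \<phi>(2) by (intro CollectI bexI[of _ "Exi n \<phi>"]) auto
qed

text \<open>Every parameter occurring in \<open>e\<close> becomes the new variable at one chosen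
  position where it occurs, so repetitions in \<open>e\<close> do no harm.\<close>

lemma DS_fiber_ex:
  assumes "X \<in> DS (A \<union> set e) n"
  shows "\<exists>Y\<in>DS A (n + length e). X = {a \<in> tup n. a @ e \<in> Y}"
proof -
  obtain \<phi> where \<phi>: "\<phi> \<in> fmla L (A \<union> set e) {..<n}" "X = {a \<in> tup n. holds S ((!) a) \<phi>}"
    using assms by (auto simp: DS_def)
  then have wf: "wf_fm L \<phi>" and par: "params \<phi> \<subseteq> A \<union> set e" and fvs: "fv \<phi> \<subseteq> {..<n}"
    by (auto simp: fmla_def)
  obtain idx where idx: "\<And>m. m \<in> set e \<Longrightarrow> idx m < length e \<and> e ! idx m = m"
    by (rule index_function[of e]) (rule that)
  define \<pi> :: "'m \<Rightarrow> nat + 'm" where "\<pi> m = (if m \<in> set e then Inl (n + idx m) else Inr m)" for m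
  obtain \<phi>' where \<phi>': "is_subst L S Inl \<pi> \<phi> \<phi>'" using subst_exists[OF wf] by blast
  have "\<phi>' \<in> fmla L A {..<n + length e}"
    unfolding fmla_def
  proof (intro CollectI conjI subsetI)
    fix m assume "m \<in> params \<phi>'"
    with is_substD(2)[OF \<phi>', of m] show "m \<in> A" using par by (auto simp: \<pi>_def split: if_splits)
  next
    fix v assume "v \<in> fv \<phi>'"
    with is_substD(3)[OF \<phi>', of v] show "v \<in> {..<n + length e}"
      using fvs idx by (fastforce simp: \<pi>_def split: if_splits)
  qed (rule is_substD(1)[OF \<phi>'])
  moreover have "holds S ((!) (a @ e)) \<phi>' = holds S ((!) a) \<phi>" if "length a = n" for a
  proof -
    have "holds S ((!) (a @ e)) \<phi>' = holds S (\<lambda>v. ev ((!) (a @ e)) (Inl v)) \<phi>"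
      by (rule is_substD(4)[OF \<phi>']) (use that idx in \<open>auto simp: \<pi>_def nth_append\<close>)
    also have "\<dots> = holds S ((!) a) \<phi>"
      by (rule sat_cong) (use fvs that in \<open>auto simp: nth_append\<close>)
    finally show ?thesis .
  qed
  ultimately show ?thesis
    unfolding DS_def using \<phi>(2) by (intro bexI[of _ "{a \<in> tup (n + length e). holds S ((!) a) \<phi>'}"]) auto
qed

text \<open>A formula has finitely many parameters, and these can be listed. Properties stated for
  parameter-free sets with a tuple plugged in therefore reach all definable sets.\<close>

lemma DS_fiber_param:
  assumes "X \<in> DS A n"
  obtains e Y where "set e \<subseteq> A" "Y \<in> DS {} (n + length e)" "X = {a \<in> tup n. a @ e \<in> Y}"
proof -
  obtain \<phi> where \<phi>: "\<phi> \<in> fmla L A {..<n}" "X = {a \<in> tup n. holds S ((!) a) \<phi>}"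
    using assms by (auto simp: DS_def)
  from finite_list[OF finite_params[of \<phi>]] obtain e where e: "set e = params \<phi>" ..
  have "\<phi> \<in> fmla L ({} \<union> set e) {..<n}" and eA: "set e \<subseteq> A" using \<phi>(1) e by (simp_all add: fmla_def)
  then have "X \<in> DS ({} \<union> set e) n" unfolding DS_def using \<phi>(2) by blast
  from DS_fiber_ex[OF this] show ?thesis using that[OF eA] by blast
qed

lemma DS_fiber:
  assumes "Y \<in> DS A (n + length e)"
  shows "{a \<in> tup n. a @ e \<in> Y} \<in> DS (A \<union> set e) n"
proof -
  let ?f = "map Inl [0..<n] @ map Inr e"
  have "{a \<in> tup n. map (ev ((!) a)) ?f \<in> Y} \<in> DS (A \<union> set e) n"
    by (rule DS_preimage) (use DS_mono[OF assms] in auto)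
  moreover have "map (ev ((!) a)) ?f = a @ e" if "length a = n" for a
    using that map_nth[of a] by (simp add: comp_def)
  ultimately show ?thesis by (simp cong: conj_cong)
qed

lemma DS_fiber_left:
  assumes "Y \<in> DS A (length e + n)"
  shows "{a \<in> tup n. e @ a \<in> Y} \<in> DS (A \<union> set e) n"
proof -
  let ?f = "map Inr e @ map Inl [0..<n]"
  have "{a \<in> tup n. map (ev ((!) a)) ?f \<in> Y} \<in> DS (A \<union> set e) n"
    by (rule DS_preimage) (use DS_mono[OF assms] in auto)
  moreover have "map (ev ((!) a)) ?f = e @ a" if "length a = n" for a
    using that map_nth[of a] by (simp add: comp_def)
  ultimately show ?thesis by (simp cong: conj_cong)
qed

lemma DS_coords:
  assumes "Y \<in> DS A (length is)" "set is \<subseteq> {..<n}"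
  shows "{a \<in> tup n. map ((!) a) is \<in> Y} \<in> DS A n"
proof -
  have "{a \<in> tup n. map (ev ((!) a)) (map Inl is) \<in> Y} \<in> DS A n"
    by (rule DS_preimage) (use assms in auto)
  then show ?thesis by (simp add: comp_def)
qed

end

lemma finite_card_ordLess: "finite A \<Longrightarrow> infinite B \<Longrightarrow> |A| <o |B|"
  by (rule finite_ordLess_infinite) (simp_all add: card_of_well_order_on Field_card_of)

lemma asg_nth:
  assumes "distinct x" "length a = length x" "i < length x"
  shows "asg x a (x ! i) = a ! i"
  using map_of_zip_nth[of x a i] assms by (simp add: asg_def)

context fo_structure
begin

lemma DS_I: "\<phi> \<in> fmla L A {..<n} \<Longrightarrow> {a \<in> tup n. holds S ((!) a) \<phi>} \<in> DS A n"
  unfolding DS_def by blast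

lemma holds_asg_upt:
  assumes "length a = n" "fv \<phi> \<subseteq> {..<n}"
  shows "holds S (asg [0..<n] a) \<phi> = holds S ((!) a) \<phi>"
proof (rule sat_cong)
  fix v assume "v \<in> fv \<phi>"
  then show "asg [0..<n] a v = a ! v"
    using asg_nth[of "[0..<n]" a v] assms by auto
qed

lemma equiv_over_iff:
  "equiv_over L S A a a' \<longleftrightarrow> length a = length a' \<and> (\<forall>X\<in>DS A (length a). a \<in> X \<longleftrightarrow> a' \<in> X)"
proof (cases "length a = length a'")
  case True
  let ?n = "length a"
  have "equiv_over L S A a a' \<longleftrightarrow>
     (\<forall>\<phi>\<in>fmla L A {..<?n}. holds S (asg [0..<?n] a) \<phi> = holds S (asg [0..<?n] a') \<phi>)"
    unfolding equiv_over_def tp_def using True by (auto simp: atLeast0LessThan)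
  also have "\<dots> \<longleftrightarrow> (\<forall>\<phi>\<in>fmla L A {..<?n}. holds S ((!) a) \<phi> = holds S ((!) a') \<phi>)"
    by (intro ball_cong refl) (use True in \<open>auto simp: holds_asg_upt fmla_def\<close>)
  also have "\<dots> \<longleftrightarrow> (\<forall>X\<in>DS A ?n. a \<in> X \<longleftrightarrow> a' \<in> X)"
    unfolding DS_def using True by auto
  finally show ?thesis using True by simp
qed (simp add: equiv_over_def)

lemma equiv_over_length: "equiv_over L S A a a' \<Longrightarrow> length a = length a'"
  by (simp add: equiv_over_def)

lemma equiv_over_sym: "equiv_over L S A a a' \<Longrightarrow> equiv_over L S A a' a"
  unfolding equiv_over_def by metis

lemma equiv_over_trans: "equiv_over L S A a b \<Longrightarrow> equiv_over L S A b c \<Longrightarrow> equiv_over L S A a c"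
  unfolding equiv_over_def by metis

lemma equiv_over_mono: "equiv_over L S B a a' \<Longrightarrow> A \<subseteq> B \<Longrightarrow> equiv_over L S A a a'"
  unfolding equiv_over_iff by (simp add: DS_mono)

text \<open>One direction suffices because definable sets are closed under complement.\<close>

lemma equiv_overI:
  assumes "length a = n" "length a' = n" "\<And>X. X \<in> DS A n \<Longrightarrow> a \<in> X \<Longrightarrow> a' \<in> X"
  shows "equiv_over L S A a a'"
  unfolding equiv_over_iff
proof (intro conjI ballI iffI)
  fix X assume X: "X \<in> DS A (length a)"
  show "a \<in> X \<Longrightarrow> a' \<in> X" using assms X by auto
  assume "a' \<in> X"
  show "a \<in> X"
  proof (rule ccontr)
    assume "a \<notin> X"
    then have "a \<in> tup n - X" using assms by simp
    then have "a' \<in> tup n - X" using assms(3)[OF DS_compl] X assms(1) by blast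
    then show False using \<open>a' \<in> X\<close> by simp
  qed
qed (use assms in simp)

lemma equiv_overD: "equiv_over L S A a a' \<Longrightarrow> X \<in> DS A n \<Longrightarrow> a \<in> X \<Longrightarrow> a' \<in> X"
  using DS_tup[of X A n] unfolding equiv_over_iff by auto

section \<open>Automorphisms and their action on definable sets\<close>

definition Aut :: "'m set \<Rightarrow> ('m \<Rightarrow> 'm) set" where
  "Aut A = {h. automorphism L S h \<and> (\<forall>x\<in>A. h x = x)}"

lemma Aut_empty: "h \<in> Aut B \<Longrightarrow> h \<in> Aut {}"
  by (auto simp: Aut_def)

lemma Aut_bij: "h \<in> Aut A \<Longrightarrow> bij h"
  unfolding Aut_def automorphism_def by blast

lemma Aut_fix: "h \<in> Aut A \<Longrightarrow> set a \<subseteq> A \<Longrightarrow> map h a = a"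
  by (induction a) (auto simp: Aut_def)

lemma Aut_inv_map: "h \<in> Aut A \<Longrightarrow> map (inv h) (map h a) = a" "h \<in> Aut A \<Longrightarrow> map h (map (inv h) a) = a"
  using inv_f_f[OF bij_is_inj[OF Aut_bij[of h A]]] surj_f_inv_f[OF bij_is_surj[OF Aut_bij[of h A]]]
  by (simp_all add: map_idI)

lemma Aut_inj_map: "h \<in> Aut A \<Longrightarrow> map h a = map h b \<longleftrightarrow> a = b"
  using Aut_inv_map(1) by metis

lemma automorphism_bij: "automorphism L S h \<Longrightarrow> bij h"
  unfolding automorphism_def by blast

lemma automorphism_fint:
  "automorphism L S h \<Longrightarrow> f \<in> funs L \<Longrightarrow> length as = farity L f \<Longrightarrow> h (fint S f as) = fint S f (map h as)"
  unfolding automorphism_def by blast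

lemma automorphism_rint:
  "automorphism L S h \<Longrightarrow> r \<in> rels L \<Longrightarrow> length as = rarity L r \<Longrightarrow> rint S r (map h as) = rint S r as"
  unfolding automorphism_def by blast

lemma Aut_inv: "h \<in> Aut A \<Longrightarrow> inv h \<in> Aut A"
proof -
  assume h: "h \<in> Aut A"
  have bij: "bij h" using h by (rule Aut_bij)
  have aut: "automorphism L S h" using h by (simp add: Aut_def)
  have "automorphism L S (inv h)"
    unfolding automorphism_def
  proof (intro conjI ballI allI impI)
    show "bij (inv h)" using bij by (rule bij_imp_bij_inv)
  next
    fix f and as :: "'m list" assume "f \<in> funs L" "length as = farity L f"
    then have "h (fint S f (map (inv h) as)) = fint S f (map h (map (inv h) as))"
      using automorphism_fint[OF aut] by simp
    then have "h (fint S f (map (inv h) as)) = fint S f as" using Aut_inv_map(2)[OF h] by simp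
    then show "inv h (fint S f as) = fint S f (map (inv h) as)"
      by (metis bij bij_inv_eq_iff)
  next
    fix r and as :: "'m list" assume "r \<in> rels L" "length as = rarity L r"
    then have "rint S r (map (inv h) as) = rint S r (map h (map (inv h) as))"
      using automorphism_rint[OF aut, of r "map (inv h) as"] by simp
    then show "rint S r as = rint S r (map (inv h) as)" using Aut_inv_map(2)[OF h] by simp
  qed
  moreover have "inv h x = x" if "x \<in> A" for x
  proof -
    have "h x = x" using h that by (simp add: Aut_def)
    then show ?thesis using inv_f_f[OF bij_is_inj[OF bij], of x] by simp
  qed
  ultimately show ?thesis by (simp add: Aut_def)
qed

lemma Aut_comp: "g \<in> Aut A \<Longrightarrow> h \<in> Aut A \<Longrightarrow> g \<circ> h \<in> Aut A"
proof -
  assume g: "g \<in> Aut A" and h: "h \<in> Aut A"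
  then have aut: "automorphism L S g" "automorphism L S h" by (simp_all add: Aut_def)
  have "automorphism L S (g \<circ> h)"
    unfolding automorphism_def
  proof (intro conjI ballI allI impI)
    show "bij (g \<circ> h)" using bij_comp[OF Aut_bij[OF h] Aut_bij[OF g]] .
  next
    fix f and as :: "'m list" assume f: "f \<in> funs L" "length as = farity L f"
    show "(g \<circ> h) (fint S f as) = fint S f (map (g \<circ> h) as)"
      using automorphism_fint[OF aut(2) f] automorphism_fint[OF aut(1) f(1), of "map h as"] f(2) by simp
  next
    fix r and as :: "'m list" assume r: "r \<in> rels L" "length as = rarity L r"
    show "rint S r as = rint S r (map (g \<circ> h) as)"
      using automorphism_rint[OF aut(2) r] automorphism_rint[OF aut(1) r(1), of "map h as"] r(2) by simp
  qed
  then show ?thesis using g h by (simp add: Aut_def)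
qed

lemma val_aut:
  assumes "automorphism L S h"
  shows "wf_trm L t \<Longrightarrow> \<forall>m\<in>params_trm t. h m = m \<Longrightarrow> val S (\<lambda>v. h (s v)) t = h (val S s t)"
proof (induction t)
  case (Fn f ts)
  have "map (val S (\<lambda>v. h (s v))) ts = map h (map (val S s) ts)" using Fn by auto
  then show ?case using automorphism_fint[OF assms, of f "map (val S s) ts"] Fn.prems(1)
    by (simp del: map_map)
qed auto

lemma holds_aut:
  assumes "automorphism L S h"
  shows "wf_fm L \<phi> \<Longrightarrow> \<forall>m\<in>params \<phi>. h m = m \<Longrightarrow> holds S (\<lambda>v. h (s v)) \<phi> = holds S s \<phi>"
proof (induction \<phi> arbitrary: s)
  case (Eq t u)
  have "inj h" using bij_is_inj[OF automorphism_bij[OF assms]] .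
  moreover have "val S (\<lambda>v. h (s v)) t = h (val S s t)" "val S (\<lambda>v. h (s v)) u = h (val S s u)"
    using Eq val_aut[OF assms] by auto
  ultimately show ?case by (simp add: inj_eq)
next
  case (Rel r ts)
  have "map (val S (\<lambda>v. h (s v))) ts = map h (map (val S s) ts)" using Rel val_aut[OF assms] by auto
  then show ?case using automorphism_rint[OF assms, of r "map (val S s) ts"] Rel.prems(1)
    by (simp del: map_map)
next
  case (Exi v \<phi>)
  have surj: "surj h" using bij_is_surj[OF automorphism_bij[OF assms]] .
  have "holds S ((\<lambda>v. h (s v))(v := h m)) \<phi> = holds S (s(v := m)) \<phi>" for m
  proof -
    have "(\<lambda>u. h ((s(v := m)) u)) = (\<lambda>v. h (s v))(v := h m)" by auto
    moreover have "holds S (\<lambda>u. h ((s(v := m)) u)) \<phi> = holds S (s(v := m)) \<phi>"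
      by (rule Exi.IH) (use Exi.prems in simp_all)
    ultimately show ?thesis by simp
  qed
  then show ?case by simp (metis surj surjD)
qed auto

lemma Aut_DS: "h \<in> Aut A \<Longrightarrow> X \<in> DS A n \<Longrightarrow> map h a \<in> X \<longleftrightarrow> a \<in> X"
proof -
  assume h: "h \<in> Aut A" and "X \<in> DS A n"
  then obtain \<phi> where \<phi>: "\<phi> \<in> fmla L A {..<n}" "X = {a \<in> tup n. holds S ((!) a) \<phi>}"
    unfolding DS_def by blast
  have "holds S ((!) (map h a)) \<phi> = holds S ((!) a) \<phi>" if "length a = n"
  proof -
    have "holds S ((!) (map h a)) \<phi> = holds S (\<lambda>v. h (a ! v)) \<phi>"
      by (rule sat_cong) (use \<phi>(1) that in \<open>auto simp: fmla_def\<close>)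
    also have "\<dots> = holds S ((!) a) \<phi>"
      by (rule holds_aut) (use h \<phi>(1) in \<open>auto simp: Aut_def fmla_def\<close>)
    finally show ?thesis .
  qed
  then show ?thesis using \<phi>(2) by auto
qed

lemma Aut_equiv: "h \<in> Aut A \<Longrightarrow> equiv_over L S A a (map h a)"
  unfolding equiv_over_iff using Aut_DS by auto

lemma Aut_image_iff: "h \<in> Aut A \<Longrightarrow> a \<in> map h ` X \<longleftrightarrow> map (inv h) a \<in> X"
proof -
  assume h: "h \<in> Aut A"
  show ?thesis
  proof
    assume "a \<in> map h ` X"
    then obtain b where "a = map h b" "b \<in> X" by blast
    then show "map (inv h) a \<in> X" using Aut_inv_map(1)[OF h, of b] by simp
  next
    assume "map (inv h) a \<in> X"
    then have "map h (map (inv h) a) \<in> map h ` X" by (rule imageI)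
    then show "a \<in> map h ` X" unfolding Aut_inv_map(2)[OF h] .
  qed
qed

lemma Aut_image_fiber:
  assumes h: "h \<in> Aut B" and Y: "Y \<in> DS B (n + length e)"
  shows "map h ` {a \<in> tup n. a @ e \<in> Y} = {a \<in> tup n. a @ map h e \<in> Y}"
proof (intro set_eqI)
  fix a
  have "map (inv h) a @ e \<in> Y \<longleftrightarrow> map h (map (inv h) a @ e) \<in> Y" using Aut_DS[OF h Y] by blast
  also have "map h (map (inv h) a @ e) = a @ map h e" using Aut_inv_map(2)[OF h] by simp
  finally show "a \<in> map h ` {a \<in> tup n. a @ e \<in> Y} \<longleftrightarrow> a \<in> {a \<in> tup n. a @ map h e \<in> Y}"
    unfolding Aut_image_iff[OF h] by simp
qed

lemma Aut_image_DS:
  assumes h: "h \<in> Aut {}" and X: "X \<in> DS A n"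
  shows "map h ` X \<in> DS (h ` A) n"
proof -
  obtain e Y where e: "set e \<subseteq> A" "Y \<in> DS {} (n + length e)" "X = {a \<in> tup n. a @ e \<in> Y}"
    using DS_fiber_param[OF X] .
  have "{a \<in> tup n. a @ map h e \<in> Y} \<in> DS ({} \<union> set (map h e)) n"
    by (rule DS_fiber) (use e in simp)
  then have "{a \<in> tup n. a @ map h e \<in> Y} \<in> DS (h ` A) n" by (rule DS_mono) (use e(1) in auto)
  then show ?thesis using Aut_image_fiber[OF h e(2)] e(3) by simp
qed

lemma Aut_image_inv: "h \<in> Aut A \<Longrightarrow> map h ` map (inv h) ` X = X" "h \<in> Aut A \<Longrightarrow> map (inv h) ` map h ` X = X"
  by (simp_all add: image_image Aut_inv_map del: map_map)

lemma Aut_image_tup: "h \<in> Aut A \<Longrightarrow> map h ` tup n = tup n"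
  by (auto simp: Aut_image_iff)

end

section \<open>Smallness, homogeneity and saturation in the monster model\<close>

locale monster = fo_structure L S
  for L :: "('f, 'r) language" and S :: "('f, 'r, 'm) fo_struct" +
  fixes \<kappa> :: "'k rel"
  assumes card_order: "Card_order \<kappa>"
    and card_language: "|fmla L {} UNIV :: ('f, 'r, 'm) fm set| <o \<kappa>"
    and sat: "saturated L \<kappa> S"
    and homogeneous: "strongly_homogeneous L \<kappa> S"
begin

definition small :: "'a set \<Rightarrow> bool" where
  "small A \<longleftrightarrow> |A| <o \<kappa>"

lemma infinite_fmla: "infinite (fmla L {} UNIV :: ('f, 'r, 'm) fm set)"
proof
  assume fin: "finite (fmla L {} UNIV :: ('f, 'r, 'm) fm set)"
  have "range (\<lambda>i. Eq (Var i) (Var i)) \<subseteq> (fmla L {} UNIV :: ('f, 'r, 'm) fm set)"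
    by (auto simp: fmla_def)
  moreover have "inj (\<lambda>i. Eq (Var i) (Var i) :: ('f, 'r, 'm) fm)" by (simp add: inj_def)
  ultimately show False using fin by (metis finite_subset finite_imageD infinite_UNIV_nat)
qed

lemma infinite_Field: "infinite (Field \<kappa>)"
proof
  assume "finite (Field \<kappa>)"
  moreover have "|fmla L {} UNIV :: ('f, 'r, 'm) fm set| <o |Field \<kappa>|"
    using card_language card_of_Field_ordIso[OF card_order] ordIso_symmetric ordLess_ordIso_trans by blast
  ultimately show False using infinite_fmla
    by (metis card_of_ordLeq_finite ordLess_imp_ordLeq)
qed

lemma small_finite: "finite A \<Longrightarrow> small A"
proof -
  assume "finite A"
  then have "|A| <o |Field \<kappa>|" using infinite_Field by (rule finite_card_ordLess)
  then show ?thesis unfolding small_def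
    using card_of_Field_ordIso[OF card_order] ordLess_ordIso_trans by blast
qed

lemma small_Un: "small A \<Longrightarrow> small B \<Longrightarrow> small (A \<union> B)"
  unfolding small_def using card_of_Un_ordLess_infinite_Field[OF infinite_Field card_order] by blast

lemma small_set: "small A \<Longrightarrow> small (A \<union> set a)"
  by (simp add: small_Un small_finite)

text \<open>The cardinal \<kappa> may be singular, so unions are estimated against a single small
  infinite set. Adding the formulas to \<open>Q\<close> makes the set infinite and large enough for
  a closure under Skolem functions.\<close>

lemma small_bound:
  fixes Q :: "'a set"
  assumes "small Q"
  obtains B :: "('a + ('f, 'r, 'm) fm) set"
  where "infinite B" "|Q| \<le>o |B|" "|fmla L {} UNIV :: ('f, 'r, 'm) fm set| \<le>o |B|" "small B"
proof -
  let ?F = "fmla L {} UNIV :: ('f, 'r, 'm) fm set"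
  show ?thesis
  proof (rule that[of "Q <+> ?F"])
  show "infinite (Q <+> ?F)" using infinite_fmla by (simp add: finite_Plus_iff)
  show "|Q| \<le>o |Q <+> ?F|" by (rule card_of_Plus1)
  show "|?F| \<le>o |Q <+> ?F|" by (rule card_of_Plus2)
  show "small (Q <+> ?F)"
    using assms card_language card_of_Plus_ordLess_infinite_Field[OF infinite_Field card_order]
    unfolding small_def by blast
  qed
qed

text \<open>The bound must be uniform in \<open>i\<close>: with \<kappa> of countable cofinality, a
  countable union of sets that are merely small each could reach \<kappa>.\<close>

lemma small_UN:
  fixes A :: "nat \<Rightarrow> 'b set" and Q :: "'a set"
  assumes "small Q" "\<And>i. |A i| \<le>o |Q|"
  shows "small (\<Union>i. A i)"
proof -
  obtain B :: "('a + ('f, 'r, 'm) fm) set" where B: "infinite B" "|Q| \<le>o |B|" "small B"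
    using small_bound[OF assms(1)] by metis
  have "|\<Union>i\<in>UNIV. A i| \<le>o |B|"
  proof (rule card_of_UNION_ordLeq_infinite[OF B(1)])
    show "|UNIV :: nat set| \<le>o |B|" using B(1) infinite_iff_card_of_nat by blast
    show "\<forall>i\<in>UNIV. |A i| \<le>o |B|" using assms(2) B(2) ordLeq_transitive by blast
  qed
  then show ?thesis using B(3) ordLeq_ordLess_trans unfolding small_def by blast
qed

lemma small_UN_set: "small (\<Union>i::nat. set (c i))"
proof (rule small_UN)
  show "small (fmla L {} UNIV :: ('f, 'r, 'm) fm set)" using card_language by (simp add: small_def)
  show "|set (c i)| \<le>o |fmla L {} UNIV :: ('f, 'r, 'm) fm set|" for i
    using finite_card_ordLess[OF finite_set infinite_fmla] by (rule ordLess_imp_ordLeq)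
qed

text \<open>Sending \<open>a ! i\<close> to \<open>a' ! i\<close> and fixing \<open>A\<close> is a
  well-defined partial elementary map, because the equations between entries of \<open>a\<close>,
  and between entries and elements of \<open>A\<close>, belong to the type.\<close>

lemma homogeneity:
  assumes A: "small A" and eq: "equiv_over L S A a a'"
  obtains h where "h \<in> Aut A" "map h a = a'"
proof -
  let ?n = "length a"
  have len: "length a' = ?n" using equiv_over_length[OF eq] by simp
  have tr: "holds S ((!) a) \<phi> = holds S ((!) a') \<phi>" if "\<phi> \<in> fmla L A {..<?n}" for \<phi>
  proof -
    have "\<forall>X\<in>DS A ?n. a \<in> X \<longleftrightarrow> a' \<in> X" using eq by (simp add: equiv_over_iff)
    from bspec[OF this DS_I[OF that]] show ?thesis using len by simp
  qed
  obtain idx where idx: "\<And>x. x \<in> set a \<Longrightarrow> idx x < ?n \<and> a ! idx x = x"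
    by (rule index_function[of a]) (rule that)
  define g where "g x = (if x \<in> set a then a' ! idx x else x)" for x
  have gA: "g x = x" if "x \<in> A" for x
  proof (cases "x \<in> set a")
    case True
    have "Eq (Var (idx x)) (Par x) \<in> fmla L A {..<?n}" using that idx[OF True] by (simp add: fmla_def)
    from tr[OF this] have "a' ! idx x = x" using idx[OF True] by simp
    then show ?thesis by (simp add: g_def)
  qed (simp add: g_def)
  have ga: "map g a = a'"
  proof (rule nth_equalityI)
    fix i assume "i < length (map g a)"
    then have i: "i < ?n" by simp
    then have ai: "a ! i \<in> set a" by simp
    have "Eq (Var (idx (a ! i))) (Var i) \<in> fmla L A {..<?n}" using i idx[OF ai] by (simp add: fmla_def)
    from tr[OF this] have "a' ! idx (a ! i) = a' ! i" using idx[OF ai] by simp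
    then show "map g a ! i = a' ! i" using i ai by (simp add: g_def)
  qed (use len in simp)
  have "partial_elementary L S (A \<union> set a) g"
    unfolding partial_elementary_def
  proof (intro ballI allI impI)
    fix \<phi> :: "('f, 'r, 'm) fm" and s
    assume \<phi>: "\<phi> \<in> fmla L {} UNIV" and s: "s ` fv \<phi> \<subseteq> A \<union> set a"
    define \<sigma> where "\<sigma> v = (if s v \<in> set a then Inl (idx (s v)) else Inr (s v))" for v
    have \<phi>0: "\<phi> \<in> fmla L {} (fv \<phi>)" using \<phi> by (simp add: fmla_def)
    have \<sigma>: "\<sigma> v \<in> Inl ` {..<?n} \<union> Inr ` A" if "v \<in> fv \<phi>" for v
      using s that idx[of "s v"] by (auto simp: \<sigma>_def)
    obtain \<phi>' where \<phi>': "\<phi>' \<in> fmla L A {..<?n}" "\<And>t. holds S t \<phi>' = holds S (\<lambda>v. ev t (\<sigma> v)) \<phi>"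
      by (rule subst_fmla[OF \<phi>0, of \<sigma>, OF \<sigma> empty_subsetI]) (assumption, rule that)
    from tr[OF \<phi>'(1)] have "holds S ((!) a) \<phi>' = holds S ((!) a') \<phi>'" .
    moreover have "(\<lambda>v. ev ((!) a) (\<sigma> v)) = s"
    proof
      show "ev ((!) a) (\<sigma> v) = s v" for v using idx[of "s v"] by (simp add: \<sigma>_def)
    qed
    moreover have "(\<lambda>v. ev ((!) a') (\<sigma> v)) = g \<circ> s"
    proof
      show "ev ((!) a') (\<sigma> v) = (g \<circ> s) v" for v by (simp add: \<sigma>_def g_def)
    qed
    ultimately show "holds S s \<phi> = holds S (g \<circ> s) \<phi>" using \<phi>'(2) by metis
  qed
  then obtain h where h: "automorphism L S h" "\<forall>x\<in>A \<union> set a. h x = g x"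
    using homogeneous small_set[OF A, of a] unfolding strongly_homogeneous_def small_def by blast
  show ?thesis
  proof (rule that)
    show "h \<in> Aut A" using h gA by (simp add: Aut_def)
    have "map h a = map g a" using h(2) by simp
    then show "map h a = a'" using ga by simp
  qed
qed

lemma saturation1:
  assumes A: "small A" and G: "G \<subseteq> DS A 1"
    and fip: "\<And>G0. finite G0 \<Longrightarrow> G0 \<subseteq> G \<Longrightarrow> tup 1 \<inter> \<Inter>G0 \<noteq> {}"
  obtains m where "\<And>X. X \<in> G \<Longrightarrow> [m] \<in> X"
proof -
  define D where "D \<phi> = {a \<in> tup 1. holds S ((!) a) \<phi>}" for \<phi>
  have D: "[m] \<in> D \<phi> \<longleftrightarrow> holds S (\<lambda>_. m) \<phi>" if "\<phi> \<in> fmla L A {0}" for \<phi> m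
  proof -
    have "holds S ((!) [m]) \<phi> = holds S (\<lambda>_. m) \<phi>"
      by (rule sat_cong) (use that in \<open>auto simp: fmla_def\<close>)
    then show ?thesis by (simp add: D_def)
  qed
  define \<Sigma> where "\<Sigma> = {\<phi> \<in> fmla L A {0}. D \<phi> \<in> G}"
  have fin: "\<exists>m. \<forall>\<phi>\<in>\<Sigma>0. holds S (\<lambda>_. m) \<phi>" if "\<Sigma>0 \<subseteq> \<Sigma>" "finite \<Sigma>0" for \<Sigma>0
  proof -
    have "tup 1 \<inter> \<Inter>(D ` \<Sigma>0) \<noteq> {}" by (rule fip) (use that in \<open>auto simp: \<Sigma>_def\<close>)
    then obtain a where "a \<in> tup 1 \<inter> \<Inter>(D ` \<Sigma>0)" by blast
    then have a: "length a = 1" "\<And>\<phi>. \<phi> \<in> \<Sigma>0 \<Longrightarrow> a \<in> D \<phi>" by simp_all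
    then obtain m where "a = [m]" by (cases a) auto
    then show ?thesis using a(2) D that(1) unfolding \<Sigma>_def by blast
  qed
  have "|A| <o \<kappa> \<and> \<Sigma> \<subseteq> fmla L A {0} \<and>
        (\<forall>\<Sigma>0\<subseteq>\<Sigma>. finite \<Sigma>0 \<longrightarrow> (\<exists>m. \<forall>\<phi>\<in>\<Sigma>0. holds S (\<lambda>_. m) \<phi>))"
    using A fin unfolding small_def \<Sigma>_def by blast
  then obtain m where m: "\<forall>\<phi>\<in>\<Sigma>. holds S (\<lambda>_. m) \<phi>" using sat unfolding saturated_def by meson
  show ?thesis
  proof (rule that)
    fix X assume X: "X \<in> G"
    then have "X \<in> DS A 1" using G by blast
    then obtain \<phi> where "\<phi> \<in> fmla L A {..<1}" and X': "X = D \<phi>" unfolding DS_def D_def by blast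
    moreover have "{..<1} = {0::nat}" by auto
    ultimately have \<phi>: "\<phi> \<in> fmla L A {0}" by simp
    then have "\<phi> \<in> \<Sigma>" using X X' by (simp add: \<Sigma>_def)
    then show "[m] \<in> X" using m D[OF \<phi>] X' by simp
  qed
qed

text \<open>Saturation is given in one variable only. The first \<open>n\<close> coordinates realize
  the projections of all finite intersections, which an existential quantifier keeps definable over
  \<open>A\<close>; the last coordinate then realizes the fibers, with these \<open>n\<close>
  entries as additional parameters.\<close>

lemma saturation:
  assumes A: "small A"
  shows "G \<subseteq> DS A n \<Longrightarrow> (\<And>G0. finite G0 \<Longrightarrow> G0 \<subseteq> G \<Longrightarrow> tup n \<inter> \<Inter>G0 \<noteq> {}) \<Longrightarrow>
    \<exists>a\<in>tup n. \<forall>X\<in>G. a \<in> X"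
proof (induction n arbitrary: G)
  case 0
  have "[] \<in> X" if "X \<in> G" for X
  proof -
    have "tup 0 \<inter> \<Inter>{X} \<noteq> {}" by (rule 0(2)) (use that in auto)
    then show ?thesis by auto
  qed
  then show ?case by (intro bexI[of _ "[]"]) auto
next
  case (Suc n)
  define P where "P G0 = {a :: 'm list. a \<in> tup n \<and> (\<exists>m. a @ [m] \<in> tup (Suc n) \<inter> \<Inter>G0)}" for G0
  define \<G> where "\<G> = {G0. finite G0 \<and> G0 \<subseteq> G}"
  have "\<exists>a\<in>tup n. \<forall>X\<in>P ` \<G>. a \<in> X"
  proof (rule Suc.IH)
    have "P G0 \<in> DS A n" if "G0 \<in> \<G>" for G0
      unfolding P_def by (intro DS_proj DS_INT) (use that Suc.prems(1) in \<open>auto simp: \<G>_def\<close>)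
    then show "P ` \<G> \<subseteq> DS A n" by blast
  next
    fix H0 assume "finite H0" "H0 \<subseteq> P ` \<G>"
    then obtain H where H: "H \<subseteq> \<G>" "finite H" "H0 = P ` H" by (meson finite_subset_image)
    have "tup (Suc n) \<inter> \<Inter>(\<Union>H) \<noteq> {}"
      by (rule Suc.prems(2)) (use H in \<open>auto simp: \<G>_def\<close>)
    then obtain c where c: "length c = Suc n" "c \<in> \<Inter>(\<Union>H)" by auto
    then have c': "butlast c @ [last c] = c" by (metis append_butlast_last_id list.size(3) nat.distinct(1))
    have "butlast c \<in> P G0" if "G0 \<in> H" for G0
      unfolding P_def using c c' that by (auto intro!: exI[of _ "last c"])
    then have "butlast c \<in> tup n \<inter> \<Inter>H0" using H(3) c(1) by auto
    then show "tup n \<inter> \<Inter>H0 \<noteq> {}" by blast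
  qed
  then obtain a where a: "length a = n" "\<And>G0. G0 \<in> \<G> \<Longrightarrow> a \<in> P G0" by auto
  define Q where "Q X = {c \<in> tup 1. a @ c \<in> X}" for X
  have "small (A \<union> set a)" using A by (rule small_set)
  moreover have "Q ` G \<subseteq> DS (A \<union> set a) 1"
  proof (intro image_subsetI)
    fix X assume "X \<in> G"
    then have "X \<in> DS A (length a + 1)" using Suc.prems(1) a(1) by auto
    then show "Q X \<in> DS (A \<union> set a) 1" unfolding Q_def by (rule DS_fiber_left)
  qed
  moreover have "tup 1 \<inter> \<Inter>H0 \<noteq> {}" if H0: "finite H0" "H0 \<subseteq> Q ` G" for H0
  proof -
    obtain H where H: "H \<subseteq> G" "finite H" "H0 = Q ` H" using finite_subset_image[OF H0] by blast
    then have "a \<in> P H" using a(2) by (simp add: \<G>_def)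
    then obtain m where "a @ [m] \<in> \<Inter>H" by (auto simp: P_def)
    then have "[m] \<in> tup 1 \<inter> \<Inter>H0" using H(3) by (auto simp: Q_def)
    then show ?thesis by blast
  qed
  ultimately obtain m where "\<And>X. X \<in> Q ` G \<Longrightarrow> [m] \<in> X" using saturation1 by metis
  then have "\<forall>X\<in>G. a @ [m] \<in> X" by (auto simp: Q_def)
  then show ?case using a(1) by (intro bexI[of _ "a @ [m]"]) auto
qed

end

section \<open>Ideals and global types\<close>

context fo_structure
begin

definition def_ideal :: "nat \<Rightarrow> 'm list set set \<Rightarrow> bool" where
  "def_ideal n J \<longleftrightarrow> J \<subseteq> DS UNIV n \<and> {} \<in> J \<and> (\<forall>X\<in>J. \<forall>Y\<in>DS UNIV n. Y \<subseteq> X \<longrightarrow> Y \<in> J) \<and>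
     (\<forall>X\<in>J. \<forall>Y\<in>J. X \<union> Y \<in> J)"

definition fib :: "nat \<Rightarrow> 'm list set \<Rightarrow> 'm list \<Rightarrow> 'm list set" where
  "fib n Y e = {a \<in> tup n. a @ e \<in> Y}"

definition S1 :: "nat \<Rightarrow> 'm list set set \<Rightarrow> bool" where
  "S1 n J \<longleftrightarrow> def_ideal n J \<and> (\<forall>h\<in>Aut {}. \<forall>X\<in>J. map h ` X \<in> J) \<and>
     (\<forall>m Y c. Y \<in> DS {} (n + m) \<and> (\<forall>i. length (c i) = m) \<and> indiscernible L S {} c \<and>
        fib n Y (c 0) \<inter> fib n Y (c 1) \<in> J \<longrightarrow> fib n Y (c 0) \<in> J)"

text \<open>A complete global type in \<open>n\<close> variables, as the ultrafilter of the definable sets it contains.\<close>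

definition ultra :: "nat \<Rightarrow> 'm list set set \<Rightarrow> bool" where
  "ultra n U \<longleftrightarrow> U \<subseteq> DS UNIV n \<and> tup n \<in> U \<and> {} \<notin> U \<and> (\<forall>X\<in>U. \<forall>Y\<in>U. X \<inter> Y \<in> U) \<and>
     (\<forall>X\<in>DS UNIV n. X \<in> U \<or> tup n - X \<in> U)"

definition realizes :: "nat \<Rightarrow> 'm list set set \<Rightarrow> 'm set \<Rightarrow> 'm list \<Rightarrow> bool" where
  "realizes n U A a \<longleftrightarrow> length a = n \<and> (\<forall>X\<in>U \<inter> DS A n. a \<in> X)"

definition wd :: "nat \<Rightarrow> 'm list set set \<Rightarrow> 'm set \<Rightarrow> 'm list \<Rightarrow> bool" where
  "wd n J A a \<longleftrightarrow> length a = n \<and> (\<forall>X\<in>J \<inter> DS A n. a \<notin> X)"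

definition invariant_type :: "'m set \<Rightarrow> 'm list set set \<Rightarrow> bool" where
  "invariant_type A V \<longleftrightarrow> (\<forall>h\<in>Aut A. \<forall>X\<in>V. map h ` X \<in> V)"

text \<open>The Tarski-Vaught criterion, for tuples of every length. This is the form in which
  coheirs use that \<open>M\<close> is a model.\<close>

definition mdl :: "'m set \<Rightarrow> bool" where
  "mdl M \<longleftrightarrow> (\<forall>n. \<forall>X\<in>DS M n. X \<noteq> {} \<longrightarrow> (\<exists>a\<in>X. set a \<subseteq> M))"

lemma fib_DS: "Y \<in> DS A (n + m) \<Longrightarrow> length e = m \<Longrightarrow> fib n Y e \<in> DS (A \<union> set e) n"
  unfolding fib_def using DS_fiber by blast

lemma Aut_fib: "h \<in> Aut A \<Longrightarrow> Y \<in> DS A (n + m) \<Longrightarrow> length e = m \<Longrightarrow> map h ` fib n Y e = fib n Y (map h e)"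
  unfolding fib_def using Aut_image_fiber by blast

lemma fib_iff [simp]: "a \<in> fib n Y e \<longleftrightarrow> length a = n \<and> a @ e \<in> Y"
  by (simp add: fib_def)

lemma def_ideal_down: "def_ideal n J \<Longrightarrow> X \<in> J \<Longrightarrow> Y \<subseteq> X \<Longrightarrow> Y \<in> DS A n \<Longrightarrow> Y \<in> J"
  unfolding def_ideal_def using DS_UNIV by metis

lemma def_ideal_Un: "def_ideal n J \<Longrightarrow> X \<in> J \<Longrightarrow> Y \<in> J \<Longrightarrow> X \<union> Y \<in> J"
  unfolding def_ideal_def by simp

lemma def_ideal_empty: "def_ideal n J \<Longrightarrow> {} \<in> J"
  unfolding def_ideal_def by simp

lemma def_ideal_DS: "def_ideal n J \<Longrightarrow> X \<in> J \<Longrightarrow> X \<in> DS UNIV n"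
  unfolding def_ideal_def by (elim conjE) (rule subsetD)

lemma S1_ideal: "S1 n J \<Longrightarrow> def_ideal n J"
  by (simp add: S1_def)

lemma S1_Aut: "S1 n J \<Longrightarrow> h \<in> Aut A \<Longrightarrow> X \<in> J \<Longrightarrow> map h ` X \<in> J"
  using Aut_empty[of h A] by (simp add: S1_def)

lemma S1_Aut_iff: "S1 n J \<Longrightarrow> h \<in> Aut A \<Longrightarrow> map h ` X \<in> J \<longleftrightarrow> X \<in> J"
  using S1_Aut[of n J h A X] S1_Aut[of n J "inv h" A "map h ` X"] Aut_inv[of h A] Aut_image_inv(2)[of h A X]
  by auto

lemma ultra_DS: "ultra n U \<Longrightarrow> X \<in> U \<Longrightarrow> X \<in> DS UNIV n"
  unfolding ultra_def by (elim conjE) (rule subsetD)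

lemma ultra_Int: "ultra n U \<Longrightarrow> X \<in> U \<Longrightarrow> Y \<in> U \<Longrightarrow> X \<inter> Y \<in> U"
  unfolding ultra_def by simp

lemma ultra_compl: "ultra n U \<Longrightarrow> X \<in> DS A n \<Longrightarrow> tup n - X \<in> U \<longleftrightarrow> X \<notin> U"
proof -
  assume U: "ultra n U" and X: "X \<in> DS A n"
  have "X \<inter> (tup n - X) = {}" by blast
  then have "X \<in> U \<Longrightarrow> tup n - X \<in> U \<Longrightarrow> False" using ultra_Int[OF U, of X "tup n - X"] U by (simp add: ultra_def)
  moreover have "X \<in> U \<or> tup n - X \<in> U" using U DS_UNIV[OF X] by (simp add: ultra_def)
  ultimately show ?thesis by blast
qed

lemma ultra_INT:
  assumes "ultra n U" "finite G"
  shows "G \<subseteq> U \<Longrightarrow> tup n \<inter> \<Inter>G \<in> U"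
  using assms(2)
proof (induction G rule: finite_induct)
  case empty
  then show ?case using assms(1) by (simp add: ultra_def)
next
  case (insert X G)
  have "tup n \<inter> \<Inter>(insert X G) = X \<inter> (tup n \<inter> \<Inter>G)" by auto
  then show ?case using insert ultra_Int[OF assms(1)] by simp
qed

lemma ultra_image:
  assumes h: "h \<in> Aut {}" and U: "ultra n U"
  shows "ultra n ((`) (map h) ` U)"
  unfolding ultra_def
proof (intro conjI ballI)
  show "(`) (map h) ` U \<subseteq> DS UNIV n"
    using Aut_image_DS[OF h ultra_DS[OF U]] DS_UNIV by blast
  have "map h ` tup n = tup n" by (rule Aut_image_tup[OF h])
  then show "tup n \<in> (`) (map h) ` U" using U unfolding ultra_def by (metis imageI)
  show "{} \<notin> (`) (map h) ` U" using U by (auto simp: ultra_def)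
next
  fix X Y assume "X \<in> (`) (map h) ` U" "Y \<in> (`) (map h) ` U"
  then obtain X' Y' where X': "X' \<in> U" "Y' \<in> U" "X = map h ` X'" "Y = map h ` Y'" by blast
  have "inj (map h)" using Aut_inj_map[OF h] by (simp add: inj_def)
  then have "X \<inter> Y = map h ` (X' \<inter> Y')" using X' by (simp add: image_Int)
  then show "X \<inter> Y \<in> (`) (map h) ` U" using ultra_Int[OF U X'(1,2)] by blast
next
  fix X assume X: "X \<in> DS UNIV n"
  let ?X = "map (inv h) ` X"
  have "?X \<in> DS UNIV n" using Aut_image_DS[OF Aut_inv[OF h] X] DS_UNIV by blast
  then consider "?X \<in> U" | "tup n - ?X \<in> U" using U unfolding ultra_def by blast
  then show "X \<in> (`) (map h) ` U \<or> tup n - X \<in> (`) (map h) ` U"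
  proof cases
    case 1
    then have "map h ` ?X \<in> (`) (map h) ` U" by (rule imageI)
    then show ?thesis using Aut_image_inv(1)[OF h] by simp
  next
    case 2
    then have "map h ` (tup n - ?X) \<in> (`) (map h) ` U" by (rule imageI)
    moreover have "map h ` (tup n - ?X) = tup n - X"
    proof (rule set_eqI)
      fix a
      show "a \<in> map h ` (tup n - ?X) \<longleftrightarrow> a \<in> tup n - X"
        using Aut_image_iff[OF h, of a "tup n - ?X"] Aut_image_iff[OF Aut_inv[OF h], of "map (inv h) a" X]
          Aut_bij[OF h] Aut_inv_map(2)[OF h, of a] by (simp add: inv_inv_eq)
    qed
    ultimately show ?thesis by simp
  qed
qed

lemma realizes_iff: "ultra n U \<Longrightarrow> realizes n U A a \<Longrightarrow> X \<in> DS A n \<Longrightarrow> a \<in> X \<longleftrightarrow> X \<in> U"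
proof
  assume U: "ultra n U" and a: "realizes n U A a" and X: "X \<in> DS A n"
  show "X \<in> U \<Longrightarrow> a \<in> X" using a X by (simp add: realizes_def)
  assume "a \<in> X"
  show "X \<in> U"
  proof (rule ccontr)
    assume "X \<notin> U"
    then have "tup n - X \<in> U \<inter> DS A n" using ultra_compl[OF U X] DS_compl[OF X] by simp
    then have "a \<in> tup n - X" using a unfolding realizes_def by blast
    then show False using \<open>a \<in> X\<close> by simp
  qed
qed

lemma realizesD: "realizes n U A a \<Longrightarrow> X \<in> U \<Longrightarrow> X \<in> DS A n \<Longrightarrow> a \<in> X"
  by (simp add: realizes_def)

lemma realizes_mono: "realizes n U B a \<Longrightarrow> A \<subseteq> B \<Longrightarrow> realizes n U A a"
  unfolding realizes_def using DS_mono[of _ A n B] by auto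

lemma realizes_length: "realizes n U A a \<Longrightarrow> length a = n"
  by (simp add: realizes_def)

lemma realizes_equiv:
  assumes "ultra n U" "realizes n U A a" "realizes n U A b"
  shows "equiv_over L S A a b"
proof (rule equiv_overI[of _ n])
  show "a \<in> X \<Longrightarrow> b \<in> X" if "X \<in> DS A n" for X
    using realizes_iff[OF assms(1,2) that] realizes_iff[OF assms(1,3) that] by simp
qed (use assms(2,3) in \<open>simp_all add: realizes_def\<close>)

lemma wd_mono: "wd n J B a \<Longrightarrow> A \<subseteq> B \<Longrightarrow> wd n J A a"
  unfolding wd_def using DS_mono[of _ A n B] by auto

lemma realizes_wd: "ultra n U \<Longrightarrow> U \<inter> J = {} \<Longrightarrow> realizes n U A a \<Longrightarrow> wd n J A a"
  unfolding wd_def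
proof (intro conjI ballI notI)
  fix X assume U: "ultra n U" "U \<inter> J = {}" "realizes n U A a" and X: "X \<in> J \<inter> DS A n" "a \<in> X"
  then have "X \<in> U" using realizes_iff[OF U(1,3), of X] by simp
  then show False using U(2) X by blast
qed (simp add: realizes_def)

text \<open>The ultrafilter theorem relative to an ideal. In a maximal family without finite
  intersections in \<open>J\<close>, leaving both \<open>X\<close> and its complement out would put
  two sets into \<open>J\<close> whose union contains a finite intersection of the family.\<close>

lemma ultra_exists:
  assumes J: "def_ideal n J" and G: "G \<subseteq> DS UNIV n"
    and fip: "\<And>G0. finite G0 \<Longrightarrow> G0 \<subseteq> G \<Longrightarrow> tup n \<inter> \<Inter>G0 \<notin> J"
  obtains U where "ultra n U" "G \<subseteq> U" "U \<inter> J = {}"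
proof -
  define FIP where "FIP H \<longleftrightarrow> (\<forall>H0. finite H0 \<and> H0 \<subseteq> H \<longrightarrow> tup n \<inter> \<Inter>H0 \<notin> J)" for H
  define \<A> where "\<A> = {H. G \<subseteq> H \<and> H \<subseteq> DS UNIV n \<and> FIP H}"
  have "\<exists>U\<in>\<A>. \<forall>X\<in>\<A>. U \<subseteq> X \<longrightarrow> X = U"
  proof (rule subset_Zorn_nonempty)
    show "\<A> \<noteq> {}" using G fip by (auto simp: \<A>_def FIP_def)
  next
    fix C assume C: "C \<noteq> {}" "subset.chain \<A> C"
    have CA: "C \<subseteq> \<A>" using C(2) by (simp add: subset.chain_def)
    have "FIP (\<Union>C)"
      unfolding FIP_def
    proof (intro allI impI, elim conjE)
      fix H0 assume "finite H0" "H0 \<subseteq> \<Union>C"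
      then obtain H where "H \<in> C" "H0 \<subseteq> H"
        using finite_subset_Union_chain[of H0 C \<A>] C by blast
      then show "tup n \<inter> \<Inter>H0 \<notin> J" using CA \<open>finite H0\<close> by (auto simp: \<A>_def FIP_def)
    qed
    moreover have "G \<subseteq> \<Union>C" "\<Union>C \<subseteq> DS UNIV n" using C(1) CA unfolding \<A>_def by blast+
    ultimately show "\<Union>C \<in> \<A>" by (simp add: \<A>_def)
  qed
  then obtain U where "U \<in> \<A>" and max: "\<And>X. X \<in> \<A> \<Longrightarrow> U \<subseteq> X \<Longrightarrow> X = U" by blast
  then have GU: "G \<subseteq> U" and UDS: "U \<subseteq> DS UNIV n" and FIPU: "FIP U" by (simp_all add: \<A>_def)
  \<comment> \<open>Maximality in usable form: a definable set belongs to \<open>U\<close> as soon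
    as adding it would not create a finite intersection in \<open>J\<close>.\<close>
  have in_U: "X \<in> U" if X: "X \<in> DS UNIV n" and f: "\<And>H0. finite H0 \<Longrightarrow> H0 \<subseteq> U \<Longrightarrow> tup n \<inter> \<Inter>H0 \<inter> X \<notin> J" for X
  proof -
    have "FIP (insert X U)"
      unfolding FIP_def
    proof (intro allI impI, elim conjE)
      fix H0 assume H0: "finite H0" "H0 \<subseteq> insert X U"
      have "tup n \<inter> \<Inter>(H0 - {X}) \<inter> X \<notin> J" by (rule f) (use H0 in auto)
      moreover have "tup n \<inter> \<Inter>(H0 - {X}) \<inter> X \<subseteq> tup n \<inter> \<Inter>H0" by blast
      moreover have "tup n \<inter> \<Inter>(H0 - {X}) \<in> DS UNIV n" by (rule DS_INT) (use H0 UDS in auto)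
      ultimately show "tup n \<inter> \<Inter>H0 \<notin> J" using def_ideal_down[OF J] DS_Int X by metis
    qed
    then have "insert X U \<in> \<A>" using GU UDS X by (auto simp: \<A>_def)
    then show ?thesis using max by blast
  qed
  have UJ: "U \<inter> J = {}"
  proof (rule ccontr)
    assume "U \<inter> J \<noteq> {}"
    then obtain X where X: "X \<in> U" "X \<in> J" by blast
    then have "tup n \<inter> \<Inter>{X} \<notin> J" using FIPU unfolding FIP_def by blast
    moreover have "tup n \<inter> \<Inter>{X} = X" using DS_tup[of X UNIV n] UDS X(1) by blast
    ultimately show False using X(2) by simp
  qed
  have UINT: "tup n \<inter> \<Inter>H0 \<notin> J" if "finite H0" "H0 \<subseteq> U" for H0
    using FIPU that by (simp add: FIP_def)
  have "ultra n U"
    unfolding ultra_def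
  proof (intro conjI ballI)
    show "U \<subseteq> DS UNIV n" by (rule UDS)
    show "tup n \<in> U"
    proof (rule in_U)
      fix H0 assume "finite H0" "H0 \<subseteq> U"
      then show "tup n \<inter> \<Inter>H0 \<inter> tup n \<notin> J" using UINT by (metis Int_assoc Int_commute Int_absorb)
    qed simp
    show "{} \<notin> U" using UJ def_ideal_empty[OF J] by blast
  next
    fix X Y assume XY: "X \<in> U" "Y \<in> U"
    show "X \<inter> Y \<in> U"
    proof (rule in_U)
      show "X \<inter> Y \<in> DS UNIV n" using XY UDS by blast
      fix H0 assume "finite H0" "H0 \<subseteq> U"
      then have "tup n \<inter> \<Inter>(insert X (insert Y H0)) \<notin> J" using XY by (intro UINT) auto
      moreover have "tup n \<inter> \<Inter>(insert X (insert Y H0)) = tup n \<inter> \<Inter>H0 \<inter> (X \<inter> Y)" by blast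
      ultimately show "tup n \<inter> \<Inter>H0 \<inter> (X \<inter> Y) \<notin> J" by simp
    qed
  next
    fix X assume X: "X \<in> DS UNIV n"
    show "X \<in> U \<or> tup n - X \<in> U"
    proof (rule ccontr)
      assume n: "\<not> ?thesis"
      then obtain H where H: "finite H" "H \<subseteq> U" "tup n \<inter> \<Inter>H \<inter> X \<in> J" using in_U[OF X] by blast
      obtain H' where H': "finite H'" "H' \<subseteq> U" "tup n \<inter> \<Inter>H' \<inter> (tup n - X) \<in> J"
        using in_U[OF DS_compl[OF X]] n by blast
      have "tup n \<inter> \<Inter>(H \<union> H') \<subseteq> tup n \<inter> \<Inter>H \<inter> X \<union> tup n \<inter> \<Inter>H' \<inter> (tup n - X)" by blast
      moreover have "tup n \<inter> \<Inter>(H \<union> H') \<in> DS UNIV n" by (rule DS_INT) (use H H' UDS in auto)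
      ultimately have "tup n \<inter> \<Inter>(H \<union> H') \<in> J" using def_ideal_down[OF J] def_ideal_Un[OF J H(3) H'(3)] by blast
      moreover have "tup n \<inter> \<Inter>(H \<union> H') \<notin> J" by (rule UINT) (use H H' in auto)
      ultimately show False by simp
    qed
  qed
  then show ?thesis using that GU UJ by blast
qed

lemma ultra_extends_type:
  assumes J: "def_ideal n J" and a: "wd n J A a"
  obtains U where "ultra n U" "U \<inter> J = {}" "realizes n U A a"
proof -
  define G where "G = {X \<in> DS A n. a \<in> X}"
  have "G \<subseteq> DS UNIV n" using DS_UNIV[of _ A n] by (auto simp: G_def)
  moreover have "tup n \<inter> \<Inter>G0 \<notin> J" if G0: "finite G0" "G0 \<subseteq> G" for G0
  proof -
    have "tup n \<inter> \<Inter>G0 \<in> DS A n" by (rule DS_INT) (use G0 in \<open>auto simp: G_def\<close>)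
    moreover have "a \<in> tup n \<inter> \<Inter>G0" using a G0(2) by (auto simp: G_def wd_def)
    ultimately show ?thesis using a unfolding wd_def by blast
  qed
  ultimately obtain U where U: "ultra n U" "G \<subseteq> U" "U \<inter> J = {}" using ultra_exists[OF J] by metis
  have "realizes n U A a"
    unfolding realizes_def
  proof (intro conjI ballI)
    fix X assume X: "X \<in> U \<inter> DS A n"
    show "a \<in> X"
    proof (rule ccontr)
      assume "a \<notin> X"
      then have "tup n - X \<in> G" using a X by (auto simp: G_def wd_def)
      then show False using U(2) ultra_compl[OF U(1), of X A] X by blast
    qed
  qed (use a in \<open>simp add: wd_def\<close>)
  then show ?thesis using that U by blast
qed

text \<open>
  A type each of whose members has a point with coordinates in \<open>A\<close> is invariant: automorphisms over
  \<open>A\<close> fix that point, so \<open>X - h X\<close> cannot belong to the type.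
\<close>

lemma invariant_typeI:
  assumes V: "ultra n V" and fs: "\<And>X. X \<in> V \<Longrightarrow> \<exists>c\<in>X. set c \<subseteq> A"
  shows "invariant_type A V"
  unfolding invariant_type_def
proof (intro ballI)
  fix h X assume h: "h \<in> Aut A" and X: "X \<in> V"
  have hX: "map h ` X \<in> DS UNIV n"
    using Aut_image_DS[OF Aut_empty[OF h] ultra_DS[OF V X]] DS_UNIV by blast
  show "map h ` X \<in> V"
  proof (rule ccontr)
    assume "map h ` X \<notin> V"
    then have "X \<inter> (tup n - map h ` X) \<in> V" using ultra_compl[OF V hX] ultra_Int[OF V X] by simp
    then obtain c where c: "c \<in> X \<inter> (tup n - map h ` X)" "set c \<subseteq> A" using fs by blast
    then have "c = map h c" using Aut_fix[OF h] by simp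
    then show False using c(1) by blast
  qed
qed

lemma invariant_type_iff:
  "invariant_type A V \<Longrightarrow> h \<in> Aut A \<Longrightarrow> map h ` X \<in> V \<longleftrightarrow> X \<in> V"
  using Aut_inv[of h A] Aut_image_inv(2)[of h A X] unfolding invariant_type_def by metis

text \<open>The automorphism carries the fiber of \<open>X\<close> over \<open>u\<close> to its
  fiber over \<open>v\<close>, so by invariance \<open>V\<close> contains both or neither. Hence the
  type of a realization of \<open>V\<close> over a tuple depends only on the type of that
  tuple.\<close>

lemma invariant_type_equiv:
  assumes V: "ultra m V" "invariant_type A V" and h: "h \<in> Aut A" and uv: "map h u = v"
    and x: "realizes m V (A \<union> set u) x" and y: "realizes m V (A \<union> set v) y"
  shows "equiv_over L S A (u @ x) (v @ y)"
proof (rule equiv_overI[of _ "length u + m"])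
  fix X assume X: "X \<in> DS A (length u + m)" "u @ x \<in> X"
  define Xu where "Xu = {a \<in> tup m. u @ a \<in> X}"
  have Xu: "Xu \<in> DS (A \<union> set u) m" unfolding Xu_def by (rule DS_fiber_left) (rule X(1))
  have hXu: "map h ` Xu = {a \<in> tup m. v @ a \<in> X}"
  proof (rule set_eqI)
    fix a
    have "u @ map (inv h) a \<in> X \<longleftrightarrow> map h (u @ map (inv h) a) \<in> X" using Aut_DS[OF h X(1)] by blast
    also have "map h (u @ map (inv h) a) = v @ a" using uv Aut_inv_map(2)[OF h, of a] by simp
    finally show "a \<in> map h ` Xu \<longleftrightarrow> a \<in> {a \<in> tup m. v @ a \<in> X}"
      unfolding Aut_image_iff[OF h] by (simp add: Xu_def)
  qed
  have "length v = length u" using uv by auto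
  then have hXu': "map h ` Xu \<in> DS (A \<union> set v) m" unfolding hXu using DS_fiber_left[of X A v m] X(1) by simp
  have "x \<in> Xu" using X(2) realizes_length[OF x] by (simp add: Xu_def)
  then have "Xu \<in> V" using realizes_iff[OF V(1) x Xu] by simp
  then have "map h ` Xu \<in> V" using invariant_type_iff[OF V(2) h] by simp
  then have "y \<in> map h ` Xu" using realizes_iff[OF V(1) y hXu'] by simp
  then show "v @ y \<in> X" unfolding hXu by simp
qed (use realizes_length[OF x] realizes_length[OF y] uv in auto)

text \<open>The definable sets without a point in \<open>M\<close> form an ideal, and since
  \<open>M\<close> is a model no set in the type of \<open>a\<close> over \<open>M\<close> belongs
  to it. A global type avoiding the ideal is finitely satisfiable in \<open>M\<close>, hence
  invariant.\<close>

lemma coheir: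
  assumes M: "mdl M" and a: "length a = n"
  obtains V where "ultra n V" "realizes n V M a" "invariant_type M V"
proof -
  define J where "J = {X \<in> DS UNIV n. \<forall>c\<in>X. \<not> set c \<subseteq> M}"
  have J: "def_ideal n J" unfolding def_ideal_def J_def by (simp add: DS_Un subset_iff) blast
  have "wd n J M a"
    unfolding wd_def
  proof (intro conjI ballI notI)
    fix X assume "X \<in> J \<inter> DS M n" "a \<in> X"
    then show False using M unfolding mdl_def J_def by blast
  qed (rule a)
  then obtain V where V: "ultra n V" "V \<inter> J = {}" "realizes n V M a" using ultra_extends_type[OF J] by metis
  have "invariant_type M V"
  proof (rule invariant_typeI[OF V(1)])
    fix X assume "X \<in> V"
    then show "\<exists>c\<in>X. set c \<subseteq> M" using V(2) ultra_DS[OF V(1)] unfolding J_def by blast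
  qed
  then show ?thesis using that V by blast
qed

end

context monster
begin

lemma realizes_exists:
  assumes U: "ultra n U" and A: "small A"
  obtains a where "realizes n U A a"
proof -
  have "\<exists>a\<in>tup n. \<forall>X\<in>U \<inter> DS A n. a \<in> X"
  proof (rule saturation[OF A])
    fix G0 assume "finite G0" "G0 \<subseteq> U \<inter> DS A n"
    then have "tup n \<inter> \<Inter>G0 \<in> U" using ultra_INT[OF U] by simp
    then show "tup n \<inter> \<Inter>G0 \<noteq> {}" using U by (auto simp: ultra_def)
  qed simp
  then show ?thesis using that by (auto simp: realizes_def)
qed

lemma equiv_wd:
  assumes J: "def_ideal n J" and a: "wd n J A a" and B: "small B" "A \<subseteq> B"
  obtains b where "equiv_over L S A a b" "wd n J B b"
proof -
  obtain U where U: "ultra n U" "U \<inter> J = {}" "realizes n U A a" using ultra_extends_type[OF J a] .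
  obtain b where b: "realizes n U B b" using realizes_exists[OF U(1) B(1)] .
  have "equiv_over L S A a b" by (rule realizes_equiv[OF U(1,3)]) (rule realizes_mono[OF b B(2)])
  then show ?thesis using that realizes_wd[OF U(1,2) b] by blast
qed

section \<open>Indiscernible sequences\<close>

lemma indiscernible_aut:
  assumes "small A"
  shows "indiscernible L S A d \<longleftrightarrow> (\<forall>is js. sorted_wrt (<) is \<and> sorted_wrt (<) js \<and> length is = length js
     \<longrightarrow> (\<exists>h\<in>Aut A. map h (concat (map d is)) = concat (map d js)))"
  unfolding indiscernible_def
proof (intro all_cong1 imp_cong refl)
  fix "is" js
  show "equiv_over L S A (concat (map d is)) (concat (map d js)) \<longleftrightarrow>
     (\<exists>h\<in>Aut A. map h (concat (map d is)) = concat (map d js))"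
  proof
    assume "equiv_over L S A (concat (map d is)) (concat (map d js))"
    then show "\<exists>h\<in>Aut A. map h (concat (map d is)) = concat (map d js)" using homogeneity[OF assms] by metis
  next
    assume "\<exists>h\<in>Aut A. map h (concat (map d is)) = concat (map d js)"
    then show "equiv_over L S A (concat (map d is)) (concat (map d js))" using Aut_equiv by metis
  qed
qed

text \<open>All entries have the same length \<open>m\<close>, so the concatenations can be cut
  again and the automorphism moves the sequence entry by entry.\<close>

lemma indiscernible_autD:
  assumes "small A" "indiscernible L S A d" "\<And>i. length (d i) = m"
    and "sorted_wrt (<) is" "sorted_wrt (<) js" "length is = length js"
  obtains h where "h \<in> Aut A" "map (\<lambda>i. map h (d i)) is = map d js"
proof -
  obtain h where h: "h \<in> Aut A" "map h (concat (map d is)) = concat (map d js)"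
    using assms(1,2,4-6) unfolding indiscernible_aut[OF assms(1)] by blast
  have "concat (map (\<lambda>i. map h (d i)) is) = concat (map d js)"
    using h(2) by (simp add: map_concat comp_def)
  moreover have "\<forall>(u, v)\<in>set (zip (map (\<lambda>i. map h (d i)) is) (map d js)). length u = length v"
    using assms(3) by (auto simp: set_zip)
  ultimately have "map (\<lambda>i. map h (d i)) is = map d js"
    using concat_injective assms(6) by (metis length_map)
  then show ?thesis using that h(1) by blast
qed

text \<open>Parameters are absorbed into the entries. The S1 property, stated over the empty set,
  then becomes available for formulas over \<open>A\<close>.\<close>

lemma indiscernible_param:
  assumes A: "small A" and d: "indiscernible L S A d" "\<And>i. length (d i) = m" and e: "set e \<subseteq> A"
  shows "indiscernible L S {} (\<lambda>i. d i @ e)"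
  unfolding indiscernible_def
proof (intro allI impI, elim conjE)
  fix "is" js :: "nat list" assume s: "sorted_wrt (<) is" "sorted_wrt (<) js" "length is = length js"
  obtain h where h: "h \<in> Aut A" "map (\<lambda>i. map h (d i)) is = map d js"
    using indiscernible_autD[OF A d s] .
  have "map (\<lambda>i. map h (d i @ e)) is = map (\<lambda>u. u @ e) (map (\<lambda>i. map h (d i)) is)"
    using Aut_fix[OF h(1) e] by simp
  also have "\<dots> = map (\<lambda>i. d i @ e) js" unfolding h(2) by simp
  finally have "map h (concat (map (\<lambda>i. d i @ e) is)) = concat (map (\<lambda>i. d i @ e) js)"
    by (simp add: map_concat comp_def)
  then show "equiv_over L S {} (concat (map (\<lambda>i. d i @ e) is)) (concat (map (\<lambda>i. d i @ e) js))"
    using Aut_equiv[OF Aut_empty[OF h(1)]] by metis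
qed

text \<open>An automorphism matching the earlier entries preserves the invariant type, so the last
  entries on both sides extend the match; homogeneity turns this into a new automorphism.\<close>

lemma morley_indiscernible:
  assumes A: "small A" and V: "ultra m V" "invariant_type A V"
    and d: "\<And>i. realizes m V (A \<union> (\<Union>j<i. set (d j))) (d i)"
  shows "indiscernible L S A d"
  unfolding indiscernible_aut[OF A]
proof (intro allI impI, elim conjE)
  fix "is" js :: "nat list" assume "sorted_wrt (<) is" "sorted_wrt (<) js" "length is = length js"
  then show "\<exists>h\<in>Aut A. map h (concat (map d is)) = concat (map d js)"
  proof (induction "is" arbitrary: js rule: rev_induct)
    case Nil
    have "id \<in> Aut A" by (auto simp: Aut_def automorphism_def)
    then show ?case using Nil by auto
  next
    case (snoc i "is")
    obtain j js' where js: "js = js' @ [j]" using snoc.prems(3) by (cases js rule: rev_cases) auto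
    have s: "sorted_wrt (<) is" "sorted_wrt (<) js'" "length is = length js'" "\<forall>k\<in>set is. k < i" "\<forall>k\<in>set js'. k < j"
      using snoc.prems js by (auto simp: sorted_wrt_append)
    obtain h where h: "h \<in> Aut A" "map h (concat (map d is)) = concat (map d js')" using snoc.IH[OF s(1-3)] by blast
    define u where "u = concat (map d is)"
    define v where "v = concat (map d js')"
    have di: "realizes m V (A \<union> set u) (d i)" by (rule realizes_mono[OF d]) (use s(4) in \<open>auto simp: u_def\<close>)
    have dj: "realizes m V (A \<union> set v) (d j)" by (rule realizes_mono[OF d]) (use s(5) in \<open>auto simp: v_def\<close>)
    have uv: "map h u = v" using h(2) by (simp add: u_def v_def)
    have "equiv_over L S A (u @ d i) (v @ d j)" by (rule invariant_type_equiv[OF V h(1) uv di dj])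
    then obtain g where "g \<in> Aut A" "map g (u @ d i) = v @ d j" using homogeneity[OF A] by metis
    then show ?case using js by (auto simp: u_def v_def)
  qed
qed

text \<open>Dependent choice in which a step sees all earlier values and may assume that they were
  chosen correctly. Several constructions need this to know that the base of the next step is still
  small.\<close>

lemma history_choice:
  assumes step: "\<And>xs. (\<And>i. i < length xs \<Longrightarrow> P (take i xs) (xs ! i)) \<Longrightarrow> \<exists>x. P xs x"
  obtains f where "\<And>n. P (map f [0..<n]) (f n)"
proof -
  define g where "g = rec_nat [] (\<lambda>_ xs. xs @ [SOME x. P xs x])"
  define f where "f n = (SOME x. P (g n) x)" for n
  have g: "g n = map f [0..<n]" for n
    by (induction n) (simp_all add: g_def f_def)
  have "P (map f [0..<n]) (f n)" for n
  proof (induction n rule: less_induct)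
    case (less n)
    have "\<exists>x. P (map f [0..<n]) x"
    proof (rule step)
      fix i assume "i < length (map f [0..<n])"
      then have i: "i < n" by simp
      then have "take i (map f [0..<n]) = map f [0..<i]" by (simp add: take_map)
      then show "P (take i (map f [0..<n])) (map f [0..<n] ! i)" using less.IH[OF i] i by simp
    qed
    then have "P (map f [0..<n]) (SOME x. P (map f [0..<n]) x)" by (rule someI_ex)
    then show ?case unfolding f_def[of n] g[of n] .
  qed
  then show ?thesis by (rule that)
qed

lemma morley_exists:
  assumes V: "ultra m V" and A: "small A"
  obtains d where "\<And>i :: nat. realizes m V (A \<union> (\<Union>j<i. set (d j))) (d i)"
proof -
  have step: "\<exists>x. realizes m V (A \<union> (\<Union>a\<in>set xs. set a)) x" for xs
  proof -
    have "small (\<Union>a\<in>set xs. set a)" by (rule small_finite) simp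
    with A have "small (A \<union> (\<Union>a\<in>set xs. set a))" by (rule small_Un)
    then show ?thesis using realizes_exists[OF V] by metis
  qed
  obtain d where "\<And>i :: nat. realizes m V (A \<union> (\<Union>a\<in>set (map d [0..<i]). set a)) (d i)"
    using history_choice[of "\<lambda>xs x. realizes m V (A \<union> (\<Union>a\<in>set xs. set a)) x"] step by metis
  then have "realizes m V (A \<union> (\<Union>j<i. set (d j))) (d i)" for i :: nat by (simp add: atLeast0LessThan)
  then show ?thesis by (rule that)
qed

section \<open>Dummy variables, permuted coordinates, and S1 along indiscernible sequences\<close>

lemma map_nth_upt: "j \<le> length a \<Longrightarrow> map ((!) a) [i..<j] = take (j - i) (drop i a)"
  by (rule nth_equalityI) auto

lemma DS_weaken:
  assumes "Y \<in> DS A (n + m)"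
  obtains Y' where "Y' \<in> DS A (n + (m + k))"
    "\<And>a u v. length a = n \<Longrightarrow> length u = m \<Longrightarrow> length v = k \<Longrightarrow> a @ u @ v \<in> Y' \<longleftrightarrow> a @ u \<in> Y"
proof
  show "{w \<in> tup (n + (m + k)). map ((!) w) [0..<n + m] \<in> Y} \<in> DS A (n + (m + k))"
    by (rule DS_coords) (use assms in auto)
qed (simp add: map_nth_upt del: map_map upt_Suc)

lemma DS_skip:
  assumes "Y \<in> DS A (n + m)"
  obtains Y' where "Y' \<in> DS A (n + (k + m))"
    "\<And>a u v. length a = n \<Longrightarrow> length u = k \<Longrightarrow> length v = m \<Longrightarrow> a @ u @ v \<in> Y' \<longleftrightarrow> a @ v \<in> Y"
proof
  show "{w \<in> tup (n + (k + m)). map ((!) w) ([0..<n] @ [n + k..<n + (k + m)]) \<in> Y} \<in> DS A (n + (k + m))"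
    by (rule DS_coords) (use assms in auto)
qed (simp add: map_nth_upt)

lemma DS_swap:
  assumes "Y \<in> DS A (n + m)"
  obtains Y' where "Y' \<in> DS A (m + n)"
    "\<And>u v. length u = m \<Longrightarrow> length v = n \<Longrightarrow> u @ v \<in> Y' \<longleftrightarrow> v @ u \<in> Y"
proof
  show "{w \<in> tup (m + n). map ((!) w) ([m..<m + n] @ [0..<m]) \<in> Y} \<in> DS A (m + n)"
    by (rule DS_coords) (use assms in auto)
qed (simp add: map_nth_upt)

text \<open>The parameters \<open>e\<close> of \<open>Y\<close> are appended to each
  \<open>c i\<close>, which leaves the sequence indiscernible over the empty set and the fibers
  unchanged.\<close>

lemma S1_over:
  assumes J: "S1 n J" and A: "small A" and c: "indiscernible L S A c" "\<And>i. length (c i) = m"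
    and Y: "Y \<in> DS A (n + m)" and in_J: "fib n Y (c 0) \<inter> fib n Y (c 1) \<in> J"
  shows "fib n Y (c 0) \<in> J"
proof -
  obtain e Y0 where e: "set e \<subseteq> A" "Y0 \<in> DS {} (n + m + length e)" "Y = {a \<in> tup (n + m). a @ e \<in> Y0}"
    using DS_fiber_param[OF Y] .
  have fib: "fib n Y0 (c i @ e) = fib n Y (c i)" for i using e(3) c(2) by (auto simp: fib_def)
  have "indiscernible L S {} (\<lambda>i. c i @ e)" by (rule indiscernible_param[OF A c e(1)])
  moreover have "Y0 \<in> DS {} (n + (m + length e))" using e(2) by (simp add: add.assoc)
  moreover have "\<forall>i. length (c i @ e) = m + length e" using c(2) by simp
  ultimately have "fib n Y0 (c 0 @ e) \<in> J" using J in_J fib unfolding S1_def by metis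
  then show ?thesis by (simp add: fib)
qed

lemma INT_fib:
  assumes "(0 :: nat) < K"
  shows "tup n \<inter> \<Inter>((\<lambda>i. fib n Y (c i)) ` {..<K}) = (\<Inter>i<K. fib n Y (c i))"
proof -
  have "(\<Inter>i<K. fib n Y (c i)) \<subseteq> fib n Y (c 0)" by (rule INT_lower) (use assms in simp)
  also have "\<dots> \<subseteq> tup n" by auto
  finally show ?thesis by blast
qed

lemma indiscernible_pairs:
  assumes "indiscernible L S A c"
  shows "indiscernible L S A (\<lambda>i. c (2 * i) @ c (2 * i + 1))"
proof -
  let ?d = "\<lambda>is. concat (map (\<lambda>i. [2 * i, 2 * i + 1]) is) :: nat list"
  have dbl: "concat (map (\<lambda>i. c (2 * i) @ c (2 * i + 1)) is) = concat (map c (?d is))" for "is"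
    by (induction "is") simp_all
  have srt: "sorted_wrt (<) is \<Longrightarrow> sorted_wrt (<) (?d is)" for "is"
    by (induction "is") auto
  have len: "length (?d is) = 2 * length is" for "is"
    by (induction "is") auto
  show ?thesis
    unfolding indiscernible_def
  proof (intro allI impI, elim conjE)
    fix "is" js :: "nat list" assume "sorted_wrt (<) is" "sorted_wrt (<) js" "length is = length js"
    then show "equiv_over L S A (concat (map (\<lambda>i. c (2 * i) @ c (2 * i + 1)) is))
        (concat (map (\<lambda>i. c (2 * i) @ c (2 * i + 1)) js))"
      using assms srt[of "is"] srt[of js] unfolding dbl indiscernible_def by (simp only: len)
  qed
qed

text \<open>Grouping the sequence into consecutive pairs gives an indiscernible sequence whose
  fibers are intersections of two old ones, and S1 says that these are still wide. Each repetition
  doubles the number of conjuncts.\<close>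

lemma S1_conj_pow:
  assumes J: "S1 n J" and A: "small A"
  shows "indiscernible L S A c \<Longrightarrow> (\<And>i. length (c i) = m) \<Longrightarrow> Y \<in> DS A (n + m) \<Longrightarrow> fib n Y (c 0) \<notin> J
    \<Longrightarrow> (\<Inter>i<2 ^ t. fib n Y (c i)) \<notin> J"
proof (induction t arbitrary: c m Y)
  case 0
  then show ?case by (simp add: lessThan_Suc)
next
  case (Suc t)
  define c2 where "c2 i = c (2 * i) @ c (2 * i + 1)" for i
  obtain Y1 where Y1: "Y1 \<in> DS A (n + (m + m))"
     "\<And>a u v. length a = n \<Longrightarrow> length u = m \<Longrightarrow> length v = m \<Longrightarrow> a @ u @ v \<in> Y1 \<longleftrightarrow> a @ u \<in> Y"
    using DS_weaken[OF Suc.prems(3), of m] by metis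
  obtain Y2 where Y2: "Y2 \<in> DS A (n + (m + m))"
     "\<And>a u v. length a = n \<Longrightarrow> length u = m \<Longrightarrow> length v = m \<Longrightarrow> a @ u @ v \<in> Y2 \<longleftrightarrow> a @ v \<in> Y"
    using DS_skip[OF Suc.prems(3), of m] by metis
  have fib2: "fib n (Y1 \<inter> Y2) (c2 i) = fib n Y (c (2 * i)) \<inter> fib n Y (c (2 * i + 1))" for i
    using Y1(2) Y2(2) Suc.prems(2) by (auto simp: fib_def c2_def)
  have ind: "indiscernible L S A c2" unfolding c2_def by (rule indiscernible_pairs[OF Suc.prems(1)])
  have "fib n (Y1 \<inter> Y2) (c2 0) \<notin> J"
    unfolding fib2 using S1_over[OF J A Suc.prems(1-3)] Suc.prems(4) by auto
  then have *: "(\<Inter>i<2 ^ t. fib n (Y1 \<inter> Y2) (c2 i)) \<notin> J"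
    using Suc.IH[OF ind, of "m + m" "Y1 \<inter> Y2"] Suc.prems(2) Y1(1) Y2(1) by (auto simp: c2_def)
  have sub: "(\<Inter>i<2 ^ t. fib n (Y1 \<inter> Y2) (c2 i)) \<subseteq> (\<Inter>i<2 ^ Suc t. fib n Y (c i))"
  proof (intro INT_greatest)
    fix i :: nat assume "i \<in> {..<2 ^ Suc t}"
    then have "i div 2 \<in> {..<2 ^ t}" by auto
    then have "(\<Inter>i<2 ^ t. fib n (Y1 \<inter> Y2) (c2 i)) \<subseteq> fib n (Y1 \<inter> Y2) (c2 (i div 2))" by blast
    also have "\<dots> \<subseteq> fib n Y (c i)" unfolding fib2 by (cases "even i") auto
    finally show "(\<Inter>i<2 ^ t. fib n (Y1 \<inter> Y2) (c2 i)) \<subseteq> fib n Y (c i)" .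
  qed
  have "fib n (Y1 \<inter> Y2) (c2 i) \<in> DS UNIV n" for i
    using DS_UNIV[OF fib_DS[OF DS_Int[OF Y1(1) Y2(1)], of "c2 i"]] Suc.prems(2) by (simp add: c2_def)
  then have "tup n \<inter> \<Inter>((\<lambda>i. fib n (Y1 \<inter> Y2) (c2 i)) ` {..<2 ^ t}) \<in> DS UNIV n" by (intro DS_INT) auto
  moreover have "tup n \<inter> \<Inter>((\<lambda>i. fib n (Y1 \<inter> Y2) (c2 i)) ` {..<2 ^ t}) = (\<Inter>i<2 ^ t. fib n (Y1 \<inter> Y2) (c2 i))"
    by (rule INT_fib) simp
  ultimately show ?case using * sub def_ideal_down[OF S1_ideal[OF J]] by metis
qed

text \<open>Wide sets do not divide: \<open>K < 2 ^ K\<close>, and fewer conjuncts give a larger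
  set. The conclusion is about an arbitrary \<open>X\<close> above the intersection, since the
  applications reach a finite intersection or a sign pattern rather than the intersection of fibers
  itself.\<close>

lemma S1_conj:
  assumes J: "S1 n J" and A: "small A"
    and c: "indiscernible L S A c" "\<And>i. length (c i) = m" and Y: "Y \<in> DS A (n + m)"
    and X: "X \<in> DS UNIV n" "(\<Inter>i<K. fib n Y (c i)) \<inter> tup n \<subseteq> X" and notin: "fib n Y (c 0) \<notin> J"
  shows "X \<notin> J"
proof
  assume "X \<in> J"
  have "(\<Inter>i<2 ^ K. fib n Y (c i)) \<subseteq> (\<Inter>i<K. fib n Y (c i)) \<inter> tup n"
  proof
    fix a assume a: "a \<in> (\<Inter>i<2 ^ K. fib n Y (c i))"
    have "a \<in> fib n Y (c i)" if "i < K" for i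
    proof -
      have "i < 2 ^ K" using that less_exp[of K] by (rule less_trans)
      then show ?thesis using a by blast
    qed
    moreover have "a \<in> fib n Y (c 0)" using a by (rule INT_D) simp
    ultimately show "a \<in> (\<Inter>i<K. fib n Y (c i)) \<inter> tup n" by (intro IntI INT_I) simp_all
  qed
  then have "(\<Inter>i<2 ^ K. fib n Y (c i)) \<subseteq> X" using X(2) by (rule subset_trans)
  moreover have "tup n \<inter> \<Inter>((\<lambda>i. fib n Y (c i)) ` {..<2 ^ K}) \<in> DS UNIV n"
  proof (rule DS_INT)
    show "(\<lambda>i. fib n Y (c i)) ` {..<2 ^ K} \<subseteq> DS UNIV n"
      using DS_UNIV[OF fib_DS[OF Y c(2)]] by (rule image_subsetI)
  qed simp
  moreover have "tup n \<inter> \<Inter>((\<lambda>i. fib n Y (c i)) ` {..<2 ^ K}) = (\<Inter>i<2 ^ K. fib n Y (c i))"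
    by (rule INT_fib) simp
  ultimately have "(\<Inter>i<2 ^ K. fib n Y (c i)) \<in> J"
    using def_ideal_down[OF S1_ideal[OF J] \<open>X \<in> J\<close>] by metis
  then show False using S1_conj_pow[OF J A c Y notin] by blast
qed

text \<open>
  The indiscernible sequence consists of realizations of an ultrafilter average of \<open>c\<close>; this reverses
  the order of pairs.
\<close>

lemma indiscernible_extraction:
  fixes c :: "nat \<Rightarrow> 'm list"
  assumes A: "small A" and c: "\<And>i. length (c i) = m"
  obtains d where "indiscernible L S A d" "\<And>i. length (d i) = m"
    "\<And>X. X \<in> DS A m \<Longrightarrow> (\<And>i. c i \<in> X) \<Longrightarrow> d 0 \<in> X"
    "\<And>X. X \<in> DS A (m + m) \<Longrightarrow> (\<And>i j. i < j \<Longrightarrow> c j @ c i \<in> X) \<Longrightarrow> d 0 @ d 1 \<in> X"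
proof -
  \<comment> \<open>A type avoiding these sets contains every definable set that the sequence
    eventually enters.\<close>
  define J where "J = {X \<in> DS UNIV m. finite {i :: nat. c i \<in> X}}"
  have J: "def_ideal m J"
    unfolding def_ideal_def J_def
  proof (intro conjI ballI impI)
    fix X Y assume "X \<in> {X \<in> DS UNIV m. finite {i. c i \<in> X}}" "Y \<in> DS UNIV m" "Y \<subseteq> X"
    then show "Y \<in> {X \<in> DS UNIV m. finite {i. c i \<in> X}}" using finite_subset[of "{i. c i \<in> Y}" "{i. c i \<in> X}"] by auto
  qed (auto simp: Collect_disj_eq)
  have "tup m \<notin> J" using c by (simp add: J_def)
  then obtain V where V: "ultra m V" "V \<inter> J = {}" using ultra_exists[OF J, of "{}"] by auto
  have cof: "X \<in> V" if "X \<in> DS B m" "\<And>j. i < j \<Longrightarrow> c j \<in> X" for X B i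
  proof (rule ccontr)
    assume "X \<notin> V"
    then have "tup m - X \<in> V" using ultra_compl[OF V(1) that(1)] by simp
    moreover have "{j. c j \<in> tup m - X} \<subseteq> {..i}"
    proof
      fix j assume "j \<in> {j. c j \<in> tup m - X}"
      then show "j \<in> {..i}" using that(2)[of j] by (cases "i < j") auto
    qed
    then have "finite {j. c j \<in> tup m - X}" by (rule finite_subset) simp
    ultimately show False using V(2) ultra_DS[OF V(1)] unfolding J_def by blast
  qed
  define C where "C = A \<union> (\<Union>i. set (c i))"
  have C: "small C" unfolding C_def using A small_UN_set by (rule small_Un)
  \<comment> \<open>Each member of \<open>V\<close> contains some \<open>c i\<close>, so
    \<open>V\<close> is finitely satisfiable in the set \<open>C\<close>, which includes the whole
    sequence.\<close>
  have inv: "invariant_type C V"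
  proof (rule invariant_typeI[OF V(1)])
    fix X assume X: "X \<in> V"
    then have "infinite {i. c i \<in> X}" using V(2) ultra_DS[OF V(1)] unfolding J_def by blast
    then obtain i where "c i \<in> X" by (metis (mono_tags) Collect_empty_eq finite.emptyI)
    then show "\<exists>c\<in>X. set c \<subseteq> C" unfolding C_def by blast
  qed
  obtain d where d: "\<And>i :: nat. realizes m V (C \<union> (\<Union>j<i. set (d j))) (d i)"
    using morley_exists[OF V(1) C] by metis
  have "indiscernible L S C d" by (rule morley_indiscernible[OF C V(1) inv d])
  then have "indiscernible L S A d" unfolding indiscernible_def using equiv_over_mono[of C _ _ A] by (simp add: C_def)
  moreover have dl: "length (d i) = m" for i using d by (simp add: realizes_def)
  moreover have "d 0 \<in> X" if X: "X \<in> DS A m" "\<And>i. c i \<in> X" for X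
  proof -
    have "X \<in> V" by (rule cof[OF X(1)]) (rule X(2))
    then show ?thesis using d[of 0] X(1) DS_mono[OF X(1), of C] by (auto simp: realizes_def C_def)
  qed
  moreover have "d 0 @ d 1 \<in> X" if X: "X \<in> DS A (m + m)" "\<And>i j. i < j \<Longrightarrow> c j @ c i \<in> X" for X
  proof -
    have XC: "X \<in> DS C (m + m)" using X(1) by (rule DS_mono) (simp add: C_def)
    \<comment> \<open>For fixed \<open>i\<close>, almost all \<open>j\<close> lie above
      \<open>i\<close>, so \<open>d 0\<close> takes the place of the later entry. Letting
      \<open>i\<close> vary afterwards puts \<open>d 1\<close> in the place of the earlier one,
      whence the reversal.\<close>
    have d0: "d 0 @ c i \<in> X" for i
    proof -
      have f: "fib m X (c i) \<in> DS (C \<union> set (c i)) m" by (rule fib_DS[OF XC c])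
      then have "fib m X (c i) \<in> V" by (rule cof[of _ _ i]) (use X(2) c in auto)
      moreover have "fib m X (c i) \<in> DS C m" using f by (rule DS_mono) (auto simp: C_def)
      moreover have "realizes m V C (d 0)" using d[of 0] by simp
      ultimately have "d 0 \<in> fib m X (c i)" unfolding realizes_def by blast
      then show ?thesis by simp
    qed
    have f: "{v \<in> tup m. d 0 @ v \<in> X} \<in> DS (C \<union> set (d 0)) m" by (rule DS_fiber_left) (use XC dl in simp)
    then have "{v \<in> tup m. d 0 @ v \<in> X} \<in> V" by (rule cof[of _ _ 0]) (use d0 c in simp)
    moreover have "realizes m V (C \<union> set (d 0)) (d 1)" using d[of 1] by (simp add: lessThan_Suc)
    ultimately have "d 1 \<in> {v \<in> tup m. d 0 @ v \<in> X}" using f realizesD by blast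
    then show ?thesis by simp
  qed
  ultimately show ?thesis by (rule that)
qed

section \<open>Small models\<close>

text \<open>The one-variable test suffices: a point of \<open>X\<close> is found coordinate by
  coordinate, the first ones in the projection of \<open>X\<close> and the last one in a fiber over
  them.\<close>

lemma mdlI:
  assumes "\<And>e Y m. set e \<subseteq> M \<Longrightarrow> Y \<in> DS {} (Suc (length e)) \<Longrightarrow> m # e \<in> Y \<Longrightarrow> \<exists>m\<in>M. m # e \<in> Y"
  shows "mdl M"
proof -
  have "X \<in> DS M n \<Longrightarrow> X \<noteq> {} \<Longrightarrow> \<exists>a\<in>X. set a \<subseteq> M" for n X
  proof (induction n arbitrary: X)
    case 0
    then obtain c where "c \<in> X" by blast
    then show ?case using DS_tup[OF 0(1)] by (intro bexI[of _ c]) auto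
  next
    case (Suc n)
    obtain c where c: "c \<in> X" using Suc.prems(2) by blast
    then have "length c = Suc n" using DS_tup[OF Suc.prems(1)] by auto
    then have c': "butlast c @ [last c] = c" "length (butlast c) = n"
      by (metis append_butlast_last_id list.size(3) nat.distinct(1)) (simp add: \<open>length c = Suc n\<close>)
    have "butlast c @ [last c] \<in> X" using c c'(1) by simp
    then have "butlast c \<in> {a \<in> tup n. \<exists>m. a @ [m] \<in> X}" using c'(2) unfolding tup_def by blast
    then obtain a where "a \<in> {a \<in> tup n. \<exists>m. a @ [m] \<in> X}" "set a \<subseteq> M"
      using Suc.IH[OF DS_proj[OF Suc.prems(1)]] by blast
    then have a: "length a = n" "\<exists>m. a @ [m] \<in> X" "set a \<subseteq> M" by simp_all
    then obtain m where m: "a @ [m] \<in> X" by blast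
    have "{v \<in> tup 1. a @ v \<in> X} \<in> DS (M \<union> set a) 1" by (rule DS_fiber_left) (use Suc.prems(1) a in simp)
    then have "{v \<in> tup 1. a @ v \<in> X} \<in> DS M 1" by (rule DS_mono) (use a(3) in simp)
    then obtain e Y where e: "set e \<subseteq> M" "Y \<in> DS {} (1 + length e)"
      "{v \<in> tup 1. a @ v \<in> X} = {v \<in> tup 1. v @ e \<in> Y}"
      by (rule DS_fiber_param)
    have *: "a @ v \<in> X \<longleftrightarrow> v @ e \<in> Y" if "length v = 1" for v using e(3) that by auto
    then have "m # e \<in> Y" using m *[of "[m]"] by simp
    then obtain m' where "m' \<in> M" "m' # e \<in> Y" using assms[OF e(1), of Y m] e(2) by auto
    then have "a @ [m'] \<in> X" using *[of "[m']"] by simp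
    then show ?case using \<open>m' \<in> M\<close> a(3) by (intro bexI[of _ "a @ [m']"]) auto
  qed
  then show ?thesis unfolding mdl_def by blast
qed

lemma card_of_lists_le:
  assumes B: "infinite B" and A: "|A| \<le>o |B|"
  shows "|lists A| \<le>o |B|"
proof -
  have n: "|{xs. set xs \<subseteq> A \<and> length xs = n}| \<le>o |B|" for n
  proof (induction n)
    case 0
    have "{xs. set xs \<subseteq> A \<and> length xs = 0} = {[]}" by auto
    then have "finite {xs. set xs \<subseteq> A \<and> length xs = 0}" by simp
    then show ?case using finite_card_ordLess[OF _ B] ordLess_imp_ordLeq by blast
  next
    case (Suc n)
    let ?P = "SIGMA x:A. {xs. set xs \<subseteq> A \<and> length xs = n}"
    have "|{xs. set xs \<subseteq> A \<and> length xs = Suc n}| \<le>o |(\<lambda>(x, xs). x # xs) ` ?P|"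
    proof (rule card_of_mono1, rule subsetI)
      fix ys assume "ys \<in> {xs. set xs \<subseteq> A \<and> length xs = Suc n}"
      then obtain x xs where "ys = x # xs" "x \<in> A" "set xs \<subseteq> A" "length xs = n"
        by (cases ys) auto
      then show "ys \<in> (\<lambda>(x, xs). x # xs) ` ?P" by (intro image_eqI[of _ _ "(x, xs)"]) auto
    qed
    also have "|(\<lambda>(x, xs). x # xs) ` ?P| \<le>o |?P|" by (rule card_of_image)
    also have "|?P| \<le>o |B|" by (rule card_of_Sigma_ordLeq_infinite[OF B A]) (use Suc in simp)
    finally show ?case .
  qed
  have "|\<Union>n\<in>UNIV. {xs. set xs \<subseteq> A \<and> length xs = n}| \<le>o |B|"
  proof (rule card_of_UNION_ordLeq_infinite[OF B])
    show "|UNIV :: nat set| \<le>o |B|" using B infinite_iff_card_of_nat by blast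
  qed (use n in simp)
  moreover have "(\<Union>n\<in>UNIV. {xs. set xs \<subseteq> A \<and> length xs = n}) = lists A" by (auto simp: lists_eq_set)
  ultimately show ?thesis by simp
qed

text \<open>Downward Loewenheim-Skolem: \<open>A\<close> is closed under a choice of witnesses by
  countably many applications of \<open>H\<close>, and \<open>B\<close> bounds the size of all
  stages at once.\<close>

lemma small_model_exists:
  assumes "small A"
  obtains M where "A \<subseteq> M" "small M" "mdl M"
proof -
  let ?F = "fmla L {} UNIV :: ('f, 'r, 'm) fm set"
  obtain B :: "('m + ('f, 'r, 'm) fm) set" where B: "infinite B" "|A| \<le>o |B|" "|?F| \<le>o |B|" "small B"
    using small_bound[OF assms] .
  \<comment> \<open>A Skolem function: the witness is assigned to variable \<open>0\<close>, the
    parameters in \<open>e\<close> to the variables after it.\<close>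
  define w where "w = (\<lambda>(\<phi>, e). SOME m. holds S ((!) (m # e)) \<phi>)"
  define H where "H Z = Z \<union> w ` (?F \<times> lists Z)" for Z
  define N where "N i = (H ^^ i) A" for i
  have HB: "|H Z| \<le>o |B|" if Z: "|Z| \<le>o |B|" for Z
  proof -
    have "|SIGMA \<phi>:?F. lists Z| \<le>o |B|"
      by (rule card_of_Sigma_ordLeq_infinite[OF B(1,3)]) (use card_of_lists_le[OF B(1) Z] in simp)
    then have "|w ` (?F \<times> lists Z)| \<le>o |B|" using card_of_image ordLeq_transitive by blast
    then show ?thesis unfolding H_def using Z
      by (intro card_of_Un_ordLeq_infinite_Field[of "|B|"] card_of_Card_order) (simp add: Field_card_of B(1))
  qed
  have NB: "|N i| \<le>o |B|" for i by (induction i) (use B(2) HB in \<open>simp_all add: N_def\<close>)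
  have mono: "N i \<subseteq> N (Suc i)" for i by (auto simp: N_def H_def)
  have mono': "i \<le> j \<Longrightarrow> N i \<subseteq> N j" for i j using lift_Suc_mono_le[of N] mono by blast
  define M where "M = (\<Union>i. N i)"
  have "mdl M"
  proof (rule mdlI)
    fix e Y m assume e: "set e \<subseteq> M" and Y: "Y \<in> DS {} (Suc (length e))" "m # e \<in> Y"
    have "\<exists>i. set e \<subseteq> N i" using e
    proof (induction e)
      case (Cons x e)
      then obtain i j where "set e \<subseteq> N i" "x \<in> N j" by (auto simp: M_def)
      then show ?case using mono'[of i "max i j"] mono'[of j "max i j"] by (intro exI[of _ "max i j"]) auto
    qed simp
    then obtain i where i: "set e \<subseteq> N i" by blast
    obtain \<phi> where \<phi>: "\<phi> \<in> fmla L {} {..<Suc (length e)}" "Y = {a \<in> tup (Suc (length e)). holds S ((!) a) \<phi>}"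
      using Y(1) unfolding DS_def by blast
    have "\<exists>m. holds S ((!) (m # e)) \<phi>" using Y(2) \<phi>(2) by blast
    then have "holds S ((!) (w (\<phi>, e) # e)) \<phi>" unfolding w_def by simp (rule someI_ex)
    then have "w (\<phi>, e) # e \<in> Y" using \<phi>(2) by simp
    moreover have "w (\<phi>, e) \<in> N (Suc i)"
      using \<phi>(1) i by (auto simp: N_def H_def fmla_def lists_eq_set)
    ultimately show "\<exists>m\<in>M. m # e \<in> Y" unfolding M_def by blast
  qed
  moreover have "small M" unfolding M_def by (rule small_UN[OF B(4) NB])
  moreover have "N 0 = A" by (simp add: N_def)
  then have "A \<subseteq> M" unfolding M_def by blast
  ultimately show ?thesis using that by blast
qed

section \<open>Amalgamation of wide types\<close>

lemma morley_extend:
  assumes V: "ultra m V" and A: "small A"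
    and as: "\<And>i. i < length as \<Longrightarrow> realizes m V (A \<union> (\<Union>j<i. set (as ! j))) (as ! i)"
  obtains d where "\<And>i. i < length as \<Longrightarrow> d i = as ! i"
    "\<And>i :: nat. realizes m V (A \<union> (\<Union>j<i. set (d j))) (d i)"
proof -
  define P where "P xs x \<longleftrightarrow> (if length xs < length as then x = as ! length xs
     else realizes m V (A \<union> (\<Union>a\<in>set xs. set a)) x)" for xs x
  have step: "\<exists>x. P xs x" for xs
  proof -
    have "small (\<Union>a\<in>set xs. set a)" by (rule small_finite) simp
    with A have "small (A \<union> (\<Union>a\<in>set xs. set a))" by (rule small_Un)
    then obtain x where "realizes m V (A \<union> (\<Union>a\<in>set xs. set a)) x" by (rule realizes_exists[OF V])
    then show ?thesis unfolding P_def by auto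
  qed
  obtain d where d: "\<And>i. P (map d [0..<i]) (d i)" using history_choice[of P] step by metis
  have 1: "d i = as ! i" if "i < length as" for i using d[of i] that by (simp add: P_def)
  have 2: "realizes m V (A \<union> (\<Union>j<i. set (d j))) (d i)" for i :: nat
  proof (cases "i < length as")
    case True
    then have "(\<Union>j<i. set (d j)) = (\<Union>j<i. set (as ! j))" using 1 by auto
    then show ?thesis using as[OF True] 1[OF True] by simp
  next
    case False
    then show ?thesis using d[of i] by (simp add: P_def atLeast0LessThan)
  qed
  show ?thesis by (rule that[OF 1 2])
qed

text \<open>The source of indiscernible sequences through two prescribed tuples, as S1
  requires.\<close>

lemma morley_pair:
  assumes V: "ultra m V" "invariant_type A V" and A: "small A"
    and u: "realizes m V A u" and v: "realizes m V (A \<union> set u) v"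
  obtains d where "indiscernible L S A d" "\<And>i. realizes m V A (d i)" "d 0 = u" "d 1 = v"
proof -
  have as: "realizes m V (A \<union> (\<Union>j<i. set ([u, v] ! j))) ([u, v] ! i)" if i: "i < length [u, v]" for i
  proof -
    consider "i = 0" | "i = 1" using i by fastforce
    then show ?thesis using u v by cases (simp_all add: lessThan_Suc)
  qed
  obtain d where d: "\<And>i. i < length [u, v] \<Longrightarrow> d i = [u, v] ! i"
    "\<And>i :: nat. realizes m V (A \<union> (\<Union>j<i. set (d j))) (d i)"
    using morley_extend[OF V(1) A, of "[u, v]"] as by metis
  show ?thesis
  proof (rule that)
    show "indiscernible L S A d" by (rule morley_indiscernible[OF A V d(2)])
    show "realizes m V A (d i)" for i by (rule realizes_mono[OF d(2)]) simp
    show "d 0 = u" "d 1 = v" using d(1)[of 0] d(1)[of 1] by simp_all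
  qed
qed

lemma fib_aut_iff:
  assumes J: "S1 n J" and h: "h \<in> Aut A" and Y: "Y \<in> DS A (n + m)" and e: "length e = m"
  shows "fib n Y (map h e) \<in> J \<longleftrightarrow> fib n Y e \<in> J"
  using S1_Aut_iff[OF J h, of "fib n Y e"] Aut_fib[OF h Y e] by simp

text \<open>
  The copies \<open>z\<^sub>i\<close> of \<open>c\<close> exist because the type of \<open>c\<close> over \<open>M b\<close>, being wide for an S1 ideal, does not divide
  over \<open>M\<close>.
\<close>

lemma half_independent_sequence:
  assumes K: "S1 m K" and M: "small M" and V: "ultra m V" "invariant_type M V" "realizes m V M b"
    and c: "length c = m" "wd m K (M \<union> set b) c"
  obtains a z where "\<And>i :: nat. realizes m V (M \<union> (\<Union>j<i. set (a j) \<union> set (z j))) (a i)"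
    "\<And>i j. j \<le> i \<Longrightarrow> equiv_over L S M (c @ b) (z i @ a j)"
proof -
  \<comment> \<open>A term is a pair \<open>(a\<^sub>i, z\<^sub>i)\<close>. The first component
    realizes the coheir over all earlier pairs; the second copies \<open>c\<close> over every first
    component so far, the new one included. No relation among the \<open>z\<^sub>i\<close> is
    imposed.\<close>
  define P where "P xs x \<longleftrightarrow> realizes m V (M \<union> (\<Union>u\<in>set xs. set (fst u) \<union> set (snd u))) (fst x) \<and>
     (\<forall>u\<in>set (map fst xs @ [fst x]). equiv_over L S M (c @ b) (snd x @ u))" for xs x
  have b: "length b = m" using V(3) by (rule realizes_length)
  have step: "\<exists>x. P xs x" if xs: "\<And>i. i < length xs \<Longrightarrow> P (take i xs) (xs ! i)" for xs
  proof -
    define Z where "Z = M \<union> (\<Union>u\<in>set xs. set (fst u) \<union> set (snd u))"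
    have "small (\<Union>u\<in>set xs. set (fst u) \<union> set (snd u))" by (rule small_finite) simp
    with M have "small Z" unfolding Z_def by (rule small_Un)
    then obtain x where x: "realizes m V Z x" by (rule realizes_exists[OF V(1)])
    define as where "as = map fst xs @ [x]"
    have as: "realizes m V (M \<union> (\<Union>j<i. set (as ! j))) (as ! i)" if i: "i < length as" for i
    proof (cases "i < length xs")
      case True
      have "realizes m V (M \<union> (\<Union>u\<in>set (take i xs). set (fst u) \<union> set (snd u))) (fst (xs ! i))"
        using xs[OF True] by (simp add: P_def)
      moreover have "M \<union> (\<Union>j<i. set (as ! j)) \<subseteq> M \<union> (\<Union>u\<in>set (take i xs). set (fst u) \<union> set (snd u))"
      proof -
        have "set (as ! j) \<subseteq> (\<Union>u\<in>set (take i xs). set (fst u) \<union> set (snd u))" if j: "j < i" for j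
        proof -
          have "xs ! j \<in> set (take i xs)" using j True by (metis in_set_conv_nth length_take min.absorb4 nth_take)
          moreover have "as ! j = fst (xs ! j)" using j True by (simp add: as_def nth_append)
          ultimately show ?thesis by auto
        qed
        then show ?thesis by blast
      qed
      ultimately have "realizes m V (M \<union> (\<Union>j<i. set (as ! j))) (fst (xs ! i))" by (rule realizes_mono)
      then show ?thesis using True by (simp add: as_def nth_append)
    next
      case False
      then have i: "i = length xs" using i by (simp add: as_def)
      have "realizes m V (M \<union> (\<Union>j<i. set (as ! j))) x"
        by (rule realizes_mono[OF x]) (auto simp: Z_def i as_def nth_append)
      moreover have "as ! i = x" using i by (simp add: as_def nth_append)
      ultimately show ?thesis by simp
    qed
    \<comment> \<open>The finitely many first components are prolonged to a full Morley sequence,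
      because S1 speaks about infinite sequences only.\<close>
    obtain D where D: "\<And>i. i < length as \<Longrightarrow> D i = as ! i"
      "\<And>i :: nat. realizes m V (M \<union> (\<Union>j<i. set (D j))) (D i)"
      using morley_extend[OF V(1) M, of as] as by metis
    have ind: "indiscernible L S M D" by (rule morley_indiscernible[OF M V(1,2) D(2)])
    have Dl: "length (D i) = m" for i using D(2)[of i] by (rule realizes_length)
    have "realizes m V M (D 0)" using D(2)[of 0] by simp
    then obtain h where h: "h \<in> Aut M" "map h b = D 0"
      using homogeneity[OF M realizes_equiv[OF V(1,3)]] by metis
    \<comment> \<open>\<open>\<T>\<close> is the type of \<open>(c, b)\<close> over
      \<open>M\<close>. A point in all of its fibers over the \<open>D j\<close> is a copy of
      \<open>c\<close> over each of them at once.\<close>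
    define \<T> where "\<T> = {T \<in> DS M (m + m). c @ b \<in> T}"
    define G where "G = (\<lambda>(T, j). fib m T (D j)) ` (\<T> \<times> {..<length as})"
    have "G \<subseteq> DS UNIV m"
    proof
      fix X assume "X \<in> G"
      then obtain T j where "T \<in> \<T>" "X = fib m T (D j)" by (auto simp: G_def)
      then show "X \<in> DS UNIV m" using DS_UNIV[OF fib_DS[of T M m m "D j"]] Dl by (simp add: \<T>_def)
    qed
    moreover have "tup m \<inter> \<Inter>G0 \<notin> K" if G0: "finite G0" "G0 \<subseteq> G" for G0
    proof -
      obtain Q where Q: "Q \<subseteq> \<T> \<times> {..<length as}" "finite Q" "G0 = (\<lambda>(T, j). fib m T (D j)) ` Q"
        using finite_subset_image[OF G0(1) G0(2)[unfolded G_def]] by blast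
      \<comment> \<open>A finite part of \<open>\<T>\<close> is bounded by one set
        \<open>T0\<close>. Since \<open>c\<close> lies in its fiber over \<open>b\<close> and is
        wide over \<open>M b\<close>, that fiber is wide, and non-dividing applies to it.\<close>
      define T0 where "T0 = tup (m + m) \<inter> \<Inter>(fst ` Q)"
      have T0: "T0 \<in> DS M (m + m)" unfolding T0_def by (rule DS_INT) (use Q in \<open>auto simp: \<T>_def\<close>)
      have "c @ b \<in> T0" using Q(1) b c(1) by (auto simp: T0_def \<T>_def)
      then have "c \<in> fib m T0 b" using c(1) by simp
      moreover have "fib m T0 b \<in> DS (M \<union> set b) m" by (rule fib_DS[OF T0 b])
      ultimately have "fib m T0 b \<notin> K" using c(2) unfolding wd_def by blast
      then have notK: "fib m T0 (D 0) \<notin> K" using fib_aut_iff[OF K h(1) T0 b] h(2) by simp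
      show ?thesis
      proof (rule S1_conj[OF K M ind Dl T0 _ _ notK])
        show "tup m \<inter> \<Inter>G0 \<in> DS UNIV m" by (rule DS_INT) (use G0 \<open>G \<subseteq> DS UNIV m\<close> in auto)
        show "(\<Inter>i<length as. fib m T0 (D i)) \<inter> tup m \<subseteq> tup m \<inter> \<Inter>G0"
        proof
          fix w assume w: "w \<in> (\<Inter>i<length as. fib m T0 (D i)) \<inter> tup m"
          have "w \<in> X" if X: "X \<in> G0" for X
          proof -
            obtain T j where "(T, j) \<in> Q" "X = fib m T (D j)" using X Q(3) by auto
            moreover have "w \<in> fib m T0 (D j)" using w Q(1) \<open>(T, j) \<in> Q\<close> by blast
            ultimately show ?thesis by (auto simp: T0_def)
          qed
          then show "w \<in> tup m \<inter> \<Inter>G0" using w by blast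
        qed
      qed
    qed
    ultimately obtain U where U: "ultra m U" "G \<subseteq> U" using ultra_exists[OF S1_ideal[OF K]] by metis
    have "small (M \<union> (\<Union>j<length as. set (D j)))" by (intro small_Un M small_finite) auto
    then obtain z where z: "realizes m U (M \<union> (\<Union>j<length as. set (D j))) z" by (rule realizes_exists[OF U(1)])
    have zD: "equiv_over L S M (c @ b) (z @ D j)" if j: "j < length as" for j
    proof (rule equiv_overI[of _ "m + m"])
      fix T assume T: "T \<in> DS M (m + m)" "c @ b \<in> T"
      have "fib m T (D j) \<in> U" using U(2) T j by (auto simp: G_def \<T>_def)
      moreover have "fib m T (D j) \<in> DS (M \<union> (\<Union>j<length as. set (D j))) m"
        by (rule DS_mono[OF fib_DS[OF T(1) Dl]]) (use j in auto)
      ultimately have "z \<in> fib m T (D j)" using realizesD[OF z] by blast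
      then show "z @ D j \<in> T" by simp
    qed (use b c Dl realizes_length[OF z] in simp_all)
    have "P xs (x, z)"
      unfolding P_def
    proof (intro conjI ballI)
      show "realizes m V (M \<union> (\<Union>u\<in>set xs. set (fst u) \<union> set (snd u))) (fst (x, z))" using x by (simp add: Z_def)
    next
      fix u assume "u \<in> set (map fst xs @ [fst (x, z)])"
      then have "u \<in> set as" by (simp add: as_def)
      then obtain j where "j < length as" "u = as ! j" by (metis in_set_conv_nth)
      then show "equiv_over L S M (c @ b) (snd (x, z) @ u)" using zD D(1) by simp
    qed
    then show ?thesis by blast
  qed
  obtain f where f: "\<And>i. P (map f [0..<i]) (f i)" using history_choice[of P] step by metis
  show ?thesis
  proof (rule that[of "\<lambda>i. fst (f i)" "\<lambda>i. snd (f i)"])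
    show "realizes m V (M \<union> (\<Union>j<i. set (fst (f j)) \<union> set (snd (f j)))) (fst (f i))" for i :: nat
      using f[of i] by (simp add: P_def atLeast0LessThan)
    show "equiv_over L S M (c @ b) (snd (f i) @ fst (f j))" if "j \<le> i" for i j
    proof -
      have "fst (f j) \<in> set (map fst (map f [0..<i]) @ [fst (f i)])" using that by (cases "j = i") auto
      then show ?thesis using f[of i] unfolding P_def by blast
    qed
  qed
qed

text \<open>S1 needs indiscernible sequences, whereas \<open>(b, c)\<close> is only wide in one
  direction. The coheir \<open>V\<close> mediates: if the two fibers met in \<open>J\<close>, S1
  along the pairs \<open>(z\<^sub>i, a\<^sub>i\<^sub>+\<^sub>1)\<close> would put the intersection
  belonging to one such pair into \<open>J\<close>, and S1 along a Morley sequence of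
  \<open>V\<close> starting with that pair would put a conjugate of \<open>fib n Y b\<close> into
  \<open>J\<close>.\<close>

lemma wide_amalgamation:
  assumes J: "S1 n J" and K: "S1 m K" and M: "small M" "mdl M" and Y: "Y \<in> DS M (n + m)"
    and b: "length b = m" and bc: "equiv_over L S M b c" and c: "wd m K (M \<union> set b) c"
    and notJ: "fib n Y b \<notin> J"
  shows "fib n Y b \<inter> fib n Y c \<notin> J"
proof
  assume in_J: "fib n Y b \<inter> fib n Y c \<in> J"
  have cl: "length c = m" using b equiv_over_length[OF bc] by simp
  obtain V where V: "ultra m V" "realizes m V M b" "invariant_type M V" using coheir[OF M(2) b] .
  have V_equiv: "realizes m V M u" if "equiv_over L S M b u" for u
    unfolding realizes_def using equiv_overD[OF that] realizesD[OF V(2)] equiv_over_length[OF that] b by auto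
  obtain a z where a: "\<And>i :: nat. realizes m V (M \<union> (\<Union>j<i. set (a j) \<union> set (z j))) (a i)"
    and za: "\<And>i j. j \<le> i \<Longrightarrow> equiv_over L S M (c @ b) (z i @ a j)"
    using half_independent_sequence[OF K M(1) V(1,3,2) cl c] by blast
  have al: "length (a i) = m" for i using a[of i] by (rule realizes_length)
  have zl: "length (z i) = m" for i using equiv_over_length[OF za[of i i]] al[of i] cl b by simp
  have cz: "equiv_over L S M c (z i)" for i
  proof -
    obtain h where h: "h \<in> Aut M" "map h (c @ b) = z i @ a i" using homogeneity[OF M(1) za[of i i]] by auto
    then have "map h c = z i" using cl zl by simp
    then show ?thesis using Aut_equiv[OF h(1)] by metis
  qed
  have bz: "equiv_over L S M b (z i)" for i using bc cz by (rule equiv_over_trans)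
  obtain Y1 where Y1: "Y1 \<in> DS M (n + (m + m))"
     "\<And>x u v. length x = n \<Longrightarrow> length u = m \<Longrightarrow> length v = m \<Longrightarrow> x @ u @ v \<in> Y1 \<longleftrightarrow> x @ u \<in> Y"
    using DS_weaken[OF Y, of m] by metis
  obtain Y2 where Y2: "Y2 \<in> DS M (n + (m + m))"
     "\<And>x u v. length x = n \<Longrightarrow> length u = m \<Longrightarrow> length v = m \<Longrightarrow> x @ u @ v \<in> Y2 \<longleftrightarrow> x @ v \<in> Y"
    using DS_skip[OF Y, of m] by metis
  let ?Y = "Y1 \<inter> Y2"
  have Y12: "?Y \<in> DS M (n + (m + m))" using Y1(1) Y2(1) by (rule DS_Int)
  have fib2: "fib n ?Y (u @ v) = fib n Y u \<inter> fib n Y v" if "length u = m" "length v = m" for u v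
    using Y1(2) Y2(2) that by (auto simp: fib_def)
  \<comment> \<open>The shift serves both sides: \<open>a (Suc i)\<close> realizes the coheir over
    \<open>z i\<close>, while for \<open>i < j\<close> the tuple \<open>z j\<close> is a copy of
    \<open>c\<close> over \<open>a (Suc i)\<close>.\<close>
  define e where "e i = z i @ a (Suc i)" for i
  have el: "length (e i) = m + m" for i by (simp add: e_def al zl)
  have az: "realizes m V (M \<union> set (z i)) (a (Suc i))" for i
    by (rule realizes_mono[OF a]) auto
  have e0: "equiv_over L S M (e 0) (e i)" for i
  proof -
    have "equiv_over L S M (z 0) (z i)" using cz equiv_over_sym equiv_over_trans by metis
    then obtain h where "h \<in> Aut M" "map h (z 0) = z i" using homogeneity[OF M(1)] by metis
    then show ?thesis unfolding e_def using invariant_type_equiv[OF V(1,3) _ _ az az] by blast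
  qed
  obtain d where d: "indiscernible L S M d" "\<And>i. length (d i) = m + m"
    and d_single: "\<And>X. X \<in> DS M (m + m) \<Longrightarrow> (\<And>i. e i \<in> X) \<Longrightarrow> d 0 \<in> X"
    and d_pair: "\<And>X. X \<in> DS M (m + m + (m + m)) \<Longrightarrow> (\<And>i j. i < j \<Longrightarrow> e j @ e i \<in> X) \<Longrightarrow> d 0 @ d 1 \<in> X"
    using indiscernible_extraction[OF M(1), of e, OF el] by metis
  \<comment> \<open>Both \<open>z 0\<close> and \<open>a 1\<close> realize \<open>V\<close> over
    \<open>M\<close>, the second even over the first, so they begin a Morley sequence.\<close>
  have "fib n ?Y (e 0) \<notin> J"
  proof
    assume in_J': "fib n ?Y (e 0) \<in> J"
    obtain D where D: "indiscernible L S M D" "\<And>i. realizes m V M (D i)" and D01: "D 0 = z 0" "D 1 = a 1"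
      by (rule morley_pair[OF V(1,3) M(1) V_equiv[OF bz[of 0]], of "a 1"]) (use az[of 0] in simp_all)
    have "fib n Y (D 0) \<in> J"
    proof (rule S1_over[OF J M(1) _ _ Y])
      show "indiscernible L S M D" by (rule D(1))
      show "length (D i) = m" for i using D(2)[of i] by (rule realizes_length)
      show "fib n Y (D 0) \<inter> fib n Y (D 1) \<in> J" using in_J' fib2[OF zl al, of 0 1] D01 by (simp add: e_def)
    qed
    then have "fib n Y (z 0) \<in> J" by (simp add: D01)
    moreover obtain h where "h \<in> Aut M" "map h b = z 0" using homogeneity[OF M(1) bz] by metis
    ultimately show False using notJ fib_aut_iff[OF J _ Y b] by metis
  qed
  moreover have "equiv_over L S M (e 0) (d 0)"
    by (rule equiv_overI[OF el d(2)]) (rule d_single, assumption, rule equiv_overD[OF e0])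
  then obtain g where "g \<in> Aut M" "map g (e 0) = d 0" using homogeneity[OF M(1)] by metis
  ultimately have "fib n ?Y (d 0) \<notin> J" using fib_aut_iff[OF J _ Y12 el] by metis
  \<comment> \<open>The first half of \<open>d 0\<close> and the second half of \<open>d 1\<close>
    inherit from the reversed pairs \<open>e j\<close>, \<open>e i\<close> the type of
    \<open>(c, b)\<close>, whose fibers were assumed to meet in \<open>J\<close>.\<close>
  moreover have "fib n ?Y (d 0) \<inter> fib n ?Y (d 1) \<in> J"
  proof -
    define u where "u = take m (d 0)"
    define v where "v = drop m (d 1)"
    have uv: "length u = m" "length v = m" using d(2) by (simp_all add: u_def v_def)
    have "equiv_over L S M (c @ b) (u @ v)"
    proof (rule equiv_overI[of _ "m + m"])
      fix T assume T: "T \<in> DS M (m + m)" "c @ b \<in> T"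
      let ?T = "{w \<in> tup (m + m + (m + m)). map ((!) w) ([0..<m] @ [m + m + m..<m + m + (m + m)]) \<in> T}"
      have "?T \<in> DS M (m + m + (m + m))" by (rule DS_coords) (use T in auto)
      moreover have "e j @ e i \<in> ?T" if "i < j" for i j
      proof -
        have "z j @ a (Suc i) \<in> T" using equiv_overD[OF za T] that by simp
        then show ?thesis using al zl by (simp add: e_def map_nth_upt)
      qed
      ultimately have "d 0 @ d 1 \<in> ?T" by (rule d_pair)
      then show "u @ v \<in> T" using d(2) by (simp add: map_nth_upt u_def v_def)
    qed (use b cl uv in simp_all)
    then obtain h where h: "h \<in> Aut M" "map h (c @ b) = u @ v" using homogeneity[OF M(1)] by metis
    then have hc: "map h c = u" "map h b = v" using cl uv by simp_all
    have "map h ` (fib n Y b \<inter> fib n Y c) = fib n Y v \<inter> fib n Y u"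
      using Aut_fib[OF h(1) Y b] Aut_fib[OF h(1) Y cl] Aut_inj_map[OF h(1)] hc
      by (metis (no_types, lifting) image_Int injI)
    then have "fib n Y v \<inter> fib n Y u \<in> J" using S1_Aut[OF J h(1) in_J] by simp
    moreover have "fib n ?Y (d 0) \<inter> fib n ?Y (d 1) \<subseteq> fib n Y v \<inter> fib n Y u"
    proof -
      have "fib n ?Y (u @ drop m (d 0)) \<subseteq> fib n Y u" using fib2[of u "drop m (d 0)"] uv d(2) by simp
      moreover have "fib n ?Y (take m (d 1) @ v) \<subseteq> fib n Y v" using fib2[of "take m (d 1)" v] uv d(2) by simp
      ultimately show ?thesis by (auto simp: u_def v_def)
    qed
    moreover have "fib n ?Y (d 0) \<inter> fib n ?Y (d 1) \<in> DS UNIV n"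
      by (intro DS_Int) (use DS_UNIV[OF fib_DS[OF Y12 d(2)]] in auto)
    ultimately show ?thesis using def_ideal_down[OF S1_ideal[OF J]] by metis
  qed
  ultimately show False using S1_over[OF J M(1) d(1,2) Y12] by metis
qed

end

section \<open>Stability\<close>

text \<open>Both ladder conditions are indexed by order of construction, starting at
  \<open>0\<close>. Reading the backward sequence this way reverses the inequality, so the second
  condition has \<open>j \<le> i\<close>.\<close>

locale stable_relation = monster L S \<kappa>
  for L :: "('f, 'r) language" and S :: "('f, 'r, 'm) fo_struct" and \<kappa> :: "'k rel" +
  fixes M :: "'m set" and n :: nat and J :: "'m list set set" and m :: nat and K :: "'m list set set"
    and F :: "'m list \<Rightarrow> 'm list \<Rightarrow> bool" and k :: nat
  assumes small_M: "small M" and mdl_M: "mdl M" and S1_J: "S1 n J" and S1_K: "S1 m K"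
    and F_DS: "{w \<in> tup (n + m). F (take n w) (drop n w)} \<in> DS {} (n + m)"
    and no_ladder1: "\<not> (\<exists>a b. (\<forall>i<k. wd n J (M \<union> (\<Union>j<i. set (a j) \<union> set (b j))) (a i) \<and>
         wd m K (M \<union> (\<Union>j<i. set (a j) \<union> set (b j)) \<union> set (a i)) (b i)) \<and>
       (\<forall>i<k. \<forall>j<k. F (a i) (b j) \<longleftrightarrow> i \<le> j))"
    and no_ladder2: "\<not> (\<exists>a b. (\<forall>i<k. wd m K (M \<union> (\<Union>j<i. set (a j) \<union> set (b j))) (b i) \<and>
         wd n J (M \<union> (\<Union>j<i. set (a j) \<union> set (b j)) \<union> set (b i)) (a i)) \<and>
       (\<forall>i<k. \<forall>j<k. F (a i) (b j) \<longleftrightarrow> j \<le> i))"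
begin

text \<open>Exchanging the sorts interchanges the two kinds of ladder, so every result in this
  locale also holds with \<open>x\<close> and \<open>y\<close> exchanged.\<close>

lemma swap: "stable_relation L S \<kappa> M m K n J (\<lambda>b a. F a b) k"
proof unfold_locales
  obtain Y where Y: "Y \<in> DS {} (m + n)" "\<And>u v. length u = m \<Longrightarrow> length v = n \<Longrightarrow>
      u @ v \<in> Y \<longleftrightarrow> v @ u \<in> {w \<in> tup (n + m). F (take n w) (drop n w)}"
    by (rule DS_swap[OF F_DS]) blast
  have "Y = {w \<in> tup (m + n). F (drop m w) (take m w)}"
  proof (rule set_eqI)
    fix w
    show "w \<in> Y \<longleftrightarrow> w \<in> {w \<in> tup (m + n). F (drop m w) (take m w)}"
    proof (cases "length w = m + n")
      case True
      then show ?thesis using Y(2)[of "take m w" "drop m w"] by simp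
    next
      case False
      then show ?thesis using DS_tup[OF Y(1)] by auto
    qed
  qed
  then show "{w \<in> tup (m + n). F (drop m w) (take m w)} \<in> DS {} (m + n)" using Y(1) by simp
  have comm: "(\<Union>j<i. set (a j) \<union> set (b j)) = (\<Union>j<i. set (b j) \<union> set (a j))"
    for a b :: "nat \<Rightarrow> 'm list" and i :: nat
    by (rule SUP_cong[OF refl Un_commute])
  have all2: "(\<And>a b. \<not> Q b a) \<Longrightarrow> \<not> (\<exists>a b. Q a b)" for Q :: "(nat \<Rightarrow> 'm list) \<Rightarrow> (nat \<Rightarrow> 'm list) \<Rightarrow> bool"
    by auto
  show "\<not> (\<exists>a b. (\<forall>i<k. wd m K (M \<union> (\<Union>j<i. set (a j) \<union> set (b j))) (a i) \<and>
         wd n J (M \<union> (\<Union>j<i. set (a j) \<union> set (b j)) \<union> set (a i)) (b i)) \<and>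
       (\<forall>i<k. \<forall>j<k. F (b j) (a i) \<longleftrightarrow> i \<le> j))"
  proof (rule all2)
    fix a b
    have "(\<forall>i<k. \<forall>j<k. F (a j) (b i) \<longleftrightarrow> i \<le> j) \<longleftrightarrow> (\<forall>i<k. \<forall>j<k. F (a i) (b j) \<longleftrightarrow> j \<le> i)"
      by (intro iffI allI impI) simp_all
    then show "\<not> ((\<forall>i<k. wd m K (M \<union> (\<Union>j<i. set (b j) \<union> set (a j))) (b i) \<and>
         wd n J (M \<union> (\<Union>j<i. set (b j) \<union> set (a j)) \<union> set (b i)) (a i)) \<and>
       (\<forall>i<k. \<forall>j<k. F (a j) (b i) \<longleftrightarrow> i \<le> j))"
      using no_ladder2[unfolded not_ex, THEN spec, THEN spec, of a b] unfolding comm[of b a] by simp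
  qed
  show "\<not> (\<exists>a b. (\<forall>i<k. wd n J (M \<union> (\<Union>j<i. set (a j) \<union> set (b j))) (b i) \<and>
         wd m K (M \<union> (\<Union>j<i. set (a j) \<union> set (b j)) \<union> set (b i)) (a i)) \<and>
       (\<forall>i<k. \<forall>j<k. F (b j) (a i) \<longleftrightarrow> j \<le> i))"
  proof (rule all2)
    fix a b
    have "(\<forall>i<k. \<forall>j<k. F (a j) (b i) \<longleftrightarrow> j \<le> i) \<longleftrightarrow> (\<forall>i<k. \<forall>j<k. F (a i) (b j) \<longleftrightarrow> i \<le> j)"
      by (intro iffI allI impI) simp_all
    then show "\<not> ((\<forall>i<k. wd n J (M \<union> (\<Union>j<i. set (b j) \<union> set (a j))) (a i) \<and>
         wd m K (M \<union> (\<Union>j<i. set (b j) \<union> set (a j)) \<union> set (a i)) (b i)) \<and>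
       (\<forall>i<k. \<forall>j<k. F (a j) (b i) \<longleftrightarrow> j \<le> i))"
      using no_ladder1[unfolded not_ex, THEN spec, THEN spec, of a b] unfolding comm[of b a] by simp
  qed
qed (rule small_M mdl_M S1_J S1_K)+

text \<open>Wideness may be checked over any bases \<open>Z i\<close> that contain the preceding
  entries. In the constructions these bases also hold auxiliary parameters.\<close>

lemma ladder1:
  assumes "\<And>i. i < k \<Longrightarrow> M \<subseteq> Z i"
    and "\<And>i. i < k \<Longrightarrow> wd n J (Z i) (a i)" "\<And>i. i < k \<Longrightarrow> wd m K (Z i \<union> set (a i)) (b i)"
    and "\<And>i j. i < j \<Longrightarrow> j < k \<Longrightarrow> set (a i) \<union> set (b i) \<subseteq> Z j"
    and "\<And>i j. i < k \<Longrightarrow> j < k \<Longrightarrow> F (a i) (b j) \<longleftrightarrow> i \<le> j"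
  shows False
proof -
  have sub: "M \<union> (\<Union>j<i. set (a j) \<union> set (b j)) \<subseteq> Z i" if "i < k" for i
  proof -
    have "(\<Union>j<i. set (a j) \<union> set (b j)) \<subseteq> Z i"
    proof (rule UN_least)
      fix j assume "j \<in> {..<i}"
      then show "set (a j) \<union> set (b j) \<subseteq> Z i" using assms(4)[of j i] that by simp
    qed
    then show ?thesis using assms(1)[OF that] by simp
  qed
  have "wd n J (M \<union> (\<Union>j<i. set (a j) \<union> set (b j))) (a i) \<and>
     wd m K (M \<union> (\<Union>j<i. set (a j) \<union> set (b j)) \<union> set (a i)) (b i)" if "i < k" for i
    using wd_mono[OF assms(2)[OF that] sub[OF that]] wd_mono[OF assms(3)[OF that] Un_mono[OF sub[OF that] subset_refl]]
    by (rule conjI)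
  then show False using no_ladder1 assms(5) by blast
qed

lemma ladder2:
  assumes "\<And>i. i < k \<Longrightarrow> M \<subseteq> Z i"
    and "\<And>i. i < k \<Longrightarrow> wd m K (Z i) (b i)" "\<And>i. i < k \<Longrightarrow> wd n J (Z i \<union> set (b i)) (a i)"
    and "\<And>i j. i < j \<Longrightarrow> j < k \<Longrightarrow> set (a i) \<union> set (b i) \<subseteq> Z j"
    and "\<And>i j. i < k \<Longrightarrow> j < k \<Longrightarrow> F (a i) (b j) \<longleftrightarrow> j \<le> i"
  shows False
  using stable_relation.ladder1[OF swap, of Z b a] assms by (simp add: Un_commute)

definition Xs :: "'m list \<Rightarrow> 'm list set" where
  "Xs b = {a \<in> tup n. F a b}"

definition Ys :: "'m list \<Rightarrow> 'm list set" where
  "Ys a = {b \<in> tup m. F a b}"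

lemma Xs_DS: "length b = m \<Longrightarrow> set b \<subseteq> A \<Longrightarrow> Xs b \<in> DS A n"
proof -
  assume b: "length b = m" "set b \<subseteq> A"
  have "fib n {w \<in> tup (n + m). F (take n w) (drop n w)} b \<in> DS ({} \<union> set b) n" by (rule fib_DS[OF F_DS b(1)])
  moreover have "fib n {w \<in> tup (n + m). F (take n w) (drop n w)} b = Xs b" using b(1) by (auto simp: Xs_def fib_def)
  ultimately show ?thesis using DS_mono b(2) by auto
qed

lemma Ys_DS: "length a = n \<Longrightarrow> set a \<subseteq> A \<Longrightarrow> Ys a \<in> DS A m"
  using stable_relation.Xs_DS[OF swap, of a A] unfolding Ys_def stable_relation.Xs_def[OF swap] .

lemma F_aut:
  assumes h: "h \<in> Aut A" and "length a = n" "length b = m"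
  shows "F (map h a) (map h b) \<longleftrightarrow> F a b"
proof -
  have "map h (a @ b) \<in> {w \<in> tup (n + m). F (take n w) (drop n w)} \<longleftrightarrow>
     a @ b \<in> {w \<in> tup (n + m). F (take n w) (drop n w)}"
    by (rule Aut_DS[OF Aut_empty[OF h] F_DS])
  then show ?thesis using assms(2,3) by simp
qed

lemma Aut_Xs:
  assumes h: "h \<in> Aut A" and b: "length b = m"
  shows "map h ` Xs b = Xs (map h b)"
proof (rule set_eqI)
  fix a
  have "length a = n \<Longrightarrow> F (map (inv h) a) b \<longleftrightarrow> F a (map h b)"
    using F_aut[OF h, of "map (inv h) a" b] b Aut_inv_map(2)[OF h, of a] by simp
  then show "a \<in> map h ` Xs b \<longleftrightarrow> a \<in> Xs (map h b)" unfolding Aut_image_iff[OF h] by (auto simp: Xs_def)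
qed

section \<open>Majority sets\<close>

definition majority :: "'m list list \<Rightarrow> 'm list set" where
  "majority as = {b \<in> tup m. k < card {l. l < length as \<and> F (as ! l) b}}"

text \<open>The last clause counts the entries that misclassify \<open>b\<close>. The truth value
  \<open>\<epsilon>\<close> of the wrong answer is a variable so that both kinds of error are
  treated together.\<close>

definition defined_by :: "'m list set set \<Rightarrow> 'm set \<Rightarrow> 'm list list \<Rightarrow> bool" where
  "defined_by U A as \<longleftrightarrow> length as = 2 * k + 1 \<and> (\<forall>l<length as. length (as ! l) = n \<and> set (as ! l) \<subseteq> A) \<and>
     (\<forall>b \<epsilon>. wd m K A b \<and> (Xs b \<in> U \<longleftrightarrow> \<not> \<epsilon>) \<longrightarrow> card {l. l < length as \<and> F (as ! l) b = \<epsilon>} \<le> k)"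

lemma defined_by_iff:
  assumes d: "defined_by U A as" and b: "wd m K A b"
  shows "b \<in> majority as \<longleftrightarrow> Xs b \<in> U"
proof
  assume "b \<in> majority as"
  then show "Xs b \<in> U" using d b unfolding defined_by_def majority_def by fastforce
next
  assume U: "Xs b \<in> U"
  have "{..<length as} = {l. l < length as \<and> F (as ! l) b = True} \<union> {l. l < length as \<and> F (as ! l) b = False}"
    by auto
  then have "length as \<le> card {l. l < length as \<and> F (as ! l) b = True} + card {l. l < length as \<and> F (as ! l) b = False}"
    by (metis card_Un_le card_lessThan)
  moreover have "card {l. l < length as \<and> F (as ! l) b = False} \<le> k"
    using d b U unfolding defined_by_def by blast
  moreover have "length as = 2 * k + 1" using d by (simp add: defined_by_def)
  ultimately have "k < card {l. l < length as \<and> F (as ! l) b}" by simp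
  then show "b \<in> majority as" using b by (simp add: majority_def wd_def)
qed

text \<open>A finite union, over the index sets of more than \<open>k\<close> positions, of finite
  intersections of sets \<open>Ys (as ! l)\<close>.\<close>

lemma majority_DS:
  assumes "\<And>l. l < length as \<Longrightarrow> length (as ! l) = n \<and> set (as ! l) \<subseteq> A"
  shows "majority as \<in> DS A m"
proof -
  define G where "G w = tup m \<inter> \<Inter>((\<lambda>l. Ys (as ! l)) ` w)" for w
  have "majority as = \<Union>(G ` {w. w \<subseteq> {..<length as} \<and> k < card w})"
  proof (intro set_eqI iffI)
    fix b assume b: "b \<in> majority as"
    let ?w = "{l. l < length as \<and> F (as ! l) b}"
    have "b \<in> G ?w" using b by (auto simp: G_def Ys_def majority_def)
    moreover have "?w \<in> {w. w \<subseteq> {..<length as} \<and> k < card w}" using b by (auto simp: majority_def)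
    ultimately show "b \<in> \<Union>(G ` {w. w \<subseteq> {..<length as} \<and> k < card w})" by blast
  next
    fix b assume "b \<in> \<Union>(G ` {w. w \<subseteq> {..<length as} \<and> k < card w})"
    then obtain w where w: "w \<subseteq> {..<length as}" "k < card w" "b \<in> G w" by blast
    then have "w \<subseteq> {l. l < length as \<and> F (as ! l) b}" by (auto simp: G_def Ys_def)
    then have "card w \<le> card {l. l < length as \<and> F (as ! l) b}" by (intro card_mono) auto
    then show "b \<in> majority as" using w by (simp add: majority_def G_def)
  qed
  also have "\<dots> \<in> DS A m"
  proof (rule DS_UN)
    show "G ` {w. w \<subseteq> {..<length as} \<and> k < card w} \<subseteq> DS A m"
    proof (rule image_subsetI)
      fix w assume w: "w \<in> {w. w \<subseteq> {..<length as} \<and> k < card w}"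
      show "G w \<in> DS A m"
        unfolding G_def
      proof (rule DS_INT)
        show "finite ((\<lambda>l. Ys (as ! l)) ` w)" using w by (auto intro: finite_subset)
        show "(\<lambda>l. Ys (as ! l)) ` w \<subseteq> DS A m" using w assms Ys_DS by blast
      qed
    qed
  qed simp
  finally show ?thesis .
qed

lemma realizes_F:
  assumes U: "ultra n U" and a: "realizes n U A a" and b: "length b = m" "set b \<subseteq> A"
  shows "F a b \<longleftrightarrow> Xs b \<in> U"
  using realizes_iff[OF U a Xs_DS[OF b]] realizes_length[OF a] by (simp add: Xs_def)

text \<open>
  The tuples placed into \<open>Z\<^sub>i\<^sub>+\<^sub>1\<close> witness that the formulas \<open>F(a\<^sub>l, y)\<close>, \<open>l \<in> w\<close>, misclassify some wide tuple. More than
  \<open>k\<close> misclassifications by the whole sequence then assemble to a ladder.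
\<close>

lemma misclassification_sequence:
  assumes U: "ultra n U" and B: "small B"
  obtains a Z where "Z 0 = B" "\<And>i. small (Z i)" "\<And>i :: nat. realizes n U (Z i) (a i)"
    "\<And>i. Z i \<union> set (a i) \<subseteq> Z (Suc i)"
    "\<And>i w \<epsilon> b. w \<subseteq> {..i} \<Longrightarrow> wd m K (Z i \<union> set (a i)) b \<Longrightarrow> (Xs b \<in> U \<longleftrightarrow> \<not> \<epsilon>) \<Longrightarrow>
       (\<forall>l\<in>w. F (a l) b = \<epsilon>) \<Longrightarrow>
       \<exists>b. wd m K (Z i \<union> set (a i)) b \<and> (Xs b \<in> U \<longleftrightarrow> \<not> \<epsilon>) \<and> (\<forall>l\<in>w. F (a l) b = \<epsilon>) \<and> set b \<subseteq> Z (Suc i)"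
proof -
  define last_set where "last_set xs = (if xs = [] then B else snd (last xs))" for xs :: "('m list \<times> 'm set) list"
  define good where "good xs x w \<epsilon> b \<longleftrightarrow> wd m K (last_set xs \<union> set x) b \<and> (Xs b \<in> U \<longleftrightarrow> \<not> \<epsilon>) \<and>
     (\<forall>l\<in>w. F ((map fst xs @ [x]) ! l) b = \<epsilon>)" for xs x w \<epsilon> b
  define P where "P xs p \<longleftrightarrow> realizes n U (last_set xs) (fst p) \<and> small (snd p) \<and>
     last_set xs \<union> set (fst p) \<subseteq> snd p \<and>
     (\<forall>w\<subseteq>{..length xs}. \<forall>\<epsilon>. (\<exists>b. good xs (fst p) w \<epsilon> b) \<longrightarrow> (\<exists>b. good xs (fst p) w \<epsilon> b \<and> set b \<subseteq> snd p))" for xs p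
  have step: "\<exists>p. P xs p" if xs: "\<And>i. i < length xs \<Longrightarrow> P (take i xs) (xs ! i)" for xs
  proof -
    have sm: "small (last_set xs)"
    proof (cases "xs = []")
      case False
      then have "small (snd (xs ! (length xs - 1)))" using xs[of "length xs - 1"] by (simp add: P_def)
      then show ?thesis using False by (simp add: last_set_def last_conv_nth)
    qed (simp add: last_set_def B)
    obtain x where x: "realizes n U (last_set xs) x" using realizes_exists[OF U sm] .
    \<comment> \<open>If no misclassified tuple exists, \<open>SOME\<close> yields an arbitrary
      list. Adding its entries to \<open>Z\<close> keeps \<open>Z\<close> small, as only finitely
      many pairs \<open>(w, \<epsilon>)\<close> occur.\<close>
    define bb where "bb w \<epsilon> = (SOME b. good xs x w \<epsilon> b)" for w \<epsilon>
    define Z where "Z = last_set xs \<union> set x \<union> (\<Union>(w, \<epsilon>)\<in>Pow {..length xs} \<times> UNIV. set (bb w \<epsilon>))"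
    have "small (last_set xs \<union> set x)" using sm by (rule small_set)
    moreover have "small (\<Union>(w, \<epsilon>)\<in>Pow {..length xs} \<times> (UNIV :: bool set). set (bb w \<epsilon>))"
      by (rule small_finite) auto
    ultimately have "small Z" unfolding Z_def by (rule small_Un)
    moreover have "\<exists>b. good xs x w \<epsilon> b \<and> set b \<subseteq> Z" if w: "w \<subseteq> {..length xs}" and ex: "\<exists>b. good xs x w \<epsilon> b" for w \<epsilon>
    proof -
      have "good xs x w \<epsilon> (bb w \<epsilon>)" unfolding bb_def using ex by (rule someI_ex)
      moreover have "set (bb w \<epsilon>) \<subseteq> Z" unfolding Z_def using w by blast
      ultimately show ?thesis by blast
    qed
    ultimately have "P xs (x, Z)" unfolding P_def using x by (auto simp: Z_def)
    then show ?thesis by blast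
  qed
  obtain f where f: "\<And>i. P (map f [0..<i]) (f i)" using history_choice[of P] step by metis
  define a where "a i = fst (f i)" for i
  define Z where "Z i = last_set (map f [0..<i])" for i
  have ZS: "Z (Suc i) = snd (f i)" for i by (simp add: Z_def last_set_def)
  have a: "realizes n U (Z i) (a i)" for i using f[of i] by (simp add: P_def Z_def a_def)
  have sub: "Z i \<union> set (a i) \<subseteq> Z (Suc i)" for i using f[of i] unfolding ZS by (simp add: P_def Z_def a_def)
  have nth: "(map fst (map f [0..<i]) @ [fst (f i)]) ! l = a l" if "l \<le> i" for i l
    using that by (cases "l = i") (simp_all add: nth_append a_def)
  have good: "good (map f [0..<i]) (fst (f i)) w \<epsilon> b \<longleftrightarrow>
     wd m K (Z i \<union> set (a i)) b \<and> (Xs b \<in> U \<longleftrightarrow> \<not> \<epsilon>) \<and> (\<forall>l\<in>w. F (a l) b = \<epsilon>)" if "w \<subseteq> {..i}" for i w \<epsilon> b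
  proof -
    have "(\<forall>l\<in>w. F ((map fst (map f [0..<i]) @ [fst (f i)]) ! l) b = \<epsilon>) \<longleftrightarrow> (\<forall>l\<in>w. F (a l) b = \<epsilon>)"
    proof (rule ball_cong[OF refl])
      fix l assume "l \<in> w"
      then have "l \<le> i" using that by blast
      then show "(F ((map fst (map f [0..<i]) @ [fst (f i)]) ! l) b = \<epsilon>) = (F (a l) b = \<epsilon>)"
        by (simp only: nth)
    qed
    then show ?thesis unfolding good_def by (simp only: Z_def a_def)
  qed
  show ?thesis
  proof (rule that)
    show "Z 0 = B" by (simp add: Z_def last_set_def)
    show "small (Z i)" for i
      by (cases i) (use B f in \<open>simp_all add: ZS P_def\<close>, simp add: Z_def last_set_def)
    show "realizes n U (Z i) (a i)" for i by (rule a)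
    show "Z i \<union> set (a i) \<subseteq> Z (Suc i)" for i by (rule sub)
    fix i w \<epsilon> b
    assume w: "w \<subseteq> {..i}" and b: "wd m K (Z i \<union> set (a i)) b" "Xs b \<in> U \<longleftrightarrow> \<not> \<epsilon>" "\<forall>l\<in>w. F (a l) b = \<epsilon>"
    then have "\<exists>b. good (map f [0..<i]) (fst (f i)) w \<epsilon> b" using good[OF w] by blast
    then have "\<exists>b. good (map f [0..<i]) (fst (f i)) w \<epsilon> b \<and> set b \<subseteq> snd (f i)"
      using f[of i] w unfolding P_def by simp
    then show "\<exists>b. wd m K (Z i \<union> set (a i)) b \<and> (Xs b \<in> U \<longleftrightarrow> \<not> \<epsilon>) \<and> (\<forall>l\<in>w. F (a l) b = \<epsilon>) \<and> set b \<subseteq> Z (Suc i)"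
      unfolding good[OF w] ZS by blast
  qed
qed

lemma definition_exists:
  assumes U: "ultra n U" "U \<inter> J = {}" and B: "small B" "M \<subseteq> B"
  obtains A as where "small A" "B \<subseteq> A" "defined_by U A as" "\<And>l. l < length as \<Longrightarrow> realizes n U B (as ! l)"
proof -
  obtain a Z where Z0: "Z 0 = B" and sm: "\<And>i. small (Z i)" and a: "\<And>i :: nat. realizes n U (Z i) (a i)"
    and sub: "\<And>i. Z i \<union> set (a i) \<subseteq> Z (Suc i)"
    and pick: "\<And>i w \<epsilon> b. w \<subseteq> {..i} \<Longrightarrow> wd m K (Z i \<union> set (a i)) b \<Longrightarrow> (Xs b \<in> U \<longleftrightarrow> \<not> \<epsilon>) \<Longrightarrow>
       (\<forall>l\<in>w. F (a l) b = \<epsilon>) \<Longrightarrow>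
       \<exists>b. wd m K (Z i \<union> set (a i)) b \<and> (Xs b \<in> U \<longleftrightarrow> \<not> \<epsilon>) \<and> (\<forall>l\<in>w. F (a l) b = \<epsilon>) \<and> set b \<subseteq> Z (Suc i)"
    by (rule misclassification_sequence[OF U(1) B(1)]) (rule that)
  have Zmono: "i \<le> j \<Longrightarrow> Z i \<subseteq> Z j" for i j using lift_Suc_mono_le[of Z] sub by blast
  have ZM: "M \<subseteq> Z i" for i using Zmono[of 0 i] Z0 B(2) by simp
  have aw: "wd n J (Z i) (a i)" for i using realizes_wd[OF U a] .
  let ?N = "2 * k + 1"
  define as where "as = map a [0..<?N]"
  have bound: "card {l. l < ?N \<and> F (a l) b = \<epsilon>} \<le> k" if b: "wd m K (Z ?N) b" "Xs b \<in> U \<longleftrightarrow> \<not> \<epsilon>" for b \<epsilon>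
  proof (rule ccontr)
    assume n: "\<not> ?thesis"
    define w where "w = {l. l < ?N \<and> F (a l) b = \<epsilon>}"
    define s where "s = sorted_list_of_set w"
    have finw: "finite w" by (simp add: w_def)
    have ls: "Suc k \<le> length s" using n by (simp add: s_def w_def)
    have sw: "set s = w" using finw by (simp add: s_def)
    have smono: "s ! i < s ! j" if "i < j" "j < length s" for i j
      using that strict_sorted_list_of_set[of w] unfolding s_def sorted_wrt_iff_nth_less by blast
    have sN: "s ! i < ?N" "F (a (s ! i)) b = \<epsilon>" if "i < length s" for i
      using nth_mem[OF that] sw by (simp_all add: w_def)
    \<comment> \<open>For each initial segment of the misclassifying indices \<open>s\<close>, the
      tuple \<open>b\<close> shows that a witness exists, so one has already been placed before the
      next index of \<open>s\<close>.\<close>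
    have "\<exists>c. wd m K (Z (s ! j) \<union> set (a (s ! j))) c \<and> (Xs c \<in> U \<longleftrightarrow> \<not> \<epsilon>) \<and>
       (\<forall>l\<in>(!) s ` {..j}. F (a l) c = \<epsilon>) \<and> set c \<subseteq> Z (Suc (s ! j))" if j: "j < length s" for j
    proof (rule pick)
      show "(!) s ` {..j} \<subseteq> {..s ! j}"
      proof (rule image_subsetI)
        fix i assume "i \<in> {..j}"
        then show "s ! i \<in> {..s ! j}" using smono[of i j] j by (cases "i = j") (auto intro: less_imp_le)
      qed
      have "Z (s ! j) \<union> set (a (s ! j)) \<subseteq> Z ?N" using sub[of "s ! j"] Zmono[of "Suc (s ! j)" ?N] sN(1)[OF j] by auto
      then show "wd m K (Z (s ! j) \<union> set (a (s ! j))) b" by (rule wd_mono[OF b(1)])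
      show "Xs b \<in> U \<longleftrightarrow> \<not> \<epsilon>" by (rule b(2))
      show "\<forall>l\<in>(!) s ` {..j}. F (a l) b = \<epsilon>" using sN(2) j by auto
    qed
    then obtain c where c: "\<And>j. j < length s \<Longrightarrow> wd m K (Z (s ! j) \<union> set (a (s ! j))) (c j)"
      "\<And>j. j < length s \<Longrightarrow> Xs (c j) \<in> U \<longleftrightarrow> \<not> \<epsilon>"
      "\<And>i j. j < length s \<Longrightarrow> i \<le> j \<Longrightarrow> F (a (s ! i)) (c j) = \<epsilon>"
      "\<And>j. j < length s \<Longrightarrow> set (c j) \<subseteq> Z (Suc (s ! j))"
      by (metis atMost_iff image_eqI)
    have cl: "length (c j) = m" if "j < length s" for j using c(1)[OF that] by (simp add: wd_def)
    have sub': "set (a (s ! i)) \<union> set (c i) \<subseteq> Z (s ! j)" if "i < j" "j < length s" for i j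
    proof -
      have "set (a (s ! i)) \<union> set (c i) \<subseteq> Z (Suc (s ! i))" using sub[of "s ! i"] c(4)[of i] that by auto
      also have "\<dots> \<subseteq> Z (s ! j)" using Zmono[of "Suc (s ! i)" "s ! j"] smono[OF that] by simp
      finally show ?thesis .
    qed
    \<comment> \<open>Entries after the witness realize \<open>U\<close> over it and so answer
      correctly, whereas those up to it answer \<open>\<epsilon>\<close>. This contrast is the
      ladder.\<close>
    have F_gt: "F (a (s ! i)) (c j) = (\<not> \<epsilon>)" if "j < i" "i < length s" for i j
    proof -
      have "set (c j) \<subseteq> Z (s ! i)" using sub'[OF that] by simp
      then have "F (a (s ! i)) (c j) \<longleftrightarrow> Xs (c j) \<in> U" using realizes_F[OF U(1) a cl] that by simp
      then show ?thesis using c(2)[of j] that by simp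
    qed
    show False
    proof (cases \<epsilon>)
      case True
      show False
      proof (rule ladder1[of "\<lambda>i. Z (s ! i)" "\<lambda>i. a (s ! i)" c])
        fix i j assume ij: "i < k" "j < k"
        show "F (a (s ! i)) (c j) \<longleftrightarrow> i \<le> j"
        proof (cases "i \<le> j")
          case le: True
          then show ?thesis using c(3)[of j i] ij ls True by simp
        next
          case False
          then show ?thesis using F_gt[of j i] ij ls True by simp
        qed
      qed (use ZM aw c(1) sub' ls in simp_all)
    next
      case False
      show False
      \<comment> \<open>With \<open>\<epsilon>\<close> false, \<open>F\<close> holds exactly for
        entries strictly after the witness. The ladder starts with \<open>c 0\<close> and pairs
        \<open>c i\<close> with the entry at \<open>Suc i\<close>; this consumes the index of number
        \<open>k + 1\<close>.\<close>
      proof (rule ladder2[of "\<lambda>i. Z (s ! i) \<union> set (a (s ! i))" c "\<lambda>i. a (s ! Suc i)"])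
        fix i assume i: "i < k"
        show "M \<subseteq> Z (s ! i) \<union> set (a (s ! i))" using ZM by blast
        show "wd m K (Z (s ! i) \<union> set (a (s ! i))) (c i)" using c(1)[of i] i ls by simp
        show "wd n J (Z (s ! i) \<union> set (a (s ! i)) \<union> set (c i)) (a (s ! Suc i))"
        proof (rule wd_mono[OF aw])
          have "Z (s ! i) \<subseteq> Z (s ! Suc i)" using Zmono smono[of i "Suc i"] i ls by simp
          then show "Z (s ! i) \<union> set (a (s ! i)) \<union> set (c i) \<subseteq> Z (s ! Suc i)" using sub'[of i "Suc i"] i ls by simp
        qed
      next
        fix i j assume ij: "i < j" "j < k"
        have "set (a (s ! Suc i)) \<subseteq> Z (s ! j) \<union> set (a (s ! j))"
          using sub'[of "Suc i" j] ij ls by (cases "Suc i = j") auto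
        then show "set (a (s ! Suc i)) \<union> set (c i) \<subseteq> Z (s ! j) \<union> set (a (s ! j))"
          using sub'[of i j] ij ls by auto
      next
        fix i j assume ij: "i < k" "j < k"
        show "F (a (s ! Suc i)) (c j) \<longleftrightarrow> j \<le> i"
        proof (cases "j \<le> i")
          case le: True
          then show ?thesis using F_gt[of j "Suc i"] ij ls False by simp
        next
          case gt: False
          then show ?thesis using c(3)[of j "Suc i"] ij ls False by simp
        qed
      qed
    qed
  qed
  show ?thesis
  proof (rule that)
    show "small (Z ?N)" by (rule sm)
    show "B \<subseteq> Z ?N" using Zmono[of 0 ?N] Z0 by simp
    show "realizes n U B (as ! l)" if "l < length as" for l
    proof -
      have "realizes n U B (a l)" by (rule realizes_mono[OF a]) (use Zmono[of 0 l] Z0 in simp)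
      then show ?thesis using that by (simp add: as_def del: upt_Suc)
    qed
    show "defined_by U (Z ?N) as"
      unfolding defined_by_def
    proof (intro conjI allI impI, goal_cases)
      case (2 l)
      then show ?case using realizes_length[OF a[of l]] by (simp add: as_def del: upt_Suc)
    next
      case (3 l)
      have "set (a l) \<subseteq> Z ?N" using sub[of l] Zmono[of "Suc l" ?N] 3 by (auto simp: as_def)
      then show ?case using 3 by (simp add: as_def del: upt_Suc)
    next
      case (4 b \<epsilon>)
      have "{l. l < length as \<and> F (as ! l) b = \<epsilon>} = {l. l < ?N \<and> F (a l) b = \<epsilon>}"
        by (auto simp: as_def simp del: upt_Suc)
      then show ?case using bound[of b \<epsilon>] 4 by simp
    qed (simp add: as_def)
  qed
qed

section \<open>Conjugates of majority formulas\<close>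

lemma image_type_iff: "h \<in> Aut A \<Longrightarrow> map h ` X \<in> (`) (map h) ` U \<longleftrightarrow> X \<in> U"
proof
  assume h: "h \<in> Aut A" and "map h ` X \<in> (`) (map h) ` U"
  then obtain X' where X': "X' \<in> U" "map h ` X = map h ` X'" by blast
  from arg_cong[OF X'(2), of "(`) (map (inv h))"] have "X = X'" unfolding Aut_image_inv(2)[OF h] .
  then show "X \<in> U" using X'(1) by simp
qed (rule imageI)

lemma pattern_eq:
  "{b \<in> tup m'. \<forall>i<t :: nat. b \<in> X i \<longleftrightarrow> P i} =
     tup m' \<inter> \<Inter>((\<lambda>i. if P i then X i else tup m' - X i) ` {..<t})"
proof (rule set_eqI)
  fix b
  have "length b = m' \<Longrightarrow> b \<in> (if P i then X i else tup m' - X i) \<longleftrightarrow> (b \<in> X i \<longleftrightarrow> P i)" for i by simp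
  then show "b \<in> {b \<in> tup m'. \<forall>i<t. b \<in> X i \<longleftrightarrow> P i} \<longleftrightarrow>
     b \<in> tup m' \<inter> \<Inter>((\<lambda>i. if P i then X i else tup m' - X i) ` {..<t})"
    by (auto simp only: Int_iff INT_iff mem_Collect_eq tup_iff lessThan_iff)
qed

lemma Aut_wd:
  assumes h: "h \<in> Aut A" and K': "S1 m' K'" and b: "wd m' K' (h ` B) b"
  shows "wd m' K' B (map (inv h) b)"
  unfolding wd_def
proof (intro conjI ballI notI)
  show "length (map (inv h) b) = m'" using b by (simp add: wd_def)
  fix X assume X: "X \<in> K' \<inter> DS B m'" "map (inv h) b \<in> X"
  then have "b \<in> map h ` X" using Aut_image_iff[OF h] by simp
  moreover have "map h ` X \<in> K' \<inter> DS (h ` B) m'"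
    using X(1) S1_Aut[OF K' h] Aut_image_DS[OF Aut_empty[OF h]] by simp
  ultimately show False using b unfolding wd_def by blast
qed

lemma defined_by_image:
  assumes h: "h \<in> Aut {}" and d: "defined_by U A as"
  shows "defined_by ((`) (map h) ` U) (h ` A) (map (map h) as)"
  unfolding defined_by_def
proof (intro conjI allI impI)
  show "length (map (map h) as) = 2 * k + 1" using d by (simp add: defined_by_def)
next
  fix l assume "l < length (map (map h) as)"
  then have l: "l < length as" by simp
  then have "length (as ! l) = n" "set (as ! l) \<subseteq> A" using d by (simp_all add: defined_by_def)
  then show "length (map (map h) as ! l) = n" "set (map (map h) as ! l) \<subseteq> h ` A"
    using l by (simp_all add: image_mono)
next
  fix b \<epsilon> assume b: "wd m K (h ` A) b \<and> (Xs b \<in> (`) (map h) ` U \<longleftrightarrow> \<not> \<epsilon>)"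
  let ?b = "map (inv h) b"
  have bl: "length b = m" using b by (simp add: wd_def)
  have "wd m K A ?b" using Aut_wd[OF h S1_K] b by blast
  moreover have "map h ` Xs ?b = Xs b" using Aut_Xs[OF h, of ?b] bl Aut_inv_map(2)[OF h, of b] by simp
  then have "Xs ?b \<in> U \<longleftrightarrow> \<not> \<epsilon>" using image_type_iff[OF h, of "Xs ?b" U] b by simp
  ultimately have "card {l. l < length as \<and> F (as ! l) ?b = \<epsilon>} \<le> k" using d unfolding defined_by_def by blast
  moreover have "F (map h (as ! l)) b = F (as ! l) ?b" if "l < length as" for l
    using F_aut[OF h, of "as ! l" ?b] d that bl Aut_inv_map(2)[OF h, of b] by (simp add: defined_by_def)
  then have "{l. l < length (map (map h) as) \<and> F (map (map h) as ! l) b = \<epsilon>} =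
      {l. l < length as \<and> F (as ! l) ?b = \<epsilon>}" by auto
  ultimately show "card {l. l < length (map (map h) as) \<and> F (map (map h) as ! l) b = \<epsilon>} \<le> k" by simp
qed

lemma majority_image:
  assumes h: "h \<in> Aut {}" and "\<And>l. l < length as \<Longrightarrow> length (as ! l) = n"
  shows "majority (map (map h) as) = map h ` majority as"
proof (rule set_eqI)
  fix b
  let ?b = "map (inv h) b"
  show "b \<in> majority (map (map h) as) \<longleftrightarrow> b \<in> map h ` majority as"
  proof (cases "length b = m")
    case True
    have "F (map h (as ! l)) b = F (as ! l) ?b" if "l < length as" for l
      using F_aut[OF h, of "as ! l" ?b] assms(2)[OF that] True Aut_inv_map(2)[OF h, of b] by simp
    then have "{l. l < length (map (map h) as) \<and> F (map (map h) as ! l) b} = {l. l < length as \<and> F (as ! l) ?b}"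
      by auto
    then show ?thesis unfolding Aut_image_iff[OF h] using True by (simp add: majority_def)
  next
    case False
    then show ?thesis unfolding Aut_image_iff[OF h] by (simp add: majority_def)
  qed
qed

text \<open>
  A fresh defining sequence of \<open>U\<^sub>t\<close> is inserted before a realization \<open>b\<^sub>t\<close> of \<open>W\<^sub>t\<close>. By Ramsey's theorem a
  fixed position of these sequences yields a ladder.
\<close>

lemma no_alternating_types:
  assumes U: "\<And>i :: nat. ultra n (U i)" "\<And>i. U i \<inter> J = {}"
    and W: "\<And>i :: nat. ultra m (W i)" "\<And>i. W i \<inter> K = {}"
    and C: "small C" "M \<subseteq> C"
    and alt: "\<And>i t b. realizes m (W t) C b \<Longrightarrow> wd m K C b \<Longrightarrow> Xs b \<in> U i \<longleftrightarrow> i \<le> t"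
  shows False
proof -
  define last_set where "last_set xs = (if xs = [] then C else fst (snd (last xs)) \<union> set (snd (snd (last xs))))"
    for xs :: "('m list list \<times> 'm set \<times> 'm list) list"
  define P where "P xs p \<longleftrightarrow> small (fst (snd p)) \<and> last_set xs \<subseteq> fst (snd p) \<and>
     defined_by (U (length xs)) (fst (snd p)) (fst p) \<and>
     (\<forall>l<length (fst p). realizes n (U (length xs)) (last_set xs) (fst p ! l)) \<and>
     realizes m (W (length xs)) (fst (snd p)) (snd (snd p)) \<and> C \<subseteq> fst (snd p)" for xs p
  have step: "\<exists>p. P xs p" if xs: "\<And>i. i < length xs \<Longrightarrow> P (take i xs) (xs ! i)" for xs
  proof -
    have sm: "small (last_set xs) \<and> C \<subseteq> last_set xs"
    proof (cases "xs = []")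
      case False
      then have "P (take (length xs - 1) xs) (last xs)" using xs[of "length xs - 1"] by (simp add: last_conv_nth)
      then have "small (fst (snd (last xs)))" "C \<subseteq> fst (snd (last xs))" unfolding P_def by blast+
      then show ?thesis using False by (auto simp: last_set_def intro!: small_set)
    qed (simp add: last_set_def C)
    then obtain A as where A: "small A" "last_set xs \<subseteq> A" "defined_by (U (length xs)) A as"
      "\<And>l. l < length as \<Longrightarrow> realizes n (U (length xs)) (last_set xs) (as ! l)"
      using definition_exists[OF U, of "last_set xs" "length xs"] C(2) by (metis subset_trans)
    obtain b where b: "realizes m (W (length xs)) A b" using realizes_exists[OF W(1) A(1)] .
    have "P xs (as, A, b)" unfolding P_def using A b sm by auto
    then show ?thesis by blast
  qed
  obtain f where f: "\<And>i. P (map f [0..<i]) (f i)" using history_choice[of P] step by metis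
  define as where "as i = fst (f i)" for i
  define A where "A i = fst (snd (f i))" for i
  define b where "b i = snd (snd (f i))" for i
  define Z where "Z i = last_set (map f [0..<i])" for i
  have ZS: "Z (Suc i) = A i \<union> set (b i)" for i by (simp add: Z_def last_set_def A_def b_def)
  have props: "Z i \<subseteq> A i" "defined_by (U i) (A i) (as i)"
    "\<And>l. l < length (as i) \<Longrightarrow> realizes n (U i) (Z i) (as i ! l)" "realizes m (W i) (A i) (b i)" "C \<subseteq> A i" for i
    using f[of i] by (simp_all add: P_def Z_def A_def as_def b_def)
  have Zmono: "i \<le> j \<Longrightarrow> Z i \<subseteq> Z j" for i j
    using lift_Suc_mono_le[of Z i j] ZS props(1) by blast
  have CZ: "C \<subseteq> Z i" for i using Zmono[of 0 i] by (simp add: Z_def last_set_def)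
  have AZ: "A i \<union> set (b i) \<subseteq> Z j" if "i < j" for i j using Zmono[of "Suc i" j] ZS that by simp
  have bw: "wd m K (A i) (b i)" for i using realizes_wd[OF W props(4)] .
  have bl: "length (b i) = m" for i using bw by (simp add: wd_def)
  have alt': "Xs (b t) \<in> U i \<longleftrightarrow> i \<le> t" for i t
    by (rule alt) (rule realizes_mono[OF props(4,5)], rule wd_mono[OF bw props(5)])
  have N: "length (as i) = 2 * k + 1" for i using props(2)[of i] by (simp add: defined_by_def)
  have asl: "set (as i ! l) \<subseteq> A i" if "l < 2 * k + 1" for i l
    using props(2)[of i] that by (simp add: defined_by_def)
  \<comment> \<open>An entry inserted after \<open>b t\<close> realizes \<open>U i\<close> over it,
    so all positions answer correctly.\<close>
  have after: "\<not> F (as i ! l) (b t)" if "t < i" "l < 2 * k + 1" for i t l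
  proof -
    have "F (as i ! l) (b t) \<longleftrightarrow> Xs (b t) \<in> U i"
      by (rule realizes_F[OF U(1) props(3) bl]) (use N AZ that in auto)
    then show ?thesis using alt' that by simp
  qed
  have before: "\<exists>l<2 * k + 1. F (as i ! l) (b t)" if it: "i < t" for i t
  proof (rule ccontr)
    assume n: "\<not> ?thesis"
    have "wd m K (A i) (b t)" by (rule wd_mono[OF bw]) (use AZ[OF it] props(1) in blast)
    then have "b t \<in> majority (as i)" using defined_by_iff[OF props(2)] alt'[of t i] it by simp
    then have "{l. l < length (as i) \<and> F (as i ! l) (b t)} \<noteq> {}" unfolding majority_def by force
    then show False using n N by auto
  qed
  \<comment> \<open>The color of \<open>i < t\<close> is a position at which the sequence of stage
    \<open>i\<close> answers positively on \<open>b t\<close>. The majority guarantees some such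
    position, but it may vary with \<open>t\<close>, and Ramsey's theorem makes it constant.\<close>
  define col where "col X = (SOME l. l < 2 * k + 1 \<and> F (as (Min X) ! l) (b (Max X)))" for X :: "nat set"
  have col: "col {i, t} < 2 * k + 1" "F (as i ! col {i, t}) (b t)" if "i < t" for i t
  proof -
    have "col {i, t} < 2 * k + 1 \<and> F (as (Min {i, t}) ! col {i, t}) (b (Max {i, t}))"
      unfolding col_def by (rule someI_ex) (use before[OF that] that in auto)
    then show "col {i, t} < 2 * k + 1" "F (as i ! col {i, t}) (b t)" using that by auto
  qed
  have "\<forall>i\<in>UNIV. \<forall>t\<in>UNIV. i \<noteq> t \<longrightarrow> col {i, t} < 2 * k + 1"
  proof (intro ballI impI)
    fix i t :: nat assume "i \<noteq> t"
    then show "col {i, t} < 2 * k + 1" using col(1)[of i t] col(1)[of t i] by (metis insert_commute nat_neq_iff)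
  qed
  from Ramsey2[OF infinite_UNIV_nat this]
  obtain H l where H: "infinite H" "l < 2 * k + 1" "\<forall>i\<in>H. \<forall>t\<in>H. i \<noteq> t \<longrightarrow> col {i, t} = l"
    by (elim exE conjE)
  define h where "h = enumerate H"
  have hmono: "i < j \<Longrightarrow> h i < h j" for i j unfolding h_def by (rule enumerate_mono[OF _ H(1)])
  have hH: "h i \<in> H" for i unfolding h_def by (rule enumerate_in_set[OF H(1)])
  have hF: "F (as (h i) ! l) (b (h j))" if "i < j" for i j
    using col(2)[OF hmono[OF that]] H(3) hH hmono[OF that] by (metis less_irrefl)
  show False
  \<comment> \<open>The positive answers concern strictly later stages only. Entries at even places
    and \<open>b\<close> at odd places of the homogeneous set turn the strict inequality into
    \<open>i \<le> j\<close>.\<close>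
  proof (rule ladder1[of "\<lambda>i. Z (h (2 * i))" "\<lambda>i. as (h (2 * i)) ! l" "\<lambda>i. b (h (2 * i + 1))"])
    fix i :: nat
    show "M \<subseteq> Z (h (2 * i))" using CZ C(2) by blast
    show "wd n J (Z (h (2 * i))) (as (h (2 * i)) ! l)"
      by (rule realizes_wd[OF U props(3)]) (use N H(2) in simp)
    show "wd m K (Z (h (2 * i)) \<union> set (as (h (2 * i)) ! l)) (b (h (2 * i + 1)))"
    proof (rule wd_mono[OF bw])
      have "Z (h (2 * i)) \<union> set (as (h (2 * i)) ! l) \<subseteq> A (h (2 * i))" using props(1) asl[OF H(2)] by blast
      also have "\<dots> \<subseteq> Z (h (2 * i + 1))" using AZ[of "h (2 * i)" "h (2 * i + 1)"] hmono by auto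
      finally show "Z (h (2 * i)) \<union> set (as (h (2 * i)) ! l) \<subseteq> A (h (2 * i + 1))" using props(1) by blast
    qed
  next
    fix i j :: nat assume ij: "i < j"
    show "set (as (h (2 * i)) ! l) \<union> set (b (h (2 * i + 1))) \<subseteq> Z (h (2 * j))"
      using AZ[of "h (2 * i)" "h (2 * j)"] AZ[of "h (2 * i + 1)" "h (2 * j)"] asl[OF H(2), of "h (2 * i)"] hmono ij
      by auto
  next
    fix i j :: nat
    show "F (as (h (2 * i)) ! l) (b (h (2 * j + 1))) \<longleftrightarrow> i \<le> j"
    proof (cases "i \<le> j")
      case True
      then show ?thesis using hF[of "2 * i" "2 * j + 1"] by simp
    next
      case False
      then show ?thesis using after[OF hmono H(2), of "2 * j + 1" "2 * i"] by simp
    qed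
  qed
qed

text \<open>The fibers over the \<open>D i\<close> are the majority sets of conjugates of
  \<open>U\<close>. If two of them differed by a wide set, S1 would make every threshold pattern
  along \<open>D\<close> wide, and types extending these patterns would alternate.\<close>

lemma indiscernible_definitions_agree:
  assumes U: "ultra n U" "U \<inter> J = {}" and A: "small A" "M \<subseteq> A" and d: "defined_by U A as"
    and Y: "Y \<in> DS {} (m + length e)" "majority as = fib m Y e" and e: "set e \<subseteq> A" "concat as = e"
    and D: "indiscernible L S M D" and g: "g \<in> Aut M" "map g e = D 0" and pq: "{p, q} = {0, 1 :: nat}"
  shows "fib m Y (D p) - fib m Y (D q) \<in> K"
proof (rule ccontr)
  assume notK: "fib m Y (D p) - fib m Y (D q) \<notin> K"
  let ?l = "length e"
  have ex: "\<exists>h\<in>Aut M. map h (D 0) = D i" for i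
  proof -
    have "equiv_over L S M (concat (map D [0])) (concat (map D [i]))"
      using D[unfolded indiscernible_def, rule_format, of "[0]" "[i]"] by simp
    then show ?thesis using homogeneity[OF small_M] by simp metis
  qed
  have "\<exists>h\<in>Aut M. map h e = D i" for i
  proof -
    obtain h where "h \<in> Aut M" "map h (D 0) = D i" using ex by blast
    then show ?thesis using g Aut_comp[of h M g] by (intro bexI[of _ "h \<circ> g"]) (simp_all flip: map_map)
  qed
  then obtain G where G: "\<And>i. G i \<in> Aut M" "\<And>i. map (G i) e = D i" by metis
  have Dl: "length (D i) = ?l" for i using G(2)[of i] by (metis length_map)
  have fibDS: "fib m Y (D i) \<in> DS (set (D i)) m" for i using fib_DS[OF Y(1) Dl] by simp
  define pat where "pat N t = {b \<in> tup m. \<forall>i<t. b \<in> fib m Y (D i) \<longleftrightarrow> i \<le> N}" for N t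
  have pat_notin: "pat N t \<notin> K" for N t
  proof -
    obtain Y1 where Y1: "Y1 \<in> DS {} (m + (?l + ?l))"
       "\<And>a u v. length a = m \<Longrightarrow> length u = ?l \<Longrightarrow> length v = ?l \<Longrightarrow> a @ u @ v \<in> Y1 \<longleftrightarrow> a @ u \<in> Y"
      using DS_weaken[OF Y(1), of ?l] by metis
    obtain Y2 where Y2: "Y2 \<in> DS {} (m + (?l + ?l))"
       "\<And>a u v. length a = m \<Longrightarrow> length u = ?l \<Longrightarrow> length v = ?l \<Longrightarrow> a @ u @ v \<in> Y2 \<longleftrightarrow> a @ v \<in> Y"
      using DS_skip[OF Y(1), of ?l] by metis
    define E where "E = (if p = 0 then Y1 - Y2 else Y2 - Y1)"
    have E: "E \<in> DS {} (m + (?l + ?l))" unfolding E_def using Y1(1) Y2(1) by auto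
    define c where "c i = D (2 * i) @ D (2 * i + 1)" for i
    have p01: "p = 0 \<and> q = 1 \<or> p = 1 \<and> q = 0" using pq by (metis doubleton_eq_iff)
    have fibE: "fib m E (c i) = fib m Y (D (2 * i + p)) - fib m Y (D (2 * i + q))" for i
      using p01 Y1(2) Y2(2) Dl by (auto simp: E_def c_def fib_def)
    have ind: "indiscernible L S M c" unfolding c_def by (rule indiscernible_pairs[OF D])
    \<comment> \<open>In each pair \<open>D (2 * i)\<close>, \<open>D (2 * i + 1)\<close> a point of
      the wide difference lies in the fiber with offset \<open>p\<close> and outside the one with
      offset \<open>q\<close>. The map \<open>r\<close> picks the offset that the threshold pattern
      asks for, and indiscernibility carries the pattern back to
      \<open>0, 1, 2, ...\<close>.\<close>
    define r where "r i = (if i \<le> N then 2 * i + p else 2 * i + q)" for i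
    have rmono: "i < j \<Longrightarrow> r i < r j" for i j using p01 by (auto simp: r_def)
    define X where "X = {b \<in> tup m. \<forall>i<t. b \<in> fib m Y (D (r i)) \<longleftrightarrow> i \<le> N}"
    have XK: "X \<notin> K"
    proof (rule S1_conj[OF S1_K small_M ind, of "?l + ?l" E X t])
      show "E \<in> DS M (m + (?l + ?l))" using E by (rule DS_mono) simp
      show "fib m E (c 0) \<notin> K" unfolding fibE using notK by simp
      have "X = tup m \<inter> \<Inter>((\<lambda>i. if i \<le> N then fib m Y (D (r i)) else tup m - fib m Y (D (r i))) ` {..<t})"
        unfolding X_def by (rule pattern_eq)
      also have "\<dots> \<in> DS UNIV m"
      proof (rule DS_INT)
        show "(\<lambda>i. if i \<le> N then fib m Y (D (r i)) else tup m - fib m Y (D (r i))) ` {..<t} \<subseteq> DS UNIV m"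
        proof (rule image_subsetI)
          fix i
          have "fib m Y (D (r i)) \<in> DS UNIV m" using DS_UNIV[OF fibDS] .
          then show "(if i \<le> N then fib m Y (D (r i)) else tup m - fib m Y (D (r i))) \<in> DS UNIV m"
            using DS_compl by simp
        qed
      qed simp
      finally show "X \<in> DS UNIV m" .
      show "(\<Inter>i<t. fib m E (c i)) \<inter> tup m \<subseteq> X" unfolding fibE X_def r_def by auto
    qed (simp add: c_def Dl)
    have s0: "sorted_wrt (<) [0..<t]" and s1: "sorted_wrt (<) (map r [0..<t])" and sl: "length [0..<t] = length (map r [0..<t])"
      using rmono by (simp_all add: sorted_wrt_iff_nth_less)
    obtain h where h: "h \<in> Aut M" "map (\<lambda>i. map h (D i)) [0..<t] = map D (map r [0..<t])"
      using indiscernible_autD[OF small_M D Dl s0 s1 sl] .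
    have hD: "map h (D i) = D (r i)" if "i < t" for i
      using arg_cong[OF h(2), of "\<lambda>xs. xs ! i"] that by simp
    have "map h ` pat N t = X"
    proof (rule set_eqI)
      fix b
      have "map (inv h) b \<in> fib m Y (D i) \<longleftrightarrow> b \<in> fib m Y (D (r i))" if "i < t" for i
        using Aut_image_iff[OF h(1), of b "fib m Y (D i)"] Aut_fib[OF Aut_empty[OF h(1)] Y(1) Dl[of i]] hD[OF that]
        by simp
      then show "b \<in> map h ` pat N t \<longleftrightarrow> b \<in> X" unfolding Aut_image_iff[OF h(1)] X_def pat_def by simp
    qed
    then show ?thesis using XK S1_Aut[OF S1_K h(1), of "pat N t"] by auto
  qed
  have "\<exists>W. ultra m W \<and> W \<inter> K = {} \<and> (\<forall>i. fib m Y (D i) \<in> W \<longleftrightarrow> i \<le> N)" for N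
  proof -
    define H where "H i = (if i \<le> N then fib m Y (D i) else tup m - fib m Y (D i))" for i
    have HDS: "range H \<subseteq> DS UNIV m"
    proof (rule image_subsetI)
      fix i
      have "fib m Y (D i) \<in> DS UNIV m" using DS_UNIV[OF fibDS] .
      then show "H i \<in> DS UNIV m" unfolding H_def using DS_compl by simp
    qed
    moreover have "tup m \<inter> \<Inter>G0 \<notin> K" if G0: "finite G0" "G0 \<subseteq> range H" for G0
    proof
      assume in_K: "tup m \<inter> \<Inter>G0 \<in> K"
      obtain I where I: "finite I" "G0 = H ` I" using finite_subset_image[OF G0] by blast
      obtain t where t: "I \<subseteq> {..<t}" using I(1) finite_nat_iff_bounded by blast
      have patH: "pat N t = tup m \<inter> \<Inter>(H ` {..<t})" unfolding pat_def H_def by (rule pattern_eq)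
      have "pat N t \<subseteq> tup m \<inter> \<Inter>G0" using t unfolding I(2) patH by blast
      moreover have "H ` {..<t} \<subseteq> DS UNIV m" using HDS by blast
      then have "pat N t \<in> DS UNIV m" unfolding patH by (intro DS_INT) simp_all
      ultimately have "pat N t \<in> K" using def_ideal_down[OF S1_ideal[OF S1_K] in_K] by blast
      then show False using pat_notin by simp
    qed
    ultimately obtain W where W: "ultra m W" "range H \<subseteq> W" "W \<inter> K = {}"
      using ultra_exists[OF S1_ideal[OF S1_K]] by metis
    have "fib m Y (D i) \<in> W \<longleftrightarrow> i \<le> N" for i
    proof -
      have "H i \<in> W" using W(2) by blast
      then show ?thesis using ultra_compl[OF W(1) fibDS[of i]] by (auto simp: H_def split: if_splits)
    qed
    then show ?thesis using W by blast
  qed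
  then obtain W where W: "\<And>N. ultra m (W N)" "\<And>N. W N \<inter> K = {}"
    "\<And>N i. fib m Y (D i) \<in> W N \<longleftrightarrow> i \<le> N" by metis
  \<comment> \<open>Over the parameters of all the conjugates at once, each majority set decides
    membership in its own conjugate type.\<close>
  define C where "C = A \<union> (\<Union>i. G i ` A)"
  show False
  proof (rule no_alternating_types[of "\<lambda>i. (`) (map (G i)) ` U" W C])
    show "ultra n ((`) (map (G i)) ` U)" for i by (rule ultra_image[OF Aut_empty[OF G(1)] U(1)])
    show "(`) (map (G i)) ` U \<inter> J = {}" for i using U(2) S1_Aut_iff[OF S1_J G(1)] by blast
    show "ultra m (W i)" "W i \<inter> K = {}" for i by (rule W)+
    have "small (\<Union>i. G i ` A)" by (rule small_UN[OF A(1)]) (rule card_of_image)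
    then show "small C" unfolding C_def using A(1) small_Un by blast
    show "M \<subseteq> C" using A(2) by (auto simp: C_def)
    fix i t b assume b: "realizes m (W t) C b" "wd m K C b"
    have GA: "G i ` A \<subseteq> C" by (auto simp: C_def)
    have "Xs b \<in> (`) (map (G i)) ` U \<longleftrightarrow> b \<in> majority (map (map (G i)) as)"
      using defined_by_iff[OF defined_by_image[OF Aut_empty[OF G(1)] d] wd_mono[OF b(2) GA]] by simp
    also have "majority (map (map (G i)) as) = map (G i) ` majority as"
      by (rule majority_image[OF Aut_empty[OF G(1)]]) (use d in \<open>simp add: defined_by_def\<close>)
    also have "\<dots> = fib m Y (D i)" unfolding Y(2) using Aut_fib[OF Aut_empty[OF G(1)] Y(1) refl, of i] G(2) by simp
    also have "b \<in> \<dots> \<longleftrightarrow> fib m Y (D i) \<in> W t"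
    proof (rule realizes_iff[OF W(1) b(1)])
      have "set (D i) \<subseteq> G i ` A" using e(1) G(2)[of i] by (metis image_mono set_map)
      then show "fib m Y (D i) \<in> DS C m" using DS_mono[OF fibDS[of i], of C] GA by blast
    qed
    also have "\<dots> \<longleftrightarrow> i \<le> t" by (rule W(3))
    finally show "Xs b \<in> (`) (map (G i)) ` U \<longleftrightarrow> i \<le> t" .
  qed
qed

text \<open>The parameters \<open>e\<close> and their conjugate under \<open>h\<close> need not
  begin a common indiscernible sequence. Each of them begins one with a realization \<open>f\<close>
  of the coheir taken over both, so both fibers agree with the fiber over \<open>f\<close> modulo
  \<open>K\<close>.\<close>

lemma majority_invariant:
  assumes U: "ultra n U" "U \<inter> J = {}" and A: "small A" "M \<subseteq> A" and d: "defined_by U A as"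
    and h: "h \<in> Aut M" and W: "ultra m W" "W \<inter> K = {}"
  shows "map h ` majority as \<in> W \<longleftrightarrow> majority as \<in> W"
proof -
  define e where "e = concat as"
  have das: "\<And>l. l < length as \<Longrightarrow> length (as ! l) = n \<and> set (as ! l) \<subseteq> A" using d by (simp add: defined_by_def)
  have eA: "set e \<subseteq> A"
  proof
    fix x assume "x \<in> set e"
    then obtain u where "u \<in> set as" "x \<in> set u" by (auto simp: e_def)
    then show "x \<in> A" using das by (metis in_set_conv_nth subsetD)
  qed
  have "majority as \<in> DS ({} \<union> set e) m"
  proof (rule majority_DS)
    fix l assume "l < length as"
    then have "as ! l \<in> set as" and l: "length (as ! l) = n" using das by auto
    then have "set (as ! l) \<subseteq> set e" unfolding e_def by auto
    then show "length (as ! l) = n \<and> set (as ! l) \<subseteq> {} \<union> set e" using l by simp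
  qed
  from DS_fiber_ex[OF this]
  obtain Y where Y: "Y \<in> DS {} (m + length e)" "majority as = fib m Y e"
    unfolding fib_def by (elim bexE)
  obtain V where V: "ultra (length e) V" "realizes (length e) V M e" "invariant_type M V"
    using coheir[OF mdl_M refl] .
  have "realizes (length e) V M (map h e)"
    unfolding realizes_def
  proof (intro conjI ballI)
    fix X assume X: "X \<in> V \<inter> DS M (length e)"
    then have "e \<in> X" using realizesD[OF V(2)] by blast
    then show "map h e \<in> X" using Aut_DS[OF h, of X] X by blast
  qed simp
  have "small (M \<union> set e \<union> set (map h e))" by (intro small_set small_M)
  then obtain f where f: "realizes (length e) V (M \<union> set e \<union> set (map h e)) f" by (rule realizes_exists[OF V(1)])
  have key: "fib m Y (map g e) \<in> W \<longleftrightarrow> fib m Y f \<in> W"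
    if g: "g \<in> Aut M" "realizes (length e) V M (map g e)" "set (map g e) \<subseteq> set e \<union> set (map h e)" for g
  proof -
    have f': "realizes (length e) V (M \<union> set (map g e)) f" by (rule realizes_mono[OF f]) (use g(3) in blast)
    obtain D where ind: "indiscernible L S M D" and D: "\<And>i. realizes (length e) V M (D i)"
      and D01: "D 0 = map g e" "D 1 = f"
      by (rule morley_pair[OF V(1,3) small_M g(2) f']) (rule that)
    have agree: "fib m Y (D p) - fib m Y (D q) \<in> K" if "{p, q} = {0, 1}" for p q
      by (rule indiscernible_definitions_agree[OF U A d Y eA _ ind g(1) D01(1)[symmetric] that]) (simp add: e_def)
    have fD: "fib m Y (D i) \<in> DS UNIV m" for i
      using DS_UNIV[OF fib_DS[OF Y(1) realizes_length[OF D]]] .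
    have imp: "fib m Y (D q) \<in> W" if "fib m Y (D p) \<in> W" "{p, q} = {0, 1}" for p q
    proof (rule ccontr)
      assume "fib m Y (D q) \<notin> W"
      then have "fib m Y (D p) \<inter> (tup m - fib m Y (D q)) \<in> W"
        using ultra_Int[OF W(1) that(1)] ultra_compl[OF W(1) fD] by simp
      moreover have "fib m Y (D p) \<inter> (tup m - fib m Y (D q)) = fib m Y (D p) - fib m Y (D q)" by auto
      ultimately show False using W(2) agree[OF that(2)] by auto
    qed
    show ?thesis using imp[of 0 1] imp[of 1 0] D01 by auto
  qed
  have "id \<in> Aut M" by (auto simp: Aut_def automorphism_def)
  then have "fib m Y e \<in> W \<longleftrightarrow> fib m Y f \<in> W" using key[of id] V(2) by simp
  moreover have "fib m Y (map h e) \<in> W \<longleftrightarrow> fib m Y f \<in> W"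
    by (rule key[OF h]) (use \<open>realizes (length e) V M (map h e)\<close> in auto)
  moreover have "map h ` majority as = fib m Y (map h e)"
    unfolding Y(2) by (rule Aut_fib[OF Aut_empty[OF h] Y(1) refl])
  ultimately show ?thesis using Y(2) by simp
qed

section \<open>Definability over the model\<close>

definition Es :: "bool \<Rightarrow> 'm list \<Rightarrow> 'm list set" where
  "Es \<epsilon> c = {a \<in> tup n. F a c = \<epsilon>}"

lemma Es_DS: "length c = m \<Longrightarrow> set c \<subseteq> A \<Longrightarrow> Es \<epsilon> c \<in> DS A n"
proof -
  assume c: "length c = m" "set c \<subseteq> A"
  have "Es \<epsilon> c = (if \<epsilon> then Xs c else tup n - Xs c)" by (auto simp: Es_def Xs_def)
  then show ?thesis using Xs_DS[OF c] DS_compl by simp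
qed

lemma Es_ultra: "ultra n V \<Longrightarrow> length c = m \<Longrightarrow> Es \<epsilon> c \<in> V \<longleftrightarrow> (Xs c \<in> V \<longleftrightarrow> \<epsilon>)"
proof -
  assume V: "ultra n V" and c: "length c = m"
  have "Es \<epsilon> c = (if \<epsilon> then Xs c else tup n - Xs c)" by (auto simp: Es_def Xs_def)
  then show ?thesis using ultra_compl[OF V Xs_DS[OF c subset_refl]] by simp
qed

text \<open>A finite part of the \<open>N\<close>-type of \<open>V\<close> is a single set
  \<open>\<theta>\<close>, and amalgamation is applied to \<open>\<theta>\<close> together with the
  condition \<open>F(x, y) = \<epsilon>\<close>, as one set definable over \<open>N\<close>.
  Compactness assembles the wide intersections into \<open>V'\<close>.\<close>

lemma extend_type:
  assumes N: "small N" "mdl N" and V: "ultra n V" "V \<inter> J = {}" and c: "length c = m" "Es \<epsilon> c \<in> V"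
    and cc': "equiv_over L S N c c'" and c': "wd m K (N \<union> set c) c'"
  obtains V' where "ultra n V'" "V' \<inter> J = {}" "V \<inter> DS N n \<subseteq> V'" "Es \<epsilon> c \<in> V'" "Es \<epsilon> c' \<in> V'"
proof -
  have cl': "length c' = m" using c' by (simp add: wd_def)
  have amalg: "\<theta> \<inter> Es \<epsilon> c \<inter> Es \<epsilon> c' \<notin> J" if \<theta>: "\<theta> \<in> V \<inter> DS N n" for \<theta>
  proof -
    define FS where "FS = {w \<in> tup (n + m). F (take n w) (drop n w)}"
    have FS: "FS \<in> DS N (n + m)" unfolding FS_def using F_DS by (rule DS_mono) simp
    \<comment> \<open>With an empty middle block, weakening adds \<open>m\<close> dummy variables to
      \<open>\<theta>\<close>.\<close>
    have "\<theta> \<in> DS N (n + 0)" using \<theta> by simp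
    then obtain T where T: "T \<in> DS N (n + (0 + m))"
      "\<And>a u v. length a = n \<Longrightarrow> length u = 0 \<Longrightarrow> length v = m \<Longrightarrow> a @ u @ v \<in> T \<longleftrightarrow> a @ u \<in> \<theta>"
      using DS_weaken[of \<theta> N n 0 m] by metis
    define Y where "Y = (if \<epsilon> then T \<inter> FS else T - FS)"
    have Y: "Y \<in> DS N (n + m)" unfolding Y_def using T(1) FS by auto
    have fibY: "fib n Y u = \<theta> \<inter> Es \<epsilon> u" if "length u = m" for u
      using T(2)[of _ "[]" u] that DS_tup[of \<theta> N n] \<theta> by (auto simp: fib_def Y_def Es_def FS_def)
    have "fib n Y c \<notin> J"
      unfolding fibY[OF c(1)] using ultra_Int[OF V(1)] \<theta> c(2) V(2) by blast
    then have "fib n Y c \<inter> fib n Y c' \<notin> J" by (rule wide_amalgamation[OF S1_J S1_K N Y c(1) cc' c'])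
    moreover have "fib n Y c \<inter> fib n Y c' = \<theta> \<inter> Es \<epsilon> c \<inter> Es \<epsilon> c'" unfolding fibY[OF c(1)] fibY[OF cl'] by blast
    ultimately show ?thesis by simp
  qed
  define G where "G = V \<inter> DS N n \<union> {Es \<epsilon> c, Es \<epsilon> c'}"
  have EDS: "Es \<epsilon> c \<in> DS UNIV n" "Es \<epsilon> c' \<in> DS UNIV n" using Es_DS c(1) cl' by simp_all
  have "V \<inter> DS N n \<subseteq> DS UNIV n" using DS_UNIV by blast
  then have GDS: "G \<subseteq> DS UNIV n" unfolding G_def using EDS by simp
  have "tup n \<inter> \<Inter>G0 \<notin> J" if G0: "finite G0" "G0 \<subseteq> G" for G0
  proof
    assume in_J: "tup n \<inter> \<Inter>G0 \<in> J"
    define \<theta> where "\<theta> = tup n \<inter> \<Inter>(G0 - {Es \<epsilon> c, Es \<epsilon> c'})"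
    have fin: "finite (G0 - {Es \<epsilon> c, Es \<epsilon> c'})" and sub: "G0 - {Es \<epsilon> c, Es \<epsilon> c'} \<subseteq> V \<inter> DS N n"
      using G0 by (auto simp: G_def)
    have \<theta>: "\<theta> \<in> V \<inter> DS N n"
      unfolding \<theta>_def using ultra_INT[OF V(1) fin] DS_INT[OF fin, of N n] sub by blast
    have "\<theta> \<inter> Es \<epsilon> c \<inter> Es \<epsilon> c' \<in> DS UNIV n" using \<theta> DS_UNIV EDS DS_Int by blast
    moreover have "\<theta> \<inter> Es \<epsilon> c \<inter> Es \<epsilon> c' \<subseteq> tup n \<inter> \<Inter>G0" unfolding \<theta>_def by blast
    ultimately have "\<theta> \<inter> Es \<epsilon> c \<inter> Es \<epsilon> c' \<in> J" using def_ideal_down[OF S1_ideal[OF S1_J] in_J] by blast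
    then show False using amalg[OF \<theta>] by simp
  qed
  then obtain V' where "ultra n V'" "G \<subseteq> V'" "V' \<inter> J = {}" using ultra_exists[OF S1_ideal[OF S1_J] GDS] by metis
  then show ?thesis using that unfolding G_def by blast
qed

text \<open>
  The \<open>c\<^sub>i\<close> realize \<open>W\<close> over a growing chain of models \<open>N\<^sub>i\<close>, and \<open>a\<^sub>i\<close> realizes a type that, by amalgamation, extends the
  previous one over \<open>N\<^sub>i\<^sub>-\<^sub>1\<close> and contains \<open>F(x, c\<^sub>j) = \<epsilon>\<close> for all \<open>j \<le> i\<close>.
\<close>

lemma alternating_realizations:
  assumes W: "ultra m W" "W \<inter> K = {}" and U: "ultra n U" "U \<inter> J = {}"
    and M': "small M'" "mdl M'" and b: "realizes m W M' b" and \<Xi>: "\<Xi> \<in> DS M' n"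
    and \<epsilon>: "Es \<epsilon> b \<in> U"
  obtains N a c where "\<And>i. M' \<subseteq> N i" "\<And>i. N i \<union> set (c i) \<union> set (a i) \<subseteq> N (Suc i)"
    "\<And>i :: nat. realizes m W (N i) (c i)" "\<And>i. wd n J (N i \<union> set (c i)) (a i)"
    "\<And>i j. i \<le> j \<Longrightarrow> F (a j) (c i) = \<epsilon>" "\<And>i. a i \<in> \<Xi> \<longleftrightarrow> \<Xi> \<in> U"
proof -
  define P where "P s \<longleftrightarrow> (case s of (N, c, V, a) \<Rightarrow> small N \<and> mdl N \<and> M' \<subseteq> N \<and> realizes m W N c \<and> ultra n V \<and>
     V \<inter> J = {} \<and> Es \<epsilon> c \<in> V \<and> (\<Xi> \<in> V \<longleftrightarrow> \<Xi> \<in> U) \<and> realizes n V (N \<union> set c) a)"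
    for s :: "'m set \<times> 'm list \<times> 'm list set set \<times> 'm list"
  define Q where "Q s s' \<longleftrightarrow> (case s of (N, c, V, a) \<Rightarrow> case s' of (N', c', V', a') \<Rightarrow>
     N \<union> set c \<union> set a \<subseteq> N' \<and> V \<inter> DS N n \<subseteq> V' \<and> Es \<epsilon> c \<in> V')"
    for s s' :: "'m set \<times> 'm list \<times> 'm list set set \<times> 'm list"
  have "\<exists>f. \<forall>i. P (f i) \<and> Q (f i) (f (Suc i))"
  proof (rule dependent_nat_choice)
    obtain a where "realizes n U (M' \<union> set b) a" using realizes_exists[OF U(1) small_set[OF M'(1)]] .
    then have "P (M', b, U, a)" unfolding P_def using M' b U \<epsilon> by simp
    then show "\<exists>s. P s" by blast
  next
    fix s and i :: nat assume s: "P s"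
    obtain N c V a where s_eq: "s = (N, c, V, a)" by (cases s)
    have N: "small N" "mdl N" "M' \<subseteq> N" and c: "realizes m W N c" and V: "ultra n V" "V \<inter> J = {}"
      and Ec: "Es \<epsilon> c \<in> V" and \<Xi>V: "\<Xi> \<in> V \<longleftrightarrow> \<Xi> \<in> U"
      using s unfolding P_def s_eq by simp_all
    have "small (N \<union> set c \<union> set a)" by (intro small_set N(1))
    then obtain N' where N': "N \<union> set c \<union> set a \<subseteq> N'" "small N'" "mdl N'" by (rule small_model_exists)
    obtain c' where c': "realizes m W N' c'" using realizes_exists[OF W(1) N'(2)] .
    have c'N: "realizes m W N c'" by (rule realizes_mono[OF c']) (use N'(1) in blast)
    have "wd m K (N \<union> set c) c'"
      by (rule wd_mono[OF realizes_wd[OF W c']]) (use N'(1) in blast)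
    then obtain V' where V': "ultra n V'" "V' \<inter> J = {}" "V \<inter> DS N n \<subseteq> V'" "Es \<epsilon> c \<in> V'" "Es \<epsilon> c' \<in> V'"
      using extend_type[OF N(1,2) V realizes_length[OF c] Ec realizes_equiv[OF W(1) c c'N]] by metis
    have \<Xi>N: "\<Xi> \<in> DS N n" using \<Xi> N(3) by (rule DS_mono)
    have "\<Xi> \<in> V' \<longleftrightarrow> \<Xi> \<in> V"
    proof
      assume "\<Xi> \<in> V'"
      show "\<Xi> \<in> V"
      proof (rule ccontr)
        assume "\<Xi> \<notin> V"
        then have "tup n - \<Xi> \<in> V \<inter> DS N n" using ultra_compl[OF V(1) \<Xi>N] DS_compl[OF \<Xi>N] by simp
        then have "tup n - \<Xi> \<in> V'" using V'(3) by blast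
        then show False using ultra_compl[OF V'(1) \<Xi>N] \<open>\<Xi> \<in> V'\<close> by simp
      qed
    qed (use V'(3) \<Xi>N in blast)
    moreover obtain a' where "realizes n V' (N' \<union> set c') a'"
      using realizes_exists[OF V'(1) small_set[OF N'(2)]] .
    ultimately have "P (N', c', V', a')" unfolding P_def using N' N(3) c' V' \<Xi>V by auto
    moreover have "Q s (N', c', V', a')" unfolding Q_def s_eq using N'(1) V'(3,4) by simp
    ultimately show "\<exists>s'. P s' \<and> Q s s'" by blast
  qed
  then obtain f where f: "\<And>i. P (f i)" "\<And>i. Q (f i) (f (Suc i))" by blast
  define N where "N i = fst (f i)" for i
  define c where "c i = fst (snd (f i))" for i
  define V where "V i = fst (snd (snd (f i)))" for i
  define a where "a i = snd (snd (snd (f i)))" for i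
  have f_eq: "f i = (N i, c i, V i, a i)" for i by (simp add: N_def c_def V_def a_def)
  have props: "M' \<subseteq> N i" "realizes m W (N i) (c i)" "ultra n (V i)" "V i \<inter> J = {}" "Es \<epsilon> (c i) \<in> V i"
    "\<Xi> \<in> V i \<longleftrightarrow> \<Xi> \<in> U" "realizes n (V i) (N i \<union> set (c i)) (a i)" for i
    using f(1)[of i] unfolding f_eq P_def by simp_all
  have steps: "N i \<union> set (c i) \<union> set (a i) \<subseteq> N (Suc i)" "V i \<inter> DS (N i) n \<subseteq> V (Suc i)" "Es \<epsilon> (c i) \<in> V (Suc i)" for i
    using f(2)[of i] unfolding f_eq Q_def by simp_all
  have Nmono: "i \<le> j \<Longrightarrow> N i \<subseteq> N j" for i j using lift_Suc_mono_le[of N] steps(1) by blast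
  have cl: "length (c i) = m" for i using props(2) by (rule realizes_length)
  \<comment> \<open>Amalgamation hands the condition on \<open>c i\<close> to the next type
    explicitly. From then on \<open>c i\<close> lies in the model, so the condition is part of the
    inherited type over that model.\<close>
  have EV: "Es \<epsilon> (c i) \<in> V j" if "i \<le> j" for i j
    using that
  proof (induction j rule: dec_induct)
    case (step j)
    show ?case
    proof (cases "i = j")
      case False
      then have "set (c i) \<subseteq> N j" using steps(1)[of i] Nmono[of "Suc i" j] step(1) by auto
      then show ?thesis using steps(2)[of j] step(3) Es_DS[OF cl] by blast
    qed (use steps(3) in simp)
  qed (rule props(5))
  have aw: "wd n J (N i \<union> set (c i)) (a i)" for i by (rule realizes_wd[OF props(3,4,7)])
  have F_le: "F (a j) (c i) = \<epsilon>" if ij: "i \<le> j" for i j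
  proof -
    have "set (c i) \<subseteq> N j \<union> set (c j)"
    proof (cases "i = j")
      case False
      then show ?thesis using steps(1)[of i] Nmono[of "Suc i" j] ij by auto
    qed simp
    then have "a j \<in> Es \<epsilon> (c i)" using realizesD[OF props(7) EV[OF ij] Es_DS[OF cl]] by blast
    then show ?thesis by (simp add: Es_def)
  qed
  have a\<Xi>: "a i \<in> \<Xi> \<longleftrightarrow> \<Xi> \<in> U" for i
  proof -
    have "\<Xi> \<in> DS (N i \<union> set (c i)) n" by (rule DS_mono[OF \<Xi>]) (use props(1) in blast)
    then show ?thesis using realizes_iff[OF props(3,7)] props(6) by simp
  qed
  show ?thesis by (rule that[of N c a, OF props(1) steps(1) props(2) aw F_le a\<Xi>])
qed

text \<open>
  If the two memberships differ, \<open>b\<close> is moved to a realization of \<open>W\<close> over a model containing the parameters of \<open>\<Xi>\<close>,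
  which does not affect \<open>\<Xi> \<in> U\<close>. In the sequences of the previous lemma \<open>\<Xi>\<close> then forces \<open>F(a\<^sub>i, c\<^sub>j) \<noteq> \<epsilon>\<close> for
  \<open>j > i\<close>, which is a ladder.
\<close>

lemma membership_constant:
  assumes U: "ultra n U" "U \<inter> J = {}" and W: "ultra m W" "W \<inter> K = {}"
  obtains \<Xi> where "\<And>b. realizes m W M b \<Longrightarrow> Xs b \<in> U \<longleftrightarrow> \<Xi> \<in> U"
proof -
  \<comment> \<open>With the sorts exchanged, the majority set of \<open>W\<close> is a set of
    tuples in the sort of \<open>x\<close>, of which \<open>U\<close> can decide membership.\<close>
  interpret sw: stable_relation L S \<kappa> M m K n J "\<lambda>b a. F a b" k by (rule swap)
  obtain C cs where C: "small C" "M \<subseteq> C" and d: "sw.defined_by W C cs"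
    using sw.definition_exists[OF W small_M subset_refl] .
  define \<Xi> where "\<Xi> = sw.majority cs"
  have \<Xi>: "\<Xi> \<in> DS C n" unfolding \<Xi>_def by (rule sw.majority_DS) (use d in \<open>simp add: sw.defined_by_def\<close>)
  have "Xs b \<in> U \<longleftrightarrow> \<Xi> \<in> U" if b: "realizes m W M b" for b
  proof (rule ccontr)
    assume ne: "\<not> ?thesis"
    define \<epsilon> where "\<epsilon> \<longleftrightarrow> Xs b \<in> U"
    have bl: "length b = m" using b by (rule realizes_length)
    obtain M' where M': "C \<subseteq> M'" "small M'" "mdl M'" by (rule small_model_exists[OF C(1)])
    obtain b' where b': "realizes m W M' b'" using realizes_exists[OF W(1) M'(2)] .
    have "realizes m W M b'" by (rule realizes_mono[OF b']) (use C(2) M'(1) in blast)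
    then obtain \<tau> where \<tau>: "\<tau> \<in> Aut M" "map \<tau> b = b'"
      using homogeneity[OF small_M realizes_equiv[OF W(1) b]] by metis
    define U' where "U' = (`) (map \<tau>) ` U"
    have U': "ultra n U'" "U' \<inter> J = {}"
      unfolding U'_def using ultra_image[OF Aut_empty[OF \<tau>(1)] U(1)] U(2) S1_Aut_iff[OF S1_J \<tau>(1)] by blast+
    have "Xs b' \<in> U' \<longleftrightarrow> \<epsilon>"
      using image_type_iff[OF \<tau>(1), of "Xs b" U] Aut_Xs[OF \<tau>(1) bl] \<tau>(2) by (simp add: U'_def \<epsilon>_def)
    then have Eb: "Es \<epsilon> b' \<in> U'" using Es_ultra[OF U'(1)] \<tau>(2) bl by auto
    \<comment> \<open>Moving \<open>U\<close> by \<open>\<tau>\<close> amounts to moving \<Xi> by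
      its inverse. By invariance of majority sets in the exchanged sorts, \<open>U\<close> does not
      notice this.\<close>
    have "\<Xi> \<in> U' \<longleftrightarrow> map (inv \<tau>) ` \<Xi> \<in> U"
      using image_type_iff[OF \<tau>(1), of "map (inv \<tau>) ` \<Xi>" U] Aut_image_inv(1)[OF \<tau>(1), of \<Xi>] by (simp add: U'_def)
    also have "\<dots> \<longleftrightarrow> \<Xi> \<in> U"
      unfolding \<Xi>_def by (rule sw.majority_invariant[OF W C d Aut_inv[OF \<tau>(1)] U])
    finally have \<Xi>U': "\<Xi> \<in> U' \<longleftrightarrow> \<not> \<epsilon>" using ne by (simp add: \<epsilon>_def)
    obtain N a c where N: "\<And>i. M' \<subseteq> N i" "\<And>i. N i \<union> set (c i) \<union> set (a i) \<subseteq> N (Suc i)"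
      and c: "\<And>i :: nat. realizes m W (N i) (c i)" and a: "\<And>i. wd n J (N i \<union> set (c i)) (a i)"
      and F_le: "\<And>i j. i \<le> j \<Longrightarrow> F (a j) (c i) = \<epsilon>" and a\<Xi>: "\<And>i. a i \<in> \<Xi> \<longleftrightarrow> \<Xi> \<in> U'"
      by (rule alternating_realizations[OF W U' M'(2,3) b' DS_mono[OF \<Xi> M'(1)] Eb]) (rule that)
    have Nmono: "i \<le> j \<Longrightarrow> N i \<subseteq> N j" for i j using lift_Suc_mono_le[of N] N(2) by blast
    have NM: "M \<subseteq> N i" for i using N(1) M'(1) C(2) by blast
    have N_less: "set (c i) \<union> set (a i) \<subseteq> N j" if "i < j" for i j
      using N(2)[of i] Nmono[of "Suc i" j] that by auto
    have cw: "wd m K (N i) (c i)" for i using realizes_wd[OF W c] .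
    have F_gt: "F (a j) (c i) = (\<not> \<epsilon>)" if ij: "j < i" for i j
    proof -
      have al: "length (a j) = n" using a by (simp add: wd_def)
      \<comment> \<open>The tuple \<open>a j\<close> is wide over the parameters of \<Xi>, so \<Xi>
        predicts its relation to every later realization of \<open>W\<close>.\<close>
      have "wd n J C (a j)" by (rule wd_mono[OF a]) (use N(1) M'(1) in blast)
      then have "sw.Xs (a j) \<in> W \<longleftrightarrow> \<not> \<epsilon>" 
        using sw.defined_by_iff[OF d, of "a j"] a\<Xi>[of j] \<Xi>U' unfolding \<Xi>_def by blast
      moreover have "F (a j) (c i) \<longleftrightarrow> sw.Xs (a j) \<in> W"
        by (rule sw.realizes_F[OF W(1) c al]) (use N_less[OF ij] in simp)
      ultimately show ?thesis by simp
    qed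
    show False
    proof (cases \<epsilon>)
      case True
      show False
      proof (rule ladder2[of N c a])
        show "set (a i) \<union> set (c i) \<subseteq> N j" if "i < j" for i j using N_less[OF that] by simp
        show "F (a i) (c j) \<longleftrightarrow> j \<le> i" for i j
          using F_le[of j i] F_gt[of i j] True by (cases "j \<le> i") auto
      qed (use NM cw a in simp_all)
    next
      case False
      show False
      \<comment> \<open>With \<open>\<epsilon>\<close> false, \<open>F\<close> holds exactly for
        strictly later \<open>c\<close>. Shifting the index of \<open>c\<close> by one turns this
        into \<open>i \<le> j\<close>.\<close>
      proof (rule ladder1[of "\<lambda>i. N i \<union> set (c i)" a "\<lambda>i. c (Suc i)"])
        show "M \<subseteq> N i \<union> set (c i)" for i using NM by blast
        show "wd m K (N i \<union> set (c i) \<union> set (a i)) (c (Suc i))" for i by (rule wd_mono[OF cw N(2)])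
        show "set (a i) \<union> set (c (Suc i)) \<subseteq> N j \<union> set (c j)" if "i < j" for i j
        proof -
          have "set (c (Suc i)) \<subseteq> N j \<union> set (c j)"
            using N_less[of "Suc i" j] that by (cases "Suc i = j") auto
          then show ?thesis using N_less[OF that] by blast
        qed
        show "F (a i) (c (Suc j)) \<longleftrightarrow> i \<le> j" for i j
          using F_le[of "Suc j" i] F_gt[of i "Suc j"] False by (cases "i \<le> j") auto
      qed (rule a)
    qed
  qed
  then show ?thesis by (rule that)
qed

text \<open>The set \<Xi> belongs to \<open>W\<close>, which extends the common type of
  \<open>b\<close> and \<open>b'\<close>, and not to a particular realization.\<close>

lemma membership_invariant:
  assumes U: "ultra n U" "U \<inter> J = {}" and b: "wd m K M b" and eq: "equiv_over L S M b b'"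
  shows "Xs b \<in> U \<longleftrightarrow> Xs b' \<in> U"
proof -
  obtain W where W: "ultra m W" "W \<inter> K = {}" "realizes m W M b" using ultra_extends_type[OF S1_ideal[OF S1_K] b] .
  have "realizes m W M b'"
    unfolding realizes_def
    using equiv_overD[OF eq] realizesD[OF W(3)] equiv_over_length[OF eq] realizes_length[OF W(3)] by auto
  moreover obtain \<Xi> where "\<And>b. realizes m W M b \<Longrightarrow> Xs b \<in> U \<longleftrightarrow> \<Xi> \<in> U"
    using membership_constant[OF U W(1,2)] by metis
  ultimately show ?thesis using W(3) by simp
qed

text \<open>Were the set \<open>Bad\<close> compatible with the type of \<open>b\<close> over
  \<open>M\<close> in the wide sense, a realization over \<open>A\<close> of a common wide extension
  would be a conjugate of \<open>b\<close> on which \<open>U\<close> changes its answer.\<close>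

lemma locally_constant:
  assumes U: "ultra n U" "U \<inter> J = {}" and b: "wd m K M b"
  obtains \<eta> where "\<eta> \<in> DS M m" "b \<in> \<eta>" "\<And>b'. wd m K M b' \<Longrightarrow> b' \<in> \<eta> \<Longrightarrow> Xs b' \<in> U \<longleftrightarrow> Xs b \<in> U"
proof -
  have bl: "length b = m" using b by (simp add: wd_def)
  obtain A as where A: "small A" "M \<subseteq> A" and d: "defined_by U A as"
    using definition_exists[OF U small_M subset_refl] .
  have maj: "majority as \<in> DS A m" by (rule majority_DS) (use d in \<open>simp add: defined_by_def\<close>)
  \<comment> \<open>The tuples for which the majority predicts the opposite of the answer at
    \<open>b\<close>.\<close>
  define Bad where "Bad = (if Xs b \<in> U then tup m - majority as else majority as)"
  have Bad: "Bad \<in> DS A m" unfolding Bad_def using maj DS_compl by simp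
  have Bad_iff: "b' \<in> Bad \<longleftrightarrow> (Xs b' \<in> U \<longleftrightarrow> Xs b \<notin> U)" if "wd m K A b'" for b'
    using defined_by_iff[OF d that] that by (auto simp: Bad_def wd_def)
  have "\<exists>\<eta>\<in>DS M m. b \<in> \<eta> \<and> \<eta> \<inter> Bad \<in> K"
  proof (rule ccontr)
    assume n: "\<not> ?thesis"
    define G where "G = insert Bad {\<eta> \<in> DS M m. b \<in> \<eta>}"
    have "{\<eta> \<in> DS M m. b \<in> \<eta>} \<subseteq> DS UNIV m" using DS_UNIV by blast
    then have GDS: "G \<subseteq> DS UNIV m" unfolding G_def using DS_UNIV[OF Bad] by simp
    have "tup m \<inter> \<Inter>G0 \<notin> K" if G0: "finite G0" "G0 \<subseteq> G" for G0
    proof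
      assume in_K: "tup m \<inter> \<Inter>G0 \<in> K"
      define \<eta> where "\<eta> = tup m \<inter> \<Inter>(G0 - {Bad})"
      have "\<eta> \<in> DS M m" unfolding \<eta>_def by (rule DS_INT) (use G0 in \<open>auto simp: G_def\<close>)
      moreover have "b \<in> \<eta>" using G0(2) bl by (auto simp: \<eta>_def G_def)
      ultimately have "\<eta> \<inter> Bad \<notin> K" using n by blast
      moreover have "\<eta> \<inter> Bad \<in> DS UNIV m" using DS_UNIV[OF \<open>\<eta> \<in> DS M m\<close>] DS_UNIV[OF Bad] by (rule DS_Int)
      moreover have "\<eta> \<inter> Bad \<subseteq> tup m \<inter> \<Inter>G0" unfolding \<eta>_def by blast
      ultimately show False using def_ideal_down[OF S1_ideal[OF S1_K] in_K] by blast
    qed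
    then obtain W where W: "ultra m W" "G \<subseteq> W" "W \<inter> K = {}" using ultra_exists[OF S1_ideal[OF S1_K] GDS] by metis
    obtain b1 where b1: "realizes m W A b1" using realizes_exists[OF W(1) A(1)] .
    have "equiv_over L S M b b1"
    proof (rule equiv_overI[OF bl realizes_length[OF b1]])
      fix X assume X: "X \<in> DS M m" "b \<in> X"
      then have "X \<in> W" using W(2) by (auto simp: G_def)
      then show "b1 \<in> X" using realizesD[OF b1] DS_mono[OF X(1) A(2)] by blast
    qed
    then have "Xs b1 \<in> U \<longleftrightarrow> Xs b \<in> U" using membership_invariant[OF U b] by simp
    moreover have "b1 \<in> Bad" using realizesD[OF b1 _ Bad] W(2) by (auto simp: G_def)
    ultimately show False using Bad_iff[OF realizes_wd[OF W(1,3) b1]] by simp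
  qed
  then obtain \<eta> where \<eta>: "\<eta> \<in> DS M m" "b \<in> \<eta>" "\<eta> \<inter> Bad \<in> K" by blast
  have "Xs b' \<in> U \<longleftrightarrow> Xs b \<in> U" if b': "wd m K M b'" "b' \<in> \<eta>" for b'
  proof -
    \<comment> \<open>The majority says nothing about \<open>b'\<close>, which is wide over
      \<open>M\<close> only. It is replaced by a conjugate wide over \<open>A\<close>, for which
      \<open>U\<close> gives the same answer.\<close>
    obtain b2 where b2: "equiv_over L S M b' b2" "wd m K A b2" by (rule equiv_wd[OF S1_ideal[OF S1_K] b'(1) A])
    have "b2 \<in> \<eta>" by (rule equiv_overD[OF b2(1) \<eta>(1) b'(2)])
    moreover have "\<eta> \<inter> Bad \<in> DS A m" using DS_mono[OF \<eta>(1) A(2)] Bad by (rule DS_Int)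
    ultimately have "b2 \<notin> Bad" using b2(2) \<eta>(3) unfolding wd_def by blast
    then show ?thesis using Bad_iff[OF b2(2)] membership_invariant[OF U b'(1) b2(1)] by blast
  qed
  then show ?thesis using that \<eta> by blast
qed

text \<open>If the sets of constant answer did not cover all wide tuples finitely up to
  \<open>K\<close>, a wide type would omit all of them, and its realization over \<open>M\<close>
  would contradict local constancy.\<close>

lemma definable:
  assumes U: "ultra n U" "U \<inter> J = {}"
  obtains \<psi> where "\<psi> \<in> DS M m" "\<And>b. wd m K M b \<Longrightarrow> b \<in> \<psi> \<longleftrightarrow> Xs b \<in> U"
proof -
  define good where "good \<delta> \<eta> \<longleftrightarrow> (\<forall>b. wd m K M b \<and> b \<in> \<eta> \<longrightarrow> (Xs b \<in> U \<longleftrightarrow> \<delta>))" for \<delta> \<eta>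
  define \<H> where "\<H> = {\<eta> \<in> DS M m. good True \<eta> \<or> good False \<eta>}"
  define G where "G = (\<lambda>\<eta>. tup m - \<eta>) ` \<H>"
  have GDS: "G \<subseteq> DS UNIV m"
    unfolding G_def by (rule image_subsetI) (use DS_UNIV[OF DS_compl] in \<open>auto simp: \<H>_def\<close>)
  have "\<exists>G0. finite G0 \<and> G0 \<subseteq> G \<and> tup m \<inter> \<Inter>G0 \<in> K"
  proof (rule ccontr)
    assume "\<not> ?thesis"
    then obtain W where W: "ultra m W" "G \<subseteq> W" "W \<inter> K = {}" using ultra_exists[OF S1_ideal[OF S1_K] GDS] by metis
    obtain b where b: "realizes m W M b" using realizes_exists[OF W(1) small_M] .
    have bw: "wd m K M b" by (rule realizes_wd[OF W(1,3) b])
    obtain \<eta> where \<eta>: "\<eta> \<in> DS M m" "b \<in> \<eta>" "\<And>b'. wd m K M b' \<Longrightarrow> b' \<in> \<eta> \<Longrightarrow> Xs b' \<in> U \<longleftrightarrow> Xs b \<in> U"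
      using locally_constant[OF U bw] by metis
    then have "\<eta> \<in> \<H>" unfolding \<H>_def good_def by (cases "Xs b \<in> U") simp_all
    then have "tup m - \<eta> \<in> W" using W(2) unfolding G_def by blast
    then have "b \<in> tup m - \<eta>" using realizesD[OF b _ DS_compl[OF \<eta>(1)]] by blast
    then show False using \<eta>(2) by simp
  qed
  then obtain G0 where G0: "finite G0" "G0 \<subseteq> G" "tup m \<inter> \<Inter>G0 \<in> K" by blast
  obtain H where H: "H \<subseteq> \<H>" "finite H" "G0 = (\<lambda>\<eta>. tup m - \<eta>) ` H"
    using finite_subset_image[OF G0(1) G0(2)[unfolded G_def]] by blast
  show ?thesis
  proof (rule that)
    \<comment> \<open>A set that is good for both values contains no tuple wide over
      \<open>M\<close>, so including it does not affect the equivalence.\<close>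
    show "\<Union>{\<eta> \<in> H. good True \<eta>} \<in> DS M m" by (rule DS_UN) (use H in \<open>auto simp: \<H>_def\<close>)
    fix b assume b: "wd m K M b"
    have "tup m \<inter> \<Inter>G0 \<in> DS M m" unfolding H(3) by (rule DS_INT) (use H in \<open>auto simp: \<H>_def\<close>)
    then have "b \<notin> tup m \<inter> \<Inter>G0" using b G0(3) unfolding wd_def by blast
    have "\<exists>\<eta>\<in>H. b \<in> \<eta>"
    proof (rule ccontr)
      assume "\<not> ?thesis"
      then have "b \<in> tup m \<inter> \<Inter>G0" unfolding H(3) using b by (auto simp: wd_def)
      then show False using \<open>b \<notin> tup m \<inter> \<Inter>G0\<close> by simp
    qed
    then obtain \<eta> where \<eta>: "\<eta> \<in> H" "b \<in> \<eta>" by blast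
    show "b \<in> \<Union>{\<eta> \<in> H. good True \<eta>} \<longleftrightarrow> Xs b \<in> U"
    proof
      assume "b \<in> \<Union>{\<eta> \<in> H. good True \<eta>}"
      then show "Xs b \<in> U" using b unfolding good_def by blast
    next
      assume "Xs b \<in> U"
      then have "\<not> good False \<eta>" using b \<eta>(2) unfolding good_def by blast
      then have "good True \<eta>" using H(1) \<eta>(1) unfolding \<H>_def by blast
      then show "b \<in> \<Union>{\<eta> \<in> H. good True \<eta>}" using \<eta> by blast
    qed
  qed
qed

end

section \<open>From formulas to definable sets\<close>

lemma wf_inst_trm: "wf_trm L t \<Longrightarrow> wf_trm L (inst_trm \<rho> t)"
  by (induction t) (auto split: option.splits)

lemma wf_inst: "wf_fm L \<phi> \<Longrightarrow> wf_fm L (inst \<rho> \<phi>)"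
  by (induction \<phi> arbitrary: \<rho>) (auto simp: wf_inst_trm)

lemma fv_inst_trm: "fv_trm (inst_trm \<rho> t) = {v \<in> fv_trm t. \<rho> v = None}"
  by (induction t) (auto split: option.splits)

lemma fv_inst: "fv (inst \<rho> \<phi>) = {v \<in> fv \<phi>. \<rho> v = None}"
  by (induction \<phi> arbitrary: \<rho>) (auto simp: fv_inst_trm)

lemma params_inst_trm: "params_trm (inst_trm \<rho> t) \<subseteq> params_trm t \<union> ran \<rho>"
  by (induction t) (auto simp: ran_def split: option.splits)

lemma params_inst: "params (inst \<rho> \<phi>) \<subseteq> params \<phi> \<union> ran \<rho>"
proof (induction \<phi> arbitrary: \<rho>)
  case (Eq t u)
  then show ?case using params_inst_trm[of \<rho> t] params_inst_trm[of \<rho> u] by auto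
next
  case (Rel r ts)
  show ?case
  proof
    fix m assume "m \<in> params (inst \<rho> (Rel r ts))"
    then obtain t where "t \<in> set ts" "m \<in> params_trm (inst_trm \<rho> t)" by auto
    then show "m \<in> params (Rel r ts) \<union> ran \<rho>" using params_inst_trm[of \<rho> t] by auto
  qed
next
  case (Exi v \<phi>)
  have "ran (\<rho>(v := None)) \<subseteq> ran \<rho>" by (auto simp: ran_def)
  then show ?case using Exi[of "\<rho>(v := None)"] by (simp del: fun_upd_apply) blast
qed fastforce+

lemma val_inst_trm: "val S s (inst_trm \<rho> t) = val S (\<lambda>v. case \<rho> v of None \<Rightarrow> s v | Some m \<Rightarrow> m) t"
proof (induction t)
  case (Fn f ts)
  then have "map (val S s \<circ> inst_trm \<rho>) ts = map (val S (\<lambda>v. case \<rho> v of None \<Rightarrow> s v | Some m \<Rightarrow> m)) ts" by auto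
  then show ?case by (simp only: inst_trm.simps val.simps map_map)
qed (auto split: option.splits)

lemma holds_inst: "holds S s (inst \<rho> \<phi>) = holds S (\<lambda>v. case \<rho> v of None \<Rightarrow> s v | Some m \<Rightarrow> m) \<phi>"
proof (induction \<phi> arbitrary: \<rho> s)
  case (Rel r ts)
  have "map (val S s \<circ> inst_trm \<rho>) ts = map (val S (\<lambda>v. case \<rho> v of None \<Rightarrow> s v | Some m \<Rightarrow> m)) ts"
    by (auto simp: val_inst_trm)
  then show ?case by (simp only: inst.simps sat.simps map_map)
next
  case (Exi v \<phi>)
  have "(\<lambda>u. case (\<rho>(v := None)) u of None \<Rightarrow> (s(v := m)) u | Some m \<Rightarrow> m) =
      (\<lambda>u. case \<rho> u of None \<Rightarrow> s u | Some m \<Rightarrow> m)(v := m)" for m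
    by (rule ext) (auto split: option.split)
  then show ?case using Exi by simp
qed (simp_all add: val_inst_trm)

lemma asg_map_vars: "distinct x \<Longrightarrow> v \<in> set x \<Longrightarrow> asg x (map s x) v = s v"
  by (auto simp: in_set_conv_nth asg_nth)

context fo_structure
begin

definition vset :: "nat list \<Rightarrow> ('f, 'r, 'm) fm \<Rightarrow> 'm list set" where
  "vset x \<phi> = {a \<in> tup (length x). holds S (asg x a) \<phi>}"

lemma vset_DS:
  assumes x: "distinct x" and \<phi>: "\<phi> \<in> fmla L A (set x)"
  shows "vset x \<phi> \<in> DS A (length x)"
proof -
  have fvs: "fv \<phi> \<subseteq> set x" using \<phi> by (simp add: fmla_def)
  obtain idx where idx: "\<And>v. v \<in> set x \<Longrightarrow> idx v < length x \<and> x ! idx v = v"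
    by (rule index_function[of x]) (rule that)
  obtain \<phi>' where "\<phi>' \<in> fmla L A {..<length x}" and \<phi>': "\<And>s. holds S s \<phi>' = holds S (\<lambda>v. ev s (Inl (idx v))) \<phi>"
    by (rule subst_fmla[OF \<phi>, of "\<lambda>v. Inl (idx v)" "{..<length x}" A]) (use idx in auto)
  moreover have "holds S ((!) a) \<phi>' = holds S (asg x a) \<phi>" if a: "length a = length x" for a
    unfolding \<phi>'
  proof (rule sat_cong)
    fix v assume "v \<in> fv \<phi>"
    then have "v \<in> set x" using fvs by blast
    then show "ev ((!) a) (Inl (idx v)) = asg x a v" using asg_nth[OF x a, of "idx v"] idx[of v] by simp
  qed
  then have "vset x \<phi> = {a \<in> tup (length x). holds S ((!) a) \<phi>'}" by (auto simp: vset_def)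
  ultimately show ?thesis using DS_I by metis
qed

lemma DS_vset:
  assumes x: "distinct x" and X: "X \<in> DS A (length x)"
  obtains \<theta> where "\<theta> \<in> fmla L A (set x)" "vset x \<theta> = X"
proof -
  obtain \<phi> where \<phi>: "\<phi> \<in> fmla L A {..<length x}" "X = {a \<in> tup (length x). holds S ((!) a) \<phi>}"
    using X unfolding DS_def by blast
  have fvs: "fv \<phi> \<subseteq> {..<length x}" using \<phi>(1) by (simp add: fmla_def)
  obtain \<phi>' where \<phi>'F: "\<phi>' \<in> fmla L A (set x)" and \<phi>': "\<And>s. holds S s \<phi>' = holds S (\<lambda>v. ev s (Inl (x ! v))) \<phi>"
    by (rule subst_fmla[OF \<phi>(1), of "\<lambda>v. Inl (x ! v)" "set x" A]) auto
  have "holds S (asg x a) \<phi>' = holds S ((!) a) \<phi>" if a: "length a = length x" for a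
    unfolding \<phi>' by (rule sat_cong) (use fvs asg_nth[OF x a] in auto)
  then have "vset x \<phi>' = X" unfolding \<phi>(2) by (auto simp: vset_def)
  with \<phi>'F show ?thesis by (rule that)
qed

lemma holds_vset:
  assumes "distinct x" "\<phi> \<in> fmla L A (set x)"
  shows "holds S s \<phi> \<longleftrightarrow> map s x \<in> vset x \<phi>"
proof -
  have "holds S (asg x (map s x)) \<phi> = holds S s \<phi>"
    by (rule sat_cong) (use assms asg_map_vars[of x _ s] in \<open>auto simp: fmla_def\<close>)
  then show ?thesis by (simp add: vset_def)
qed

lemma entails_single:
  assumes "distinct x" "\<psi> \<in> fmla L A (set x)" "\<phi> \<in> fmla L B (set x)"
  shows "entails S {\<psi>} \<phi> \<longleftrightarrow> vset x \<psi> \<subseteq> vset x \<phi>"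
proof
  assume "entails S {\<psi>} \<phi>"
  then have *: "holds S s \<psi> \<Longrightarrow> holds S s \<phi>" for s unfolding entails_def by blast
  then show "vset x \<psi> \<subseteq> vset x \<phi>" by (auto simp: vset_def)
next
  assume "vset x \<psi> \<subseteq> vset x \<phi>"
  then have "holds S s \<psi> \<Longrightarrow> holds S s \<phi>" for s
    using holds_vset[OF assms(1,2)] holds_vset[OF assms(1,3)] by blast
  then show "entails S {\<psi>} \<phi>" unfolding entails_def by (intro exI[of _ "{\<psi>}"]) auto
qed

lemma vset_plug:
  assumes "distinct (x @ z)" "length e = length z"
  shows "vset x (plug z e \<psi>) = fib (length x) (vset (x @ z) \<psi>) e" (is "?l = ?r")
proof (rule set_eqI)
  fix a
  show "a \<in> ?l \<longleftrightarrow> a \<in> ?r"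
  proof (cases "length a = length x")
    case True
    have "holds S (asg x a) (plug z e \<psi>) = holds S (asg (x @ z) (a @ e)) \<psi>"
      unfolding plug_def holds_inst
    proof (rule arg_cong2[of _ _ _ _ "\<lambda>s. holds S s"])
      show "(\<lambda>v. case map_of (zip z e) v of None \<Rightarrow> asg x a v | Some m \<Rightarrow> m) = asg (x @ z) (a @ e)"
      proof
        fix v
        have "map_of (zip (x @ z) (a @ e)) v =
            (case map_of (zip x a) v of None \<Rightarrow> map_of (zip z e) v | Some m \<Rightarrow> Some m)"
          using True by (simp add: map_add_def)
        \<comment> \<open>Distinctness keeps the two partial assignments disjoint, so the order in
          which they are consulted does not matter.\<close>
        moreover have "map_of (zip x a) v = None \<or> map_of (zip z e) v = None"
          using assms True by (auto simp: map_of_zip_is_None)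
        ultimately show "(case map_of (zip z e) v of None \<Rightarrow> asg x a v | Some m \<Rightarrow> m) = asg (x @ z) (a @ e) v"
          by (auto simp: asg_def split: option.splits)
      qed
    qed simp
    then show ?thesis using True assms(2) by (simp add: vset_def)
  qed (simp add: vset_def)
qed

lemma plug_fmla:
  assumes "\<psi> \<in> fmla L A (set (x @ z))" "length e = length z"
  shows "plug z e \<psi> \<in> fmla L (A \<union> set e) (set x)"
proof -
  have "ran (map_of (zip z e)) \<subseteq> set e"
  proof
    fix m assume "m \<in> ran (map_of (zip z e))"
    then obtain v where "map_of (zip z e) v = Some m" by (auto simp: ran_def)
    then show "m \<in> set e" by (blast dest: map_of_SomeD set_zip_rightD)
  qed
  moreover have "map_of (zip z e) v = None \<longleftrightarrow> v \<notin> set z" for v using assms(2) by (simp add: map_of_zip_is_None)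
  ultimately show ?thesis
    using assms(1) params_inst[of "map_of (zip z e)" \<psi>] wf_inst[of L \<psi>] fv_inst[of "map_of (zip z e)" \<psi>]
    unfolding fmla_def plug_def by auto
qed

text \<open>An ideal is closed under equivalence of formulas, so it can be recovered from its
  solution sets.\<close>

lemma ideal_vset_iff:
  assumes x: "distinct x" and I: "is_ideal L S x I" and \<theta>: "\<theta> \<in> fmla L A (set x)"
  shows "vset x \<theta> \<in> vset x ` I \<longleftrightarrow> \<theta> \<in> I"
proof
  assume "vset x \<theta> \<in> vset x ` I"
  then obtain \<theta>' where \<theta>': "\<theta>' \<in> I" "vset x \<theta> = vset x \<theta>'" by blast
  have "\<theta>' \<in> fmla L UNIV (set x)" "\<theta> \<in> fmla L UNIV (set x)" using I \<theta>'(1) \<theta> by (auto simp: is_ideal_def fmla_def)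
  moreover from this have "entails S {\<theta>} \<theta>'" using entails_single[OF x] \<theta>'(2) by blast
  ultimately show "\<theta> \<in> I" using I \<theta>'(1) unfolding is_ideal_def by blast
qed (rule imageI)

lemma ideal_vset:
  assumes x: "distinct x" and I: "is_ideal L S x I"
  shows "def_ideal (length x) (vset x ` I)"
  unfolding def_ideal_def
proof (intro conjI ballI impI)
  have IF: "I \<subseteq> fmla L UNIV (set x)" using I by (simp add: is_ideal_def)
  then show "vset x ` I \<subseteq> DS UNIV (length x)" using vset_DS[OF x] by blast
  have "Bot \<in> I" using I by (simp add: is_ideal_def)
  moreover have "vset x Bot = {}" by (simp add: vset_def)
  ultimately show "{} \<in> vset x ` I" by (metis imageI)
  fix X assume "X \<in> vset x ` I"
  then obtain \<phi> where \<phi>: "\<phi> \<in> I" "X = vset x \<phi>" by blast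
  {
    fix Y assume Y: "Y \<in> DS UNIV (length x)" "Y \<subseteq> X"
    obtain \<theta> where \<theta>: "\<theta> \<in> fmla L UNIV (set x)" "vset x \<theta> = Y" using DS_vset[OF x Y(1)] .
    have "entails S {\<theta>} \<phi>" using entails_single[OF x \<theta>(1), of \<phi> UNIV] IF \<phi> \<theta>(2) Y(2) by blast
    then have "\<theta> \<in> I" using I \<phi>(1) \<theta>(1) unfolding is_ideal_def by blast
    then show "Y \<in> vset x ` I" using \<theta>(2) by blast
  }
  fix Y assume "Y \<in> vset x ` I"
  then obtain \<psi> where \<psi>: "\<psi> \<in> I" "Y = vset x \<psi>" by blast
  have "Disj \<phi> \<psi> \<in> I" using I \<phi>(1) \<psi>(1) by (simp add: is_ideal_def)
  moreover have "vset x (Disj \<phi> \<psi>) = X \<union> Y" unfolding \<phi>(2) \<psi>(2) by (auto simp: vset_def Disj_def)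
  ultimately show "X \<union> Y \<in> vset x ` I" by (metis imageI)
qed

lemma fresh_vars:
  fixes x :: "nat list"
  assumes "distinct x"
  obtains z where "length z = l" "distinct (x @ z)"
proof -
  have "infinite (- set x)" by (simp add: finite_compl infinite_UNIV_nat)
  then obtain Z where "Z \<subseteq> - set x" "finite Z" "card Z = l" using infinite_arbitrarily_large by metis
  moreover from this obtain z where "set z = Z" "distinct z" using finite_distinct_list by metis
  ultimately show ?thesis using that[of z] distinct_card[of z] assms by auto
qed

text \<open>Every fiber of a parameter-free set is an instance of one \<open>L\<close>-formula in
  \<open>x\<close> and fresh variables \<open>z\<close>. Invariance and S1, given for such
  instances, thus become statements about fibers.\<close>

lemma S1_ideal_vset:
  assumes x: "distinct x" and I: "S1_ideal L S {} x I"
  shows "S1 (length x) (vset x ` I)"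
proof -
  have ideal: "is_ideal L S x I" and inv: "invariant_ideal L S {} x I" using I by (simp_all add: S1_ideal_def)
  have formula: "\<exists>z \<psi>. length z = l \<and> distinct (x @ z) \<and> \<psi> \<in> fmla L {} (set (x @ z)) \<and>
      (\<forall>e. length e = l \<longrightarrow> vset x (plug z e \<psi>) = fib (length x) Y e \<and> plug z e \<psi> \<in> fmla L UNIV (set x))"
    if Y: "Y \<in> DS {} (length x + l)" for Y l
  proof -
    obtain z where z: "length z = l" "distinct (x @ z)" by (rule fresh_vars[OF x])
    have "Y \<in> DS {} (length (x @ z))" using Y z(1) by simp
    then obtain \<psi> where \<psi>: "\<psi> \<in> fmla L {} (set (x @ z))" "vset (x @ z) \<psi> = Y" by (rule DS_vset[OF z(2)])
    have "plug z e \<psi> \<in> fmla L UNIV (set x)" if "length e = l" for e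
      using plug_fmla[OF \<psi>(1), of e] z(1) that by (auto simp: fmla_def)
    then show ?thesis using z \<psi> vset_plug[OF z(2)] by (intro exI[of _ z] exI[of _ \<psi>]) auto
  qed
  show ?thesis
    unfolding S1_def
  proof (intro conjI ballI allI impI)
    show "def_ideal (length x) (vset x ` I)" by (rule ideal_vset[OF x ideal])
  next
    fix h X assume h: "h \<in> Aut {}" and X: "X \<in> vset x ` I"
    then have "X \<in> DS UNIV (length x)" using def_ideal_DS[OF ideal_vset[OF x ideal]] by blast
    then obtain e Y where e: "Y \<in> DS {} (length x + length e)" "X = fib (length x) Y e"
      unfolding fib_def by (rule DS_fiber_param)
    obtain z \<psi> where z: "length z = length e" "distinct (x @ z)" "\<psi> \<in> fmla L {} (set (x @ z))"
      "\<And>e'. length e' = length e \<Longrightarrow> vset x (plug z e' \<psi>) = fib (length x) Y e' \<and> plug z e' \<psi> \<in> fmla L UNIV (set x)"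
      using formula[OF e(1)] by metis
    have "vset x (plug z e \<psi>) \<in> vset x ` I" using z(4)[of e] X e(2) by simp
    then have "plug z e \<psi> \<in> I" using ideal_vset_iff[OF x ideal, of "plug z e \<psi>" UNIV] z(4)[of e] by blast
    then have "plug z (map h e) \<psi> \<in> I"
      using inv z(1-3) Aut_equiv[OF h] unfolding invariant_ideal_def by metis
    then have "vset x (plug z (map h e) \<psi>) \<in> vset x ` I" by (rule imageI)
    then show "map h ` X \<in> vset x ` I" using z(4)[of "map h e"] Aut_fib[OF h e(1) refl] e(2) by simp
  next
    fix l Y c
    assume a: "Y \<in> DS {} (length x + l) \<and> (\<forall>i. length (c i) = l) \<and> indiscernible L S {} c \<and>
      fib (length x) Y (c 0) \<inter> fib (length x) Y (c 1) \<in> vset x ` I"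
    then obtain z \<psi> where z: "length z = l" "distinct (x @ z)" "\<psi> \<in> fmla L {} (set (x @ z))"
      "\<And>e'. length e' = l \<Longrightarrow> vset x (plug z e' \<psi>) = fib (length x) Y e' \<and> plug z e' \<psi> \<in> fmla L UNIV (set x)"
      using formula[of Y l] by metis
    have c: "vset x (plug z (c i) \<psi>) = fib (length x) Y (c i)" "plug z (c i) \<psi> \<in> fmla L UNIV (set x)" for i
      using z(4)[of "c i"] a by auto
    let ?C = "Conj (plug z (c 0) \<psi>) (plug z (c 1) \<psi>)"
    have "?C \<in> fmla L UNIV (set x)" using c(2)[of 0] c(2)[of 1] by (simp add: fmla_def)
    moreover have "vset x ?C = fib (length x) Y (c 0) \<inter> fib (length x) Y (c 1)"
      unfolding c(1)[symmetric] by (auto simp: vset_def)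
    ultimately have "?C \<in> I" using ideal_vset_iff[OF x ideal] a by metis
    then have "plug z (c 0) \<psi> \<in> I" using I z(1-3) a unfolding S1_ideal_def by metis
    then show "fib (length x) Y (c 0) \<in> vset x ` I" using c(1)[of 0] by (metis imageI)
  qed
qed

text \<open>Types are closed under conjunction: a finite part of the type implying a formula of the
  ideal yields one definable set in the ideal that contains \<open>a\<close>.\<close>

lemma wide_over_iff:
  assumes x: "distinct x" and I: "is_ideal L S x I"
  shows "wide_over L S x I A a \<longleftrightarrow> wd (length x) (vset x ` I) A a"
proof
  assume w: "wide_over L S x I A a"
  then have al: "length a = length x" by (simp add: wide_over_def)
  show "wd (length x) (vset x ` I) A a"
    unfolding wd_def
  proof (intro conjI ballI notI al)
    fix X assume X: "X \<in> vset x ` I \<inter> DS A (length x)" "a \<in> X"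
    then obtain \<theta> where \<theta>: "\<theta> \<in> fmla L A (set x)" "vset x \<theta> = X" using DS_vset[OF x, of X A] by blast
    then have "\<theta> \<in> I" using ideal_vset_iff[OF x I \<theta>(1)] X(1) by simp
    moreover have "\<theta> \<in> tp L S x a A" using \<theta> X(2) by (auto simp: tp_def vset_def)
    then have "entails S (tp L S x a A) \<theta>" unfolding entails_def by (intro exI[of _ "{\<theta>}"]) auto
    ultimately show False using w by (auto simp: wide_over_def wide_def)
  qed
next
  assume w: "wd (length x) (vset x ` I) A a"
  then have al: "length a = length x" by (simp add: wd_def)
  show "wide_over L S x I A a"
    unfolding wide_over_def wide_def
  proof (intro conjI al notI)
    assume "\<exists>\<theta>\<in>I. entails S (tp L S x a A) \<theta>"
    then obtain \<theta> \<Sigma> where \<theta>: "\<theta> \<in> I" and \<Sigma>: "\<Sigma> \<subseteq> tp L S x a A" "finite \<Sigma>"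
      "\<And>s. (\<forall>\<sigma>\<in>\<Sigma>. holds S s \<sigma>) \<Longrightarrow> holds S s \<theta>" unfolding entails_def by blast
    let ?X = "tup (length x) \<inter> \<Inter>(vset x ` \<Sigma>)"
    have XA: "?X \<in> DS A (length x)"
      by (rule DS_INT) (use \<Sigma>(1,2) vset_DS[OF x] in \<open>auto simp: tp_def\<close>)
    have "?X \<subseteq> vset x \<theta>" using \<Sigma>(3) by (auto simp: vset_def)
    then have "?X \<in> vset x ` I" using def_ideal_down[OF ideal_vset[OF x I] _ _ XA] \<theta> by blast
    moreover have "a \<in> ?X" using \<Sigma>(1) al by (auto simp: tp_def vset_def)
    ultimately show False using w XA unfolding wd_def by blast
  qed
qed

lemma bool_comb_fmla:
  assumes "\<phi> \<in> fmla L {} (set (x @ y))" "\<theta> \<in> bool_comb y \<phi>"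
  shows "\<theta> \<in> fmla L UNIV (set x)"
  using assms(2)
proof induction
  case (1 b)
  then show ?case using plug_fmla[OF assms(1), of b] by (auto simp: fmla_def)
qed (simp_all add: fmla_def)

text \<open>Wideness of \<open>p\<close> is exactly what allows an extension to a complete type
  avoiding the ideal. The extension decides no instance of \<phi> anew: an instance in
  \<open>U\<close> is consistent with \<open>p\<close>, hence in \<open>p\<close> by
  maximality.\<close>

lemma global_type_ultra:
  assumes x: "distinct (x @ y)" and I: "is_ideal L S x I" and \<phi>: "\<phi> \<in> fmla L {} (set (x @ y))"
    and p: "global_phi_type S y \<phi> p" and w: "wide S I p"
  obtains U where "ultra (length x) U" "U \<inter> vset x ` I = {}"
    "\<And>b. length b = length y \<Longrightarrow> plug y b \<phi> \<in> p \<longleftrightarrow> vset x (plug y b \<phi>) \<in> U"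
proof -
  have dx: "distinct x" using x by simp
  have pB: "p \<subseteq> bool_comb y \<phi>" using p by (simp add: global_phi_type_def)
  then have pF: "p \<subseteq> fmla L UNIV (set x)" using bool_comb_fmla[OF \<phi>] by blast
  have GDS: "vset x ` p \<subseteq> DS UNIV (length x)" using pF vset_DS[OF dx] by blast
  have "tup (length x) \<inter> \<Inter>G0 \<notin> vset x ` I" if G0: "finite G0" "G0 \<subseteq> vset x ` p" for G0
  proof
    assume "tup (length x) \<inter> \<Inter>G0 \<in> vset x ` I"
    then obtain \<theta> where \<theta>: "\<theta> \<in> I" "vset x \<theta> = tup (length x) \<inter> \<Inter>G0" by blast
    obtain \<Sigma> where \<Sigma>: "\<Sigma> \<subseteq> p" "finite \<Sigma>" "G0 = vset x ` \<Sigma>" using finite_subset_image[OF G0] by blast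
    have \<theta>F: "\<theta> \<in> fmla L UNIV (set x)" using I \<theta>(1) by (auto simp: is_ideal_def)
    have "holds S s \<theta>" if s: "\<forall>\<sigma>\<in>\<Sigma>. holds S s \<sigma>" for s
    proof -
      have "map s x \<in> vset x \<sigma>" if "\<sigma> \<in> \<Sigma>" for \<sigma>
      proof -
        have "\<sigma> \<in> fmla L UNIV (set x)" using \<Sigma>(1) pF that by blast
        then show ?thesis using holds_vset[OF dx] s that by blast
      qed
      then have "map s x \<in> vset x \<theta>" unfolding \<theta>(2) \<Sigma>(3) by auto
      then show ?thesis using holds_vset[OF dx \<theta>F] by blast
    qed
    then have "entails S p \<theta>" using \<Sigma>(1,2) unfolding entails_def by blast
    then show False using w \<theta>(1) unfolding wide_def by blast
  qed
  then obtain U where U: "ultra (length x) U" "vset x ` p \<subseteq> U" "U \<inter> vset x ` I = {}"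
    using ultra_exists[OF ideal_vset[OF dx I] GDS] by metis
  have "plug y b \<phi> \<in> p \<longleftrightarrow> vset x (plug y b \<phi>) \<in> U" if b: "length b = length y" for b
  proof
    assume inU: "vset x (plug y b \<phi>) \<in> U"
    show "plug y b \<phi> \<in> p"
    proof (rule ccontr)
      assume n: "plug y b \<phi> \<notin> p"
      let ?q = "insert (plug y b \<phi>) p"
      have "consistent S ?q"
        unfolding consistent_def
      proof (intro allI impI)
        fix \<Sigma> assume \<Sigma>: "\<Sigma> \<subseteq> ?q" "finite \<Sigma>"
        have "vset x ` \<Sigma> \<subseteq> U" using \<Sigma>(1) U(2) inU by blast
        then have "tup (length x) \<inter> \<Inter>(vset x ` \<Sigma>) \<in> U" using ultra_INT[OF U(1)] \<Sigma>(2) by simp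
        moreover have "{} \<notin> U" using U(1) by (simp add: ultra_def)
        ultimately obtain a where "a \<in> tup (length x) \<inter> \<Inter>(vset x ` \<Sigma>)" by (metis ex_in_conv)
        then have "\<forall>\<sigma>\<in>\<Sigma>. holds S (asg x a) \<sigma>" by (simp add: vset_def)
        then show "\<exists>s. \<forall>\<sigma>\<in>\<Sigma>. holds S s \<sigma>" by blast
      qed
      moreover have "?q \<subseteq> bool_comb y \<phi>" using pB bool_comb.intros(1)[OF b] by blast
      ultimately have "?q = p" using p unfolding global_phi_type_def by blast
      then show False using n by blast
    qed
  qed (use U(2) in blast)
  then show ?thesis using that U by blast
qed

end

lemma (in monster) elementary_submodel_mdl:
  assumes "elementary_submodel L S M"
  shows "mdl M"
proof (rule mdlI)
  fix e Y m assume e: "set e \<subseteq> M" and Y: "Y \<in> DS {} (Suc (length e))" "m # e \<in> Y"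
  obtain \<phi> where \<phi>: "\<phi> \<in> fmla L {} {..<Suc (length e)}" "Y = {a \<in> tup (Suc (length e)). holds S ((!) a) \<phi>}"
    using Y(1) unfolding DS_def by blast
  obtain m0 where m0: "m0 \<in> M" using assms unfolding elementary_submodel_def by blast
  \<comment> \<open>Variable \<open>0\<close> is kept for the witness and variables \<open>1\<close>
    to \<open>length e\<close> carry \<open>e\<close>. The default \<open>m0\<close> keeps the whole
    assignment inside \<open>M\<close>.\<close>
  define s where "s i = (if 0 < i \<and> i \<le> length e then e ! (i - 1) else m0)" for i
  have range: "range s \<subseteq> M" using e m0 by (auto simp: s_def)
  have elem: "sat S M t \<psi> \<longleftrightarrow> holds S t \<psi>" if "\<psi> \<in> fmla L {} UNIV" "range t \<subseteq> M" for t \<psi>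
    using assms that unfolding elementary_submodel_def by blast
  have s_upd: "holds S (s(0 := x)) \<phi> = holds S ((!) (x # e)) \<phi>" for x
  proof (rule sat_cong)
    fix v assume "v \<in> fv \<phi>"
    then have "v < Suc (length e)" using \<phi>(1) by (auto simp: fmla_def)
    then show "(s(0 := x)) v = (x # e) ! v" by (cases v) (auto simp: s_def)
  qed
  have \<phi>F: "\<phi> \<in> fmla L {} UNIV" "Exi 0 \<phi> \<in> fmla L {} UNIV" using \<phi>(1) by (auto simp: fmla_def)
  have "holds S (s(0 := m)) \<phi>" using Y(2) \<phi>(2) s_upd by simp
  then have "holds S s (Exi 0 \<phi>)" by auto
  then have "sat S M s (Exi 0 \<phi>)" using elem[OF \<phi>F(2) range] by simp
  then obtain m' where m': "m' \<in> M" "sat S M (s(0 := m')) \<phi>" by auto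
  have "range (s(0 := m')) \<subseteq> M" using range m'(1) by auto
  then have "holds S (s(0 := m')) \<phi>" using elem[OF \<phi>F(1)] m'(2) by blast
  then show "\<exists>m\<in>M. m # e \<in> Y" using m'(1) \<phi>(2) s_upd by auto
qed

section \<open>Ladders\<close>

lemma independent_snoc:
  "independent L S x Ix y Iy M (cs @ [c]) \<longleftrightarrow> independent L S x Ix y Iy M cs \<and>
     (case c of Inl a \<Rightarrow> wide_over L S x Ix (M \<union> (\<Union>c\<in>set cs. entry_elems c)) a
      | Inr b \<Rightarrow> wide_over L S y Iy (M \<union> (\<Union>c\<in>set cs. entry_elems c)) b)"
  unfolding independent_def Let_def by (auto simp: nth_append less_Suc_eq cong: sum.case_cong)

lemma independent_Nil: "independent L S x Ix y Iy M []"
  by (simp add: independent_def)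

lemma independent_ladder:
  assumes "\<forall>i<k. wide_over L S x Ix (M \<union> (\<Union>j<i. set (a j) \<union> set (b j))) (a i) \<and>
      wide_over L S y Iy (M \<union> (\<Union>j<i. set (a j) \<union> set (b j)) \<union> set (a i)) (b i)"
  shows "independent L S x Ix y Iy M (concat (map (\<lambda>i. [Inl (a i), Inr (b i)]) [0..<k]))"
  using assms
proof (induction k)
  case (Suc k)
  let ?cs = "concat (map (\<lambda>i. [Inl (a i), Inr (b i)]) [0..<k])"
  have elems: "(\<Union>c\<in>set ?cs. entry_elems c) = (\<Union>j<k. set (a j) \<union> set (b j))"
    by (auto simp: entry_elems_def)
  have "independent L S x Ix y Iy M ((?cs @ [Inl (a k)]) @ [Inr (b k)])"
    unfolding independent_snoc using Suc elems by (simp add: entry_elems_def Un_ac)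
  then show ?case by simp
qed (simp add: independent_Nil)

lemma independent_ladder_rev:
  assumes "\<forall>i<k. wide_over L S y Iy (M \<union> (\<Union>j<i. set (a j) \<union> set (b j))) (b i) \<and>
      wide_over L S x Ix (M \<union> (\<Union>j<i. set (a j) \<union> set (b j)) \<union> set (b i)) (a i)"
  shows "independent L S x Ix y Iy M (concat (map (\<lambda>i. [Inr (b i), Inl (a i)]) [0..<k]))"
  using assms
proof (induction k)
  case (Suc k)
  let ?cs = "concat (map (\<lambda>i. [Inr (b i), Inl (a i)]) [0..<k])"
  have elems: "(\<Union>c\<in>set ?cs. entry_elems c) = (\<Union>j<k. set (a j) \<union> set (b j))"
    by (auto simp: entry_elems_def)
  have "independent L S x Ix y Iy M ((?cs @ [Inr (b k)]) @ [Inl (a k)])"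
    unfolding independent_snoc using Suc elems by (simp add: entry_elems_def Un_ac)
  then show ?case by simp
qed (simp add: independent_Nil)

text \<open>Bridges the indexing from \<open>1\<close> in \<open>ladder_seq\<close> and the indexing
  from \<open>0\<close> in the constructions.\<close>

lemma ladder_seq_shift:
  "ladder_seq k (\<lambda>i. a (i - 1)) (\<lambda>i. b (i - 1)) = concat (map (\<lambda>i. [Inl (a i), Inr (b i)]) [0..<k])"
proof -
  have "[1..<k + 1] = map Suc [0..<k]" by (simp add: map_Suc_upt del: upt_Suc)
  then show ?thesis unfolding ladder_seq_def by (simp add: comp_def del: upt_Suc)
qed

text \<open>The index map \<open>i \<mapsto> k - i\<close> sends \<open>k, ..., 1\<close> to
  \<open>0, ..., k - 1\<close>. It also reverses the inequality in the ladder, matching the second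
  condition of \<open>stable_relation\<close>.\<close>

lemma rev_ladder_seq_shift:
  "rev (ladder_seq k (\<lambda>i. a (k - i)) (\<lambda>i. b (k - i))) = concat (map (\<lambda>i. [Inr (b i), Inl (a i)]) [0..<k])"
proof -
  have "rev [1..<k + 1] = map (\<lambda>i. k - i) [0..<k]"
    by (rule nth_equalityI) (auto simp: rev_nth simp del: upt_Suc)
  then have "map (\<lambda>i. rev [Inl (a (k - i)), Inr (b (k - i))]) (rev [1..<k + 1])
      = map (\<lambda>i. [Inr (b i), Inl (a i)]) [0..<k]" by simp
  then show ?thesis unfolding ladder_seq_def rev_concat rev_map map_map comp_def by (simp only:)
qed

theorem theorem3p8:
  fixes L :: "('f, 'r) language"
    and T :: "('f, 'r, 'm) fm set"
    and \<kappa> :: "'k rel"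
    and S :: "('f, 'r, 'm) fo_struct"
    and x y :: "nat list"
    and Ix Iy :: "('f, 'r, 'm) fm set"
    and \<phi> :: "('f, 'r, 'm) fm"
    and p :: "('f, 'r, 'm) fm set"
    and M :: "'m set"
  assumes "complete_theory L T"
    and "monster_model L T \<kappa> S"
    and "distinct (x @ y)"
    and "S1_ideal L S {} x Ix"
    and "S1_ideal L S {} y Iy"
    and "\<phi> \<in> fmla L {} (set (x @ y))"
    and "I_stable L \<kappa> S x Ix y Iy \<phi>"
    and "global_phi_type S y \<phi> p"
    and "wide S Ix p"
    and "small_model L \<kappa> S M"
  shows "\<exists>\<psi>\<in>fmla L M (set y). \<forall>b. wide_over L S y Iy M b \<longrightarrow>
           (plug y b \<phi> \<in> p \<longleftrightarrow> holds S (asg y b) \<psi>)"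
proof -
  interpret monster L S \<kappa>
    using assms(2) by unfold_locales (simp_all add: monster_model_def)
  have x: "distinct x" and y: "distinct y" using assms(3) by simp_all
  have ideals: "is_ideal L S x Ix" "is_ideal L S y Iy" using assms(4,5) by (simp_all add: S1_ideal_def)
  let ?n = "length x" and ?m = "length y" and ?J = "vset x ` Ix" and ?K = "vset y ` Iy"
  note wide_iff = wide_over_iff[OF x ideals(1)] wide_over_iff[OF y ideals(2)]
  define F where "F a b = holds S (asg (x @ y) (a @ b)) \<phi>" for a b
  obtain k where k: "I_stable_of_ladder L \<kappa> S x Ix y Iy \<phi> k" using assms(7) by (auto simp: I_stable_def)
  have no_ladder: False
    if "\<forall>i\<in>{1..k}. length (a i) = ?n \<and> length (b i) = ?m"
      "independent L S x Ix y Iy M (ladder_seq k a b) \<or> independent L S x Ix y Iy M (rev (ladder_seq k a b))"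
      "\<forall>i\<in>{1..k}. \<forall>j\<in>{1..k}. F (a i) (b j) \<longleftrightarrow> i \<le> j" for a b
    using k that assms(10) unfolding I_stable_of_ladder_def F_def by blast
  interpret stable_relation L S \<kappa> M ?n ?J ?m ?K F k
  proof
    show "small M" using assms(10) by (simp add: small_model_def small_def)
    show "mdl M" using assms(10) elementary_submodel_mdl by (simp add: small_model_def)
    show "S1 ?n ?J" by (rule S1_ideal_vset[OF x assms(4)])
    show "S1 ?m ?K" by (rule S1_ideal_vset[OF y assms(5)])
    have "{w \<in> tup (?n + ?m). F (take ?n w) (drop ?n w)} = vset (x @ y) \<phi>" by (simp add: vset_def F_def)
    then show "{w \<in> tup (?n + ?m). F (take ?n w) (drop ?n w)} \<in> DS {} (?n + ?m)"
      using vset_DS[OF assms(3,6)] by simp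
    show "\<not> (\<exists>a b. (\<forall>i<k. wd ?n ?J (M \<union> (\<Union>j<i. set (a j) \<union> set (b j))) (a i) \<and>
         wd ?m ?K (M \<union> (\<Union>j<i. set (a j) \<union> set (b j)) \<union> set (a i)) (b i)) \<and>
       (\<forall>i<k. \<forall>j<k. F (a i) (b j) \<longleftrightarrow> i \<le> j))"
    proof (rule notI, elim exE conjE)
      fix a b
      assume w: "\<forall>i<k. wd ?n ?J (M \<union> (\<Union>j<i. set (a j) \<union> set (b j))) (a i) \<and>
           wd ?m ?K (M \<union> (\<Union>j<i. set (a j) \<union> set (b j)) \<union> set (a i)) (b i)"
        and F: "\<forall>i<k. \<forall>j<k. F (a i) (b j) \<longleftrightarrow> i \<le> j"
      show False
      proof (rule no_ladder)
        have "length (a i) = ?n \<and> length (b i) = ?m" if "i < k" for i using w that by (simp add: wd_def)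
        then show "\<forall>i\<in>{1..k}. length (a (i - 1)) = ?n \<and> length (b (i - 1)) = ?m" by auto
        have "independent L S x Ix y Iy M (ladder_seq k (\<lambda>i. a (i - 1)) (\<lambda>i. b (i - 1)))"
          unfolding ladder_seq_shift by (rule independent_ladder) (use w in \<open>simp only: wide_iff\<close>)
        then show "independent L S x Ix y Iy M (ladder_seq k (\<lambda>i. a (i - 1)) (\<lambda>i. b (i - 1))) \<or>
           independent L S x Ix y Iy M (rev (ladder_seq k (\<lambda>i. a (i - 1)) (\<lambda>i. b (i - 1))))" ..
        show "\<forall>i\<in>{1..k}. \<forall>j\<in>{1..k}. F (a (i - 1)) (b (j - 1)) \<longleftrightarrow> i \<le> j"
        proof (intro ballI)
          fix i j assume "i \<in> {1..k}" "j \<in> {1..k}"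
          then have "i - 1 < k" "j - 1 < k" "i - 1 \<le> j - 1 \<longleftrightarrow> i \<le> j" by auto
          then show "F (a (i - 1)) (b (j - 1)) \<longleftrightarrow> i \<le> j" using F by blast
        qed
      qed
    qed
    show "\<not> (\<exists>a b. (\<forall>i<k. wd ?m ?K (M \<union> (\<Union>j<i. set (a j) \<union> set (b j))) (b i) \<and>
         wd ?n ?J (M \<union> (\<Union>j<i. set (a j) \<union> set (b j)) \<union> set (b i)) (a i)) \<and>
       (\<forall>i<k. \<forall>j<k. F (a i) (b j) \<longleftrightarrow> j \<le> i))"
    proof (rule notI, elim exE conjE)
      fix a b
      assume w: "\<forall>i<k. wd ?m ?K (M \<union> (\<Union>j<i. set (a j) \<union> set (b j))) (b i) \<and>
           wd ?n ?J (M \<union> (\<Union>j<i. set (a j) \<union> set (b j)) \<union> set (b i)) (a i)"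
        and F: "\<forall>i<k. \<forall>j<k. F (a i) (b j) \<longleftrightarrow> j \<le> i"
      show False
      proof (rule no_ladder)
        have "length (a i) = ?n \<and> length (b i) = ?m" if "i < k" for i using w that by (simp add: wd_def)
        then show "\<forall>i\<in>{1..k}. length (a (k - i)) = ?n \<and> length (b (k - i)) = ?m" by auto
        have "independent L S x Ix y Iy M (rev (ladder_seq k (\<lambda>i. a (k - i)) (\<lambda>i. b (k - i))))"
          unfolding rev_ladder_seq_shift by (rule independent_ladder_rev) (use w in \<open>simp only: wide_iff\<close>)
        then show "independent L S x Ix y Iy M (ladder_seq k (\<lambda>i. a (k - i)) (\<lambda>i. b (k - i))) \<or>
           independent L S x Ix y Iy M (rev (ladder_seq k (\<lambda>i. a (k - i)) (\<lambda>i. b (k - i))))" ..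
        show "\<forall>i\<in>{1..k}. \<forall>j\<in>{1..k}. F (a (k - i)) (b (k - j)) \<longleftrightarrow> i \<le> j"
        proof (intro ballI)
          fix i j assume "i \<in> {1..k}" "j \<in> {1..k}"
          then have "k - i < k" "k - j < k" "k - j \<le> k - i \<longleftrightarrow> i \<le> j" by auto
          then show "F (a (k - i)) (b (k - j)) \<longleftrightarrow> i \<le> j" using F by blast
        qed
      qed
    qed
  qed
  obtain U where U: "ultra ?n U" "U \<inter> ?J = {}"
    and pU: "\<And>b. length b = ?m \<Longrightarrow> plug y b \<phi> \<in> p \<longleftrightarrow> vset x (plug y b \<phi>) \<in> U"
    using global_type_ultra[OF assms(3) ideals(1) assms(6,8,9)] by metis
  obtain \<Psi> where \<Psi>: "\<Psi> \<in> DS M ?m" "\<And>b. wd ?m ?K M b \<Longrightarrow> b \<in> \<Psi> \<longleftrightarrow> Xs b \<in> U"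
    using definable[OF U] by metis
  obtain \<psi> where \<psi>: "\<psi> \<in> fmla L M (set y)" "vset y \<psi> = \<Psi>" by (rule DS_vset[OF y \<Psi>(1)])
  show ?thesis
  proof (intro bexI[OF _ \<psi>(1)] allI impI)
    fix b assume "wide_over L S y Iy M b"
    then have b: "wd ?m ?K M b" unfolding wide_iff .
    then have bl: "length b = ?m" by (simp add: wd_def)
    have "vset x (plug y b \<phi>) = Xs b"
      unfolding vset_plug[OF assms(3) bl] using bl by (auto simp: fib_def vset_def Xs_def F_def)
    then have "plug y b \<phi> \<in> p \<longleftrightarrow> b \<in> vset y \<psi>" using pU[OF bl] \<Psi>(2)[OF b] \<psi>(2) by simp
    then show "plug y b \<phi> \<in> p \<longleftrightarrow> holds S (asg y b) \<psi>" using bl by (simp add: vset_def)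
  qed
qed

end
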